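(* (Defect identity.) Let $k$ be a number field, $\mathbf{q}=(q_0,\dots,q_n)$ positive integers. For every $\mathfrak{p} \in \mathbb{WP}^n_{\mathbf{q}}(k)$, with $\widehat{\mathfrak{h}}_k$ and $\delta_k$ computed from a representative $\mathbf{x}\in k^{n+1}$ of $\mathfrak{p}$, $$\mathfrak{h}_k(\mathfrak{p}) = \frac{\widehat{\mathfrak{h}}_k(\mathfrak{p})}{\delta_k(\mathfrak{p})}.$$ In particular $\mathfrak{h}_k(\mathfrak{p}) \leq \widehat{\mathfrak{h}}_k(\mathfrak{p})$, with equality if and only if $\theta_v(\mathbf{x}) \in \mathbb{Z}$ for every finite place $v$ of $k$. Over $k = \mathbb{Q}$, for an integral representative $\mathbf{x}\in\mathbb{Z}^{n+1}$ with $\operatorname{wgcd}(\mathbf{x}) = 1$, equality holds if and only if $\gcd(x_0,\dots,x_n) = 1$.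
   Context: Weighted projective space: $\mathbb{WP}^n_{\mathbf{q}}(\bar{k})$ is the set of nonzero tuples $\mathbf{x} \in \bar{k}^{n+1}$ modulo $\mathbf{x} \sim (\lambda^{q_0}x_0, \dots, \lambda^{q_n}x_n)$, $\lambda \in \bar{k}^{\times}$; $\mathbb{WP}^n_{\mathbf{q}}(k)$ is the subset of classes admitting a representative in $k^{n+1}$. For a finite place $v$ of $k$, $\mathfrak{P}_v$ is the corresponding prime ideal, $v(\cdot)$ the valuation with $v(k^\times)=\mathbb{Z}$, $n_v = [k_v:\mathbb{Q}_v]$ the local degree, and $|x|_v^{n_v} = \operatorname{Nm}(\mathfrak{P}_v)^{-v(x)}$. At Archimedean places $|\cdot|_v$ is the usual absolute value. For nonzero $\mathbf{x}\in k^{n+1}$ and finite $v$, $\theta_v(\mathbf{x}) = \min_{x_i\neq0} v(x_i)/q_i$. Then: - weighted height: $\mathfrak{h}_k(\mathfrak{p}) = \prod_{v} \max_i |x_i|_v^{n_v/q_i}$, product over all places of $k$; - tautological height: $\widehat{\mathfrak{h}}_k(\mathfrak{p}) = \prod_{v \text{ finite}} \operatorname{Nm}(\mathfrak{P}_v)^{-\lfloor\theta_v(\mathbf{x})\rfloor} \cdot \prod_{v\mid\infty} \max_i |x_i|_v^{n_v/q_i}$; - defect: $\delta_k(\mathfrak{p}) = \prod_{v\text{ finite}} \operatorname{Nm}(\mathfrak{P}_v)^{\theta_v(\mathbf{x}) - \lfloor\theta_v(\mathbf{x})\rfloor}$. The last two are invariant under scaling $\mathbf{x}$ by $\lambda\in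 k^\times$. For $\mathbf{x}\in\mathbb{Z}^{n+1}$ nonzero, $\operatorname{wgcd}(\mathbf{x})$ is the largest positive integer $d$ with $d^{q_i}\mid x_i$ for all $i$. *)

theory Defs
  imports
    "HOL-Analysis.Analysis"
    "HOL-Algebra.Ideal_Product"
    "HOL-Algebra.QuotRing"
    "HOL-Algebra.Algebraic_Closure_Type"
begin

section \<open>Number fields and their places\<close>

definition number_field :: "'a::field_char_0 itself \<Rightarrow> bool" where
  "number_field _ \<longleftrightarrow>
     (\<exists>B. finite_dimensional_vector_space (\<lambda>(r :: rat) (x :: 'a). of_rat r * x) B)"

definition ring_of_integers :: "'a::field_char_0 ring" where
  "ring_of_integers = ring_of_type_algebra \<lparr>carrier := {x. algebraic_int x}\<rparr>"

text \<open>The finite places are indexed by their prime ideals \<open>P\<close>, the nonzero primes of the ring of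
  integers; the Archimedean ones are the complex embeddings up to complex conjugation.\<close>

definition finite_places :: "'a::field_char_0 set set" where
  "finite_places = {P. primeideal P ring_of_integers \<and> P \<noteq> {0}}"

definition complex_embeddings :: "('a::field_char_0 \<Rightarrow> complex) set" where
  "complex_embeddings = ring_hom ring_of_type_algebra ring_of_type_algebra"

definition arch_places :: "('a::field_char_0 \<Rightarrow> complex) set set" where
  "arch_places = complex_embeddings //
     {(\<sigma>, \<tau>). \<sigma> \<in> complex_embeddings \<and> \<tau> \<in> complex_embeddings \<and> (\<tau> = \<sigma> \<or> \<tau> = cnj \<circ> \<sigma>)}"

definition ideal_norm :: "'a::field_char_0 set \<Rightarrow> nat" where
  "ideal_norm P = card (carrier (ring_of_integers Quot P))"

text \<open>Ideals are multiplied in the monoid \<^term>\<open>ideals_set ring_of_integers\<close>, so this is the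
  exponent of \<open>P\<close> in the principal ideal generated by a nonzero integer \<open>a\<close>.\<close>

definition ideal_order :: "'a::field_char_0 set \<Rightarrow> 'a \<Rightarrow> nat" where
  "ideal_order P a = (GREATEST m. a \<in> P [^]\<^bsub>ideals_set ring_of_integers\<^esub> m)"

text \<open>Only meaningful for nonzero \<open>x\<close>.\<close>

definition valuation :: "'a::field_char_0 set \<Rightarrow> 'a \<Rightarrow> int" where
  "valuation P x = (THE m. \<exists>a b. algebraic_int a \<and> algebraic_int b \<and> a \<noteq> 0 \<and> b \<noteq> 0 \<and>
     x = a / b \<and> m = int (ideal_order P a) - int (ideal_order P b))"

text \<open>The choice of embedding within a conjugate pair is irrelevant in the next two definitions.
  The completion at an Archimedean place is the closure of the image of the field in the complex
  numbers; the local degree is its dimension over the reals.\<close>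

definition arch_abs :: "('a::field_char_0 \<Rightarrow> complex) set \<Rightarrow> 'a \<Rightarrow> real" where
  "arch_abs v x = cmod ((SOME \<sigma>. \<sigma> \<in> v) x)"

definition arch_local_degree :: "('a::field_char_0 \<Rightarrow> complex) set \<Rightarrow> nat" where
  "arch_local_degree v = dim (closure (range (SOME \<sigma>. \<sigma> \<in> v)))"

datatype 'a place = Finite_Place "'a set" | Arch_Place "('a \<Rightarrow> complex) set"

definition places :: "'a::field_char_0 place set" where
  "places = Finite_Place ` finite_places \<union> Arch_Place ` arch_places"

text \<open>The normalized absolute value \<open>|x|\<^sub>v\<close> raised to the local degree \<open>n\<^sub>v\<close>, which at a finite place
  is the norm of the prime to the power \<open>- v(x)\<close>.\<close>

fun normalized_abs :: "'a::field_char_0 place \<Rightarrow> 'a \<Rightarrow> real" where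
  "normalized_abs (Finite_Place P) x =
     (if x = 0 then 0 else real (ideal_norm P) powi (- valuation P x))"
| "normalized_abs (Arch_Place v) x = arch_abs v x ^ arch_local_degree v"


section \<open>Weighted projective space\<close>

text \<open>Tuples of length \<open>n + 1\<close> are functions on a finite index type with \<open>n + 1\<close> elements.\<close>

definition weighted_equiv ::
    "('n::finite \<Rightarrow> nat) \<Rightarrow> (('n \<Rightarrow> 'k::field) \<times> ('n \<Rightarrow> 'k)) set" where
  "weighted_equiv q = {(x, y). (\<exists>i. x i \<noteq> 0) \<and> (\<exists>i. y i \<noteq> 0) \<and>
     (\<exists>l. l \<noteq> 0 \<and> (\<forall>i. y i = l ^ q i * x i))}"

definition weighted_projective_space ::
    "('n::finite \<Rightarrow> nat) \<Rightarrow> ('n \<Rightarrow> 'k::field) set set" where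
  "weighted_projective_space q = {x. \<exists>i. x i \<noteq> 0} // weighted_equiv q"

definition represents ::
    "('n::finite \<Rightarrow> 'a::field_char_0) \<Rightarrow> ('n \<Rightarrow> 'a alg_closure) set \<Rightarrow> bool" where
  "represents x p \<longleftrightarrow> (\<lambda>i. to_ac (x i)) \<in> p"

definition rational_points ::
    "('n::finite \<Rightarrow> nat) \<Rightarrow> ('n \<Rightarrow> 'a::field_char_0 alg_closure) set set" where
  "rational_points q =
     {p \<in> weighted_projective_space q. \<exists>x :: 'n \<Rightarrow> 'a. represents x p}"


section \<open>Heights and defect\<close>

text \<open>For a nonzero tuple all but finitely many factors of the products over places below are
  \<open>1\<close>; \<^const>\<open>prod'\<close> is the product of the factors different from \<open>1\<close>.\<close>

definition local_height ::
    "('n::finite \<Rightarrow> nat) \<Rightarrow> ('n \<Rightarrow> 'a::field_char_0) \<Rightarrow> 'a place \<Rightarrow> real" where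
  "local_height q x v = Max (range (\<lambda>i. normalized_abs v (x i) powr (1 / real (q i))))"

text \<open>The height is a function on points, hence the choice of a representative over the base
  field; it is independent of that choice.\<close>

definition weighted_height ::
    "('n::finite \<Rightarrow> nat) \<Rightarrow> ('n \<Rightarrow> 'a::field_char_0 alg_closure) set \<Rightarrow> real" where
  "weighted_height q p = prod' (local_height q (SOME x :: 'n \<Rightarrow> 'a. represents x p)) places"

text \<open>The tautological height and the defect are functions of the representative: they are
  invariant under scaling by the base field, but not by its algebraic closure.\<close>

definition theta ::
    "('n::finite \<Rightarrow> nat) \<Rightarrow> ('n \<Rightarrow> 'a::field_char_0) \<Rightarrow> 'a set \<Rightarrow> real" where
  "theta q x P = Min ((\<lambda>i. real_of_int (valuation P (x i)) / real (q i)) ` {i. x i \<noteq> 0})"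

definition tautological_height ::
    "('n::finite \<Rightarrow> nat) \<Rightarrow> ('n \<Rightarrow> 'a::field_char_0) \<Rightarrow> real" where
  "tautological_height q x =
     prod' (\<lambda>P. real (ideal_norm P) powi (- \<lfloor>theta q x P\<rfloor>)) finite_places *
     (\<Prod>v\<in>arch_places. local_height q x (Arch_Place v))"

definition defect :: "('n::finite \<Rightarrow> nat) \<Rightarrow> ('n \<Rightarrow> 'a::field_char_0) \<Rightarrow> real" where
  "defect q x =
     prod' (\<lambda>P. real (ideal_norm P) powr (theta q x P - of_int \<lfloor>theta q x P\<rfloor>)) finite_places"

definition wgcd :: "('n::finite \<Rightarrow> nat) \<Rightarrow> ('n \<Rightarrow> int) \<Rightarrow> nat" where
  "wgcd q x = Max {d. d > 0 \<and> (\<forall>i. int d ^ q i dvd x i)}"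

end

theory Submission
  imports Defs "Jordan_Normal_Form.Char_Poly" "HOL-Computational_Algebra.Fundamental_Theorem_Algebra"
begin

text \<open>
  At a finite place the local height of \<open>x\<close> is \<open>Nm(P)\<close> to the power \<open>- \<theta>(x)\<close>, so the identity
  holds factor by factor once the height is computed from \<open>x\<close> itself. But \<^const>\<open>weighted_height\<close>
  uses some other representative \<open>y\<close> over the base field, where \<open>y\<^sub>i ^ k = \<nu> ^ q\<^sub>i * x\<^sub>i ^ k\<close> with
  \<open>k = q\<^sub>j\<close> and \<open>\<nu> = y\<^sub>j / x\<^sub>j\<close> in the base field for some \<open>j\<close>. Every local height then changes by the
  factor \<open>\<bar>\<nu>\<bar>\<^sub>v\<close> to the power \<open>1 / k\<close>, and these factors cancel by the product formula.

  The product formula compares two expressions for the index of \<open>(a)\<close> in the ring of integers: the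
  product of \<open>Nm(P)\<close> to the powers \<open>ord\<^sub>P(a)\<close>, by unique factorization of ideals, and the product of
  \<open>\<bar>\<sigma>(a)\<bar>\<close> over the complex embeddings. For the latter, the index of \<open>a L\<close> in \<open>L\<close> does not depend on
  the lattice \<open>L\<close> with \<open>a L \<subseteq> L\<close>. If \<open>a\<close> generates the field, take \<open>L = \<int>[a]\<close>; the index is the constant
  term of the minimal polynomial of \<open>a\<close>. The general case follows by multiplicativity.
\<close>

text \<open>The scalar linking two representatives may lie outside the base field, where no
  valuation is at hand; only its \<open>q\<^sub>j\<close>-th power is a quotient of coordinates,
  which explains the roots in the comparison. The index formula concerns arbitrary lattices because
  the ring of integers is not known to be one at first: its finite generation is deduced from the
  fact that the conjugates of a nonzero algebraic integer have a product of absolute value at least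
  1, and this bound is the index formula for an auxiliary stable lattice. Afterwards finite indices
  carry the ideal theory: they replace ascending chain arguments, and a single field element that
  multiplies a prime into the integers replaces fractional ideals.\<close>

hide_const (open) Polynomials.degree Polynomials.lead_coeff up_ring.coeff up_ring.monom
  module.smult Divisibility.prime

section \<open>Finitely generated groups of field elements and indices\<close>

text \<open>Additive subgroups of the field are treated as integer submodules, which supplies spans
  together with their closure rules.\<close>

global_interpretation Z: Modules.module "\<lambda>(k::int) (x::'a::field_char_0). of_int k * x"
  defines zsub = Z.subspace and zspan = Z.span
  by unfold_locales (auto simp: algebra_simps)

text \<open>As simplification rule this loops together with \<open>of_int_mult\<close> and associativity.\<close>
declare Z.scale_scale [simp del]

lemma zsubI:
  assumes "0 \<in> A" "\<And>x y. x \<in> A \<Longrightarrow> y \<in> A \<Longrightarrow> x + y \<in> A" "\<And>x. x \<in> A \<Longrightarrow> - x \<in> A"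
  shows "zsub A"
proof -
  have nat: "of_nat n * x \<in> A" if "x \<in> A" for n x
    using that by (induction n) (auto simp: assms(1,2) distrib_right)
  have "of_int k * x \<in> A" if "x \<in> A" for k x
  proof (cases "k \<ge> 0")
    case True
    then show ?thesis using nat[of x "nat k"] that by simp
  next
    case False
    then show ?thesis using assms(3)[OF nat[of x "nat (- k)"]] that by simp
  qed
  then show ?thesis
    unfolding Z.subspace_def using assms by auto
qed

lemma zsub_scale:
  assumes "zsub A"
  shows "zsub ((*) c ` A)"
proof (rule zsubI)
  show "0 \<in> (*) c ` A" using Z.subspace_0[OF assms] by force
  show "x + y \<in> (*) c ` A" if "x \<in> (*) c ` A" "y \<in> (*) c ` A" for x y
    using that Z.subspace_add[OF assms] by (auto simp flip: distrib_left)
  show "- x \<in> (*) c ` A" if x: "x \<in> (*) c ` A" for x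
  proof -
    obtain a where a: "a \<in> A" "x = c * a" using x by auto
    show ?thesis using Z.subspace_neg[OF assms a(1)] unfolding a(2) mult_minus_right[symmetric]
      by (rule imageI)
  qed
qed

section \<open>Cosets and indices of additive groups\<close>

definition quot :: "'a::field_char_0 set \<Rightarrow> 'a set \<Rightarrow> 'a set set" where
  "quot A B = (\<lambda>x. (+) x ` B) ` A"

text \<open>An infinite index is 0 by the convention for \<open>card\<close>, which is compatible
  with multiplicativity in towers; positivity has to come from finiteness.\<close>

definition idx :: "'a::field_char_0 set \<Rightarrow> 'a set \<Rightarrow> nat" where
  "idx A B = card (quot A B)"

lemma coset_eq_iff:
  assumes "zsub B"
  shows "(+) x ` B = (+) y ` B \<longleftrightarrow> x - y \<in> B"
proof
  assume "(+) x ` B = (+) y ` B"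
  then have "x + 0 \<in> (+) y ` B" using Z.subspace_0[OF assms] by blast
  then show "x - y \<in> B" by auto
next
  assume a: "x - y \<in> B"
  have "(+) x ` B \<subseteq> (+) y ` B" if "x - y \<in> B" for x y
  proof
    fix z assume "z \<in> (+) x ` B"
    then obtain b where "b \<in> B" "z = y + (x - y + b)" by auto
    then show "z \<in> (+) y ` B" using Z.subspace_add[OF assms that] by blast
  qed
  from this[OF a] this[of y x] show "(+) x ` B = (+) y ` B"
    using Z.subspace_neg[OF assms a] by auto
qed

text \<open>A coset of \<open>C\<close> in \<open>A\<close> is determined by the coset
  \<open>U\<close> of \<open>B\<close> containing it and, after subtraction of a fixed
  representative of \<open>U\<close>, by a coset of \<open>C\<close> in \<open>B\<close>.\<close>

lemma idx_tower:
  assumes A: "zsub A" and B: "zsub B" and C: "zsub C" and "C \<subseteq> B" "B \<subseteq> A"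
  shows "idx A C = idx A B * idx B C"
proof -
  define r where "r U = (SOME x. x \<in> A \<and> U = (+) x ` B)" for U
  have r: "r U \<in> A" "U = (+) (r U) ` B" if "U \<in> quot A B" for U
  proof -
    have "\<exists>x. x \<in> A \<and> U = (+) x ` B" using that by (auto simp: quot_def)
    from someI_ex[OF this] show "r U \<in> A" "U = (+) (r U) ` B" by (auto simp: r_def)
  qed
  have im: "(+) x ` (+) y ` C = (+) (x + y) ` C" for x y :: 'a
    by (auto simp: image_image add.assoc)
  have "bij_betw (\<lambda>(U, Y). (+) (r U) ` Y) (quot A B \<times> quot B C) (quot A C)"
  proof (rule bij_betwI')
    fix p p' assume "p \<in> quot A B \<times> quot B C" "p' \<in> quot A B \<times> quot B C"
    then obtain U Y U' Y' where p: "p = (U, Y)" "p' = (U', Y')" and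
      U: "U \<in> quot A B" "U' \<in> quot A B" and Y: "Y \<in> quot B C" "Y' \<in> quot B C" by auto
    obtain y y' where y: "y \<in> B" "y' \<in> B" "Y = (+) y ` C" "Y' = (+) y' ` C"
      using Y by (auto simp: quot_def)
    show "(case p of (U, Y) \<Rightarrow> (+) (r U) ` Y) = (case p' of (U, Y) \<Rightarrow> (+) (r U) ` Y) \<longleftrightarrow> p = p'"
    proof
      assume "(case p of (U, Y) \<Rightarrow> (+) (r U) ` Y) = (case p' of (U, Y) \<Rightarrow> (+) (r U) ` Y)"
      then have *: "r U + y - (r U' + y') \<in> C"
        by (simp add: p y im coset_eq_iff[OF C])
      then have "r U + y - (r U' + y') \<in> B" using assms by auto
      then have "(r U + y - (r U' + y')) + (y' - y) \<in> B"
        using Z.subspace_add[OF B _ Z.subspace_diff[OF B y(2,1)]] by blast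
      then have "r U - r U' \<in> B" by (simp add: algebra_simps)
      then have "U = U'" using coset_eq_iff[OF B] r U by metis
      with * show "p = p'" by (simp add: p y coset_eq_iff[OF C])
    qed auto
  next
    fix p assume "p \<in> quot A B \<times> quot B C"
    then obtain U Y y where p: "p = (U, Y)" "U \<in> quot A B" "y \<in> B" "Y = (+) y ` C"
      by (auto simp: quot_def)
    then show "(case p of (U, Y) \<Rightarrow> (+) (r U) ` Y) \<in> quot A C"
      using r(1)[of U] \<open>B \<subseteq> A\<close> Z.subspace_add[OF A, of "r U" y] by (auto simp: im quot_def)
  next
    fix W assume "W \<in> quot A C"
    then obtain x where x: "x \<in> A" "W = (+) x ` C" by (auto simp: quot_def)
    define U where "U = (+) x ` B"
    have U: "U \<in> quot A B" using x by (auto simp: U_def quot_def)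
    have "x - r U \<in> B" using r(2)[OF U] U_def coset_eq_iff[OF B] by metis
    then have "(+) (x - r U) ` C \<in> quot B C" by (auto simp: quot_def)
    moreover have "W = (+) (r U) ` (+) (x - r U) ` C" by (simp add: im x)
    ultimately show "\<exists>p\<in>quot A B \<times> quot B C. W = (case p of (U, Y) \<Rightarrow> (+) (r U) ` Y)"
      using U by (intro bexI[of _ "(U, (+) (x - r U) ` C)"]) auto
  qed
  from bij_betw_same_card[OF this] show ?thesis
    by (simp add: idx_def card_cartesian_product)
qed

lemma quot_scale: "quot ((*) c ` A) ((*) c ` B) = (`) ((*) c) ` quot A B"
  by (simp add: quot_def image_image ring_distribs)

lemma idx_scale:
  assumes "c \<noteq> 0"
  shows "idx ((*) c ` A) ((*) c ` B) = idx A B"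
proof -
  have "inj ((*) c)" using assms by (auto simp: inj_on_def)
  then have "inj ((`) ((*) c))" by (simp add: inj_image_eq_iff inj_on_def)
  then show ?thesis
    by (simp add: idx_def quot_scale card_image inj_on_subset)
qed

lemma finite_quot_mono:
  assumes "finite (quot A B)" "A' \<subseteq> A" "B \<subseteq> B'" "zsub B" "zsub B'"
  shows "finite (quot A' B')"
proof -
  \<comment> \<open>A coset of the larger group can be rebuilt from a coset of \<open>B\<close>
    inside it, so the quotient by \<open>B'\<close> is an image of the quotient by
    \<open>B\<close>.\<close>
  have un: "(+) x ` B' = (\<Union>y\<in>(+) x ` B. (+) y ` B')" for x
  proof -
    have "(+) (x + b) ` B' = (+) x ` B'" if "b \<in> B" for b
      using coset_eq_iff[OF assms(5), of "x + b" x] that assms(3) by auto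
    moreover have "0 \<in> B" using assms(4) Z.subspace_0 by blast
    ultimately show ?thesis by (auto simp: image_iff)
  qed
  have "quot A' B' = (\<lambda>x. \<Union>y\<in>(+) x ` B. (+) y ` B') ` A'"
    unfolding quot_def by (rule image_cong[OF refl un])
  also have "\<dots> = (\<lambda>U. \<Union>y\<in>U. (+) y ` B') ` quot A' B"
    by (simp only: quot_def image_image)
  also have "\<dots> \<subseteq> (\<lambda>U. \<Union>y\<in>U. (+) y ` B') ` quot A B"
    using assms(2) by (intro image_mono) (auto simp: quot_def)
  finally have "quot A' B' \<subseteq> (\<lambda>U. \<Union>y\<in>U. (+) y ` B') ` quot A B" .
  then show ?thesis using assms(1) finite_surj by blast
qed

lemma idx_mono:
  assumes "finite (quot A B)" "B \<subseteq> B'" "B' \<subseteq> A" "zsub A" "zsub B" "zsub B'"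
  shows "idx A B' \<le> idx A B" and "B \<noteq> B' \<Longrightarrow> idx A B' < idx A B"
proof -
  have fin: "finite (quot A B')" "finite (quot B' B)"
    using finite_quot_mono[OF assms(1) _ assms(2)] finite_quot_mono[OF assms(1) assms(3), of B] assms
    by auto
  have 0: "0 \<in> A" "0 \<in> B'" using assms Z.subspace_0 by blast+
  then have pos: "idx A B' > 0" "idx B' B > 0"
    using fin by (auto simp: idx_def card_gt_0_iff quot_def)
  have tower: "idx A B = idx A B' * idx B' B" by (rule idx_tower) (use assms in auto)
  then show "idx A B' \<le> idx A B" using pos by simp
  assume "B \<noteq> B'"
  then obtain x where x: "x \<in> B'" "x \<notin> B" using assms by auto
  have "{(+) x ` B, (+) 0 ` B} \<subseteq> quot B' B" unfolding quot_def using x(1) 0(2) by blast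
  then have "card {(+) x ` B, (+) 0 ` B} \<le> idx B' B" unfolding idx_def using fin card_mono by blast
  moreover have "(+) x ` B \<noteq> (+) 0 ` B" using coset_eq_iff[OF assms(5), of x 0] x by auto
  ultimately have "2 \<le> idx B' B" by simp
  then show "idx A B' < idx A B" using tower pos by simp
qed

lemma idx_pos: "finite (quot A B) \<Longrightarrow> zsub A \<Longrightarrow> idx A B > 0"
  using Z.subspace_0[of A] by (auto simp: idx_def card_gt_0_iff quot_def)

section \<open>Finitely generated groups and full lattices\<close>

definition zfg :: "'a::field_char_0 set \<Rightarrow> bool" where
  "zfg L \<longleftrightarrow> (\<exists>S. finite S \<and> L = zspan S)"

lemma zfg_zsub: "zfg L \<Longrightarrow> zsub L"
  unfolding zfg_def by auto

text \<open>Reducing coefficients modulo \<open>m\<close> represents every coset by one of finitely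
  many coefficient vectors; the generators may be dependent.\<close>

lemma finite_quot_multiple:
  assumes "zfg L" "m > 0"
  shows "finite (quot L ((*) (of_int m) ` L))"
proof -
  obtain S where S: "finite S" "L = zspan S" using assms by (auto simp: zfg_def)
  have sub: "zsub ((*) (of_int m) ` L)" using assms zfg_zsub zsub_scale by blast
  have "quot L ((*) (of_int m) ` L) \<subseteq>
    (\<lambda>u. (+) (\<Sum>v\<in>S. of_int (u v) * v) ` (*) (of_int m) ` L) ` (PiE S (\<lambda>_. {0..<m}))"
  proof
    fix U assume "U \<in> quot L ((*) (of_int m) ` L)"
    then obtain x where x: "x \<in> L" "U = (+) x ` (*) (of_int m) ` L" by (auto simp: quot_def)
    obtain u where u: "x = (\<Sum>v\<in>S. of_int (u v) * v)"
      using x(1) S Z.span_finite[OF S(1)] by auto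
    define w where "w = restrict (\<lambda>v. u v mod m) S"
    have "x - (\<Sum>v\<in>S. of_int (w v) * v) = (\<Sum>v\<in>S. of_int m * (of_int (u v div m) * v))"
      unfolding u sum_subtractf[symmetric]
    proof (rule sum.cong)
      fix v assume "v \<in> S"
      have "(of_int (u v) :: 'a) = of_int m * of_int (u v div m) + of_int (u v mod m)"
        by (metis of_int_add of_int_mult mult_div_mod_eq)
      then show "of_int (u v) * v - of_int (w v) * v = of_int m * (of_int (u v div m) * v)"
        using \<open>v \<in> S\<close> by (simp add: w_def algebra_simps)
    qed auto
    also have "\<dots> = of_int m * (\<Sum>v\<in>S. of_int (u v div m) * v)" by (simp add: sum_distrib_left)
    also have "\<dots> \<in> (*) (of_int m) ` L"
      unfolding S(2) by (intro imageI Z.span_sum Z.span_scale Z.span_base)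
    finally have "U = (+) (\<Sum>v\<in>S. of_int (w v) * v) ` (*) (of_int m) ` L"
      using coset_eq_iff[OF sub] x by blast
    moreover have "w \<in> PiE S (\<lambda>_. {0..<m})" using assms(2) by (auto simp: w_def)
    ultimately show "U \<in> (\<lambda>u. (+) (\<Sum>v\<in>S. of_int (u v) * v) ` (*) (of_int m) ` L) ` (PiE S (\<lambda>_. {0..<m}))"
      by blast
  qed
  then show ?thesis
    using finite_surj[OF finite_PiE[OF S(1)], of "\<lambda>_. {0..<m}"] by simp
qed

text \<open>Generators of \<open>B\<close> together with representatives of the finitely many cosets
  generate \<open>A\<close>.\<close>

lemma zfg_finite_quot:
  assumes "zfg B" "finite (quot A B)" "zsub A" "B \<subseteq> A"
  shows "zfg A"
proof -
  obtain S where S: "finite S" "B = zspan S" using assms by (auto simp: zfg_def)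
  obtain R where R: "R \<subseteq> A" "finite R" "quot A B = (\<lambda>x. (+) x ` B) ` R"
    using finite_subset_image[OF assms(2), of "\<lambda>x. (+) x ` B" A] unfolding quot_def by auto
  have "S \<subseteq> A" using S assms(4) Z.span_superset by blast
  have "A \<subseteq> zspan (S \<union> R)"
  proof
    fix x assume "x \<in> A"
    then have "(+) x ` B \<in> (\<lambda>x. (+) x ` B) ` R" using R by (auto simp: quot_def)
    then obtain y where y: "y \<in> R" "x - y \<in> B"
      using coset_eq_iff[OF zfg_zsub[OF assms(1)]] by blast
    then have "x - y \<in> zspan (S \<union> R)" "y \<in> zspan (S \<union> R)"
      using S Z.span_mono[of S "S \<union> R"] by (auto intro: Z.span_base)
    from Z.span_add[OF this] show "x \<in> zspan (S \<union> R)" by simp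
  qed
  moreover have "zspan (S \<union> R) \<subseteq> A"
    using R \<open>S \<subseteq> A\<close> assms(3) by (intro Z.span_minimal) auto
  ultimately show ?thesis using S R unfolding zfg_def by (intro exI[of _ "S \<union> R"]) auto
qed

text \<open>The second condition says that \<open>L\<close> spans the field over the rationals, so
  \<open>L\<close> has full rank. Any two such groups are commensurable, which keeps the indices
  between them finite.\<close>

definition zlattice :: "'a::field_char_0 set \<Rightarrow> bool" where
  "zlattice L \<longleftrightarrow> zfg L \<and> (\<forall>x. \<exists>m::int. m > 0 \<and> of_int m * x \<in> L)"

lemma zlattice_zsub: "zlattice L \<Longrightarrow> zsub L"
  by (auto simp: zlattice_def intro: zfg_zsub)

lemma common_multiple_in_zsub:
  assumes "finite S" "zsub L" "\<And>x. x \<in> S \<Longrightarrow> \<exists>m::int. m > 0 \<and> of_int m * x \<in> L"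
  shows "\<exists>m::int. m > 0 \<and> (*) (of_int m) ` zspan S \<subseteq> L"
proof -
  have "\<exists>m::int. m > 0 \<and> (\<forall>x\<in>S. of_int m * x \<in> L)"
    using assms(1,3)
  proof (induction S)
    case empty
    have "(1::int) > 0" by simp
    then show ?case by blast
  next
    case (insert x S)
    obtain k where k: "k > 0" "\<forall>x\<in>S. of_int k * x \<in> L" using insert.IH insert.prems by blast
    obtain m where m: "m > 0" "of_int m * x \<in> L" using insert.prems by blast
    have "of_int (k * m) * y \<in> L" if "y \<in> insert x S" for y
    proof (cases "y = x")
      case True
      have "of_int (k * m) * y = of_int k * (of_int m * x)" using True by (simp only: of_int_mult mult.assoc)
      then show ?thesis using Z.subspace_scale[OF assms(2) m(2), of k] by metis
    next
      case False
      then have "of_int k * y \<in> L" using k(2) that by blast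
      moreover have "of_int (k * m) * y = of_int m * (of_int k * y)"
        by (simp only: of_int_mult mult.assoc mult.left_commute)
      ultimately show ?thesis using Z.subspace_scale[OF assms(2), of "of_int k * y" m] by metis
    qed
    moreover have "k * m > 0" using k m by simp
    ultimately show ?case by blast
  qed
  then obtain m where m: "m > 0" "\<forall>x\<in>S. of_int m * x \<in> L" by auto
  have "zspan S \<subseteq> {x. of_int m * x \<in> L}"
  proof (rule Z.span_minimal)
    show "S \<subseteq> {x. of_int m * x \<in> L}" using m by blast
    show "zsub {x. of_int m * x \<in> L}"
      using Z.subspace_0[OF assms(2)] Z.subspace_add[OF assms(2)] Z.subspace_neg[OF assms(2)]
      by (intro zsubI) (auto simp: ring_distribs)
  qed
  then show ?thesis using m by auto
qed

lemma lattice_multiple_subset: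
  assumes "zfg L" "zlattice L'"
  shows "\<exists>m::int. m > 0 \<and> (*) (of_int m) ` L \<subseteq> L'"
proof -
  obtain S where "finite S" "L = zspan S" using assms(1) by (auto simp: zfg_def)
  then show ?thesis
    using common_multiple_in_zsub[of S L'] zlattice_zsub[OF assms(2)] assms(2)
    by (auto simp: zlattice_def)
qed

lemma finite_quot_lattice:
  assumes "zfg L" "zlattice L'"
  shows "finite (quot L L')"
proof -
  obtain m :: int where m: "m > 0" "(*) (of_int m) ` L \<subseteq> L'"
    using lattice_multiple_subset[OF assms] by blast
  show ?thesis
    using finite_quot_mono[OF finite_quot_multiple[OF assms(1) m(1)] order_refl m(2)]
      zsub_scale[OF zfg_zsub[OF assms(1)]] zlattice_zsub[OF assms(2)] by blast
qed

lemma zlattice_scale: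
  assumes "zlattice L" "c \<noteq> 0"
  shows "zlattice ((*) c ` L)"
proof -
  obtain S where S: "finite S" "L = zspan S" using assms by (auto simp: zlattice_def zfg_def)
  have "zspan ((*) c ` S) = (*) c ` L"
  proof
    show "zspan ((*) c ` S) \<subseteq> (*) c ` L"
      using zsub_scale[of L c] zlattice_zsub[OF assms(1)] S Z.span_superset[of S]
      by (intro Z.span_minimal) auto
    have "L \<subseteq> {x. c * x \<in> zspan ((*) c ` S)}"
      unfolding S(2)
    proof (rule Z.span_minimal)
      show "S \<subseteq> {x. c * x \<in> zspan ((*) c ` S)}" by (auto intro: Z.span_base)
      show "zsub {x. c * x \<in> zspan ((*) c ` S)}"
        by (auto simp: Z.subspace_def ring_distribs mult.left_commute[of c] Z.span_zero intro: Z.span_add Z.span_scale)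
    qed
    then show "(*) c ` L \<subseteq> zspan ((*) c ` S)" by auto
  qed
  then have "zfg ((*) c ` L)" using S unfolding zfg_def by (intro exI[of _ "(*) c ` S"]) auto
  moreover have "\<exists>m::int. m > 0 \<and> of_int m * x \<in> (*) c ` L" for x
  proof -
    obtain m :: int where "m > 0" "of_int m * (x / c) \<in> L" using assms unfolding zlattice_def by blast
    then show ?thesis using assms(2) by (intro exI[of _ m]) (auto simp: image_iff intro!: bexI[of _ "of_int m * (x/c)"])
  qed
  ultimately show ?thesis by (auto simp: zlattice_def)
qed

text \<open>Some integer multiple \<open>M\<close> of \<open>L'\<close> lies in \<open>L\<close>.
  The index of \<open>x M\<close> in \<open>L\<close> can be computed through \<open>x L\<close> and
  through \<open>M\<close>; multiplication by \<open>x\<close> preserves the index of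
  \<open>M\<close> in \<open>L\<close>, which therefore cancels.\<close>

lemma idx_scale_lattice_independent:
  assumes L: "zlattice L" "zlattice L'" and x: "x \<noteq> 0" "(*) x ` L \<subseteq> L" "(*) x ` L' \<subseteq> L'"
  shows "idx L ((*) x ` L) = idx L' ((*) x ` L')"
proof -
  obtain m :: int where m: "m > 0" "(*) (of_int m) ` L' \<subseteq> L"
    using lattice_multiple_subset[of L' L] L by (auto simp: zlattice_def)
  define M where "M = (*) (of_int m) ` L'"
  have M: "zlattice M" "M \<subseteq> L" using zlattice_scale[OF L(2), of "of_int m"] m by (auto simp: M_def)
  have xM: "(*) x ` M \<subseteq> M" using x(3) by (force simp: M_def image_image mult.left_commute)
  have zs: "zsub L" "zsub M" "zsub ((*) x ` L)" "zsub ((*) x ` M)"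
    using L M zlattice_zsub zsub_scale by blast+
  have "idx L ((*) x ` L) * idx ((*) x ` L) ((*) x ` M) = idx L ((*) x ` M)"
    by (rule idx_tower[symmetric]) (use zs x M in auto)
  also have "\<dots> = idx L M * idx M ((*) x ` M)"
    by (rule idx_tower) (use zs xM M in auto)
  finally have "idx L ((*) x ` L) * idx L M = idx L M * idx M ((*) x ` M)"
    using idx_scale[OF x(1)] by simp
  moreover have "idx L M > 0"
    using idx_pos finite_quot_lattice[of L M] M(1) L zs by (auto simp: zlattice_def)
  moreover have "idx M ((*) x ` M) = idx L' ((*) x ` L')"
  proof -
    have "(*) x ` M = (*) (of_int m) ` ((*) x ` L')" by (simp add: M_def image_image mult.left_commute)
    then show ?thesis using idx_scale[of "of_int m" L'] m by (simp add: M_def)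
  qed
  ultimately show ?thesis by simp
qed

lemma idx_scale_mult:
  assumes L: "zsub L" and x: "x \<noteq> 0" "(*) x ` L \<subseteq> L" "(*) y ` L \<subseteq> L"
  shows "idx L ((*) (x * y) ` L) = idx L ((*) x ` L) * idx L ((*) y ` L)"
proof -
  have "idx L ((*) (x * y) ` L) = idx L ((*) x ` L) * idx ((*) x ` L) ((*) (x * y) ` L)"
    using L x by (intro idx_tower zsub_scale) (auto simp: mult.assoc)
  moreover have "(*) (x * y) ` L = (*) x ` (*) y ` L" by (simp add: image_image mult.assoc)
  ultimately show ?thesis using idx_scale[OF x(1)] by simp
qed

section \<open>Algebraic integers and integral minimal polynomials\<close>

text \<open>Determinant trick: the vector of generators, nonzero since \<open>M\<close> is, is an
  eigenvector with eigenvalue \<open>g\<close> of an integer matrix. Hence \<open>g\<close> is a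
  root of a monic integral characteristic polynomial.\<close>

lemma algebraic_int_if_stable:
  assumes "zfg M" "M \<noteq> {0}" "(*) g ` M \<subseteq> M"
  shows "algebraic_int g"
proof -
  obtain S where S: "finite S" "M = zspan S" using assms(1) by (auto simp: zfg_def)
  obtain xs where xs: "set xs = S" "distinct xs" using finite_distinct_list[OF S(1)] by blast
  define n where "n = length xs"
  have "\<exists>u. g * xs ! i = (\<Sum>j<n. of_int (u j) * xs ! j)" if "i < n" for i
  proof -
    have "xs ! i \<in> M" using that xs S(2) n_def Z.span_base nth_mem by blast
    then have "g * xs ! i \<in> zspan S" using assms(3) S(2) by blast
    then obtain u where "g * xs ! i = (\<Sum>v\<in>S. of_int (u v) * v)"
      using Z.span_finite[OF S(1)] by auto
    also have "\<dots> = (\<Sum>j<n. of_int (u (xs ! j)) * xs ! j)"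
      using sum.reindex_bij_betw[OF bij_betw_nth[OF xs(2), of "{..<n}" S], of "\<lambda>v. of_int (u v) * v"]
      by (simp add: n_def xs)
    finally show ?thesis by (intro exI[of _ "\<lambda>j. u (xs ! j)"])
  qed
  then obtain u where u: "\<And>i. i < n \<Longrightarrow> g * xs ! i = (\<Sum>j<n. of_int (u i j) * xs ! j)" by metis
  define B :: "int mat" where "B = mat n n (\<lambda>(i, j). u i j)"
  define A :: "'a mat" where "A = map_mat of_int B"
  have B: "B \<in> carrier_mat n n" and A: "A \<in> carrier_mat n n" by (auto simp: B_def A_def)
  have "eigenvector A (vec n (\<lambda>i. xs ! i)) g"
    unfolding eigenvector_def
  proof (intro conjI)
    show "vec n (\<lambda>i. xs ! i) \<in> carrier_vec (dim_row A)" using A by auto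
    show "vec n (\<lambda>i. xs ! i) \<noteq> 0\<^sub>v (dim_row A)"
    proof
      assume *: "vec n (\<lambda>i. xs ! i) = 0\<^sub>v (dim_row A)"
      have "xs ! i = 0" if "i < n" for i
        using arg_cong[OF *, of "\<lambda>v. vec_index v i"] that A by auto
      then have "S \<subseteq> {0}" using xs(1) n_def by (auto simp: in_set_conv_nth)
      then have "M \<subseteq> {0}" unfolding S(2) by (intro Z.span_minimal) (auto simp: Z.subspace_def)
      then show False using assms(2) S(2) Z.span_zero[of S] by blast
    qed
    show "A *\<^sub>v vec n (\<lambda>i. xs ! i) = g \<cdot>\<^sub>v vec n (\<lambda>i. xs ! i)"
      using u by (intro eq_vecI) (auto simp: A_def B_def scalar_prod_def lessThan_atLeast0)
  qed
  then have "eigenvalue A g" by (auto simp: eigenvalue_def)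
  then have "poly (char_poly A) g = 0" using eigenvalue_root_char_poly[OF A] by simp
  moreover have "char_poly A = map_poly of_int (char_poly B)"
    unfolding A_def by (rule of_int_hom.char_poly_hom[OF B])
  moreover have "lead_coeff (char_poly B) = 1" using degree_monic_char_poly[OF B] by simp
  ultimately show ?thesis unfolding algebraic_int_altdef_ipoly by metis
qed

abbreviation ipoly :: "int poly \<Rightarrow> 'a::field_char_0 \<Rightarrow> 'a" where
  "ipoly p x \<equiv> poly (map_poly of_int p) x"

lemma algebraic_int_power_eq:
  assumes x: "algebraic_int (x :: 'a::field_char_0)"
  shows "\<exists>n c. n > 0 \<and> x ^ n = (\<Sum>i<n. of_int (c i) * x ^ i)"
proof -
  obtain p where p: "ipoly p x = 0" "lead_coeff p = 1"
    using x unfolding algebraic_int_altdef_ipoly by blast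
  have "degree p > 0"
  proof (rule ccontr)
    assume "\<not> degree p > 0"
    then have "p = 1" using p(2) by (auto elim!: degree_eq_zeroE simp: one_pCons)
    then show False using p(1) by simp
  qed
  moreover have "ipoly p x = (\<Sum>i\<le>degree p. of_int (coeff p i) * x ^ i)"
    by (simp add: poly_altdef)
  then have "(\<Sum>i<degree p. of_int (coeff p i) * x ^ i) + x ^ degree p = 0"
    using p by (simp flip: lessThan_Suc_atMost)
  then have "x ^ degree p = - (\<Sum>i<degree p. of_int (coeff p i) * x ^ i)"
    by (metis add_eq_0_iff)
  then have "x ^ degree p = (\<Sum>i<degree p. of_int (- coeff p i) * x ^ i)"
    by (simp add: sum_negf)
  ultimately show ?thesis by (intro exI[of _ "degree p"] exI[of _ "\<lambda>i. - coeff p i"] conjI)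
qed

text \<open>The products \<open>x ^ i * y ^ j\<close> with bounded exponents span a stable group,
  because a top power is rewritten by the given relation. One such group serves both the sum and the
  product of two algebraic integers.\<close>

lemma stable_fg_of_power_eq:
  fixes x y :: "'a::field_char_0"
  assumes a: "a > 0" "x ^ a = (\<Sum>i<a. of_int (c i) * x ^ i)"
    and b: "b > 0" "y ^ b = (\<Sum>i<b. of_int (d i) * y ^ i)"
  shows "\<exists>M. zfg M \<and> 1 \<in> M \<and> (*) x ` M \<subseteq> M \<and> (*) y ` M \<subseteq> M"
proof -
  define S where "S = (\<lambda>(i, j). x ^ i * y ^ j) ` ({..<a} \<times> {..<b})"
  define M where "M = zspan S"
  have gen: "x ^ i * y ^ j \<in> M" if "i < a" "j < b" for i j
    unfolding M_def by (rule Z.span_base) (use that in \<open>auto simp: S_def\<close>)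
  have stable: "(*) z ` M \<subseteq> M" if "\<And>i j. i < a \<Longrightarrow> j < b \<Longrightarrow> z * (x ^ i * y ^ j) \<in> M" for z
  proof -
    have "M \<subseteq> {m. z * m \<in> M}"
      unfolding M_def
    proof (rule Z.span_minimal)
      show "S \<subseteq> {m. z * m \<in> zspan S}" using that by (auto simp: S_def M_def)
      show "zsub {m. z * m \<in> zspan S}"
        by (rule zsubI) (auto simp: ring_distribs Z.span_zero intro: Z.span_add Z.span_neg)
    qed
    then show ?thesis by auto
  qed
  have "x * (x ^ i * y ^ j) \<in> M" if ij: "i < a" "j < b" for i j
  proof (cases "Suc i < a")
    case True
    then show ?thesis using gen[of "Suc i" j] ij by (simp add: mult.assoc)
  next
    case False
    then have "a = Suc i" using ij by simp
    then have "x * (x ^ i * y ^ j) = x ^ a * y ^ j" by simp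
    also have "\<dots> = (\<Sum>i<a. of_int (c i) * (x ^ i * y ^ j))"
      by (simp add: a(2) sum_distrib_right mult.assoc)
    also have "\<dots> \<in> M"
      unfolding M_def using gen ij by (intro Z.span_sum Z.span_scale) (auto simp: M_def)
    finally show ?thesis .
  qed
  moreover have "y * (x ^ i * y ^ j) \<in> M" if ij: "i < a" "j < b" for i j
  proof (cases "Suc j < b")
    case True
    then show ?thesis using gen[of i "Suc j"] ij by (simp add: mult.left_commute)
  next
    case False
    then have "b = Suc j" using ij by simp
    then have "y * (x ^ i * y ^ j) = x ^ i * y ^ b" by (simp add: mult.left_commute)
    also have "\<dots> = (\<Sum>j<b. of_int (d j) * (x ^ i * y ^ j))"
      by (simp add: b(2) sum_distrib_left mult.left_commute)
    also have "\<dots> \<in> M"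
      unfolding M_def using gen ij by (intro Z.span_sum Z.span_scale) (auto simp: M_def)
    finally show ?thesis .
  qed
  moreover have "1 \<in> M" using gen[of 0 0] a b by simp
  moreover have "finite S" by (simp add: S_def)
  then have "zfg M" unfolding zfg_def M_def by blast
  ultimately show ?thesis using stable by blast
qed

lemma stable_fg_of_algebraic_ints:
  assumes "algebraic_int (x :: 'a::field_char_0)" "algebraic_int y"
  shows "\<exists>M. zfg M \<and> 1 \<in> M \<and> (*) x ` M \<subseteq> M \<and> (*) y ` M \<subseteq> M"
  using algebraic_int_power_eq[OF assms(1)] algebraic_int_power_eq[OF assms(2)] stable_fg_of_power_eq
  by blast

lemma algebraic_int_if_power_eq:
  assumes "n > 0" "(y :: 'a::field_char_0) ^ n = (\<Sum>i<n. of_int (c i) * y ^ i)"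
  shows "algebraic_int y"
proof -
  obtain M where M: "zfg M" "1 \<in> M" "(*) y ` M \<subseteq> M" using stable_fg_of_power_eq[OF assms assms] by blast
  moreover have "M \<noteq> {0}" using M(2) by auto
  ultimately show ?thesis using algebraic_int_if_stable by blast
qed

lemma algebraic_int_add [intro]:
  assumes "algebraic_int (x :: 'a::field_char_0)" "algebraic_int y"
  shows "algebraic_int (x + y)"
proof -
  obtain M where M: "zfg M" "1 \<in> M" "(*) x ` M \<subseteq> M" "(*) y ` M \<subseteq> M"
    using stable_fg_of_algebraic_ints[OF assms] by blast
  have "(x + y) * m \<in> M" if "m \<in> M" for m
    unfolding distrib_right using M(3,4) that by (intro Z.subspace_add[OF zfg_zsub[OF M(1)]]) auto
  then have "(*) (x + y) ` M \<subseteq> M" by blast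
  moreover have "M \<noteq> {0}" using M(2) by auto
  ultimately show ?thesis using algebraic_int_if_stable M(1) by blast
qed

lemma algebraic_int_mult [intro]:
  assumes "algebraic_int (x :: 'a::field_char_0)" "algebraic_int y"
  shows "algebraic_int (x * y)"
proof -
  obtain M where M: "zfg M" "1 \<in> M" "(*) x ` M \<subseteq> M" "(*) y ` M \<subseteq> M"
    using stable_fg_of_algebraic_ints[OF assms] by blast
  have "(x * y) * m \<in> M" if "m \<in> M" for m
    unfolding mult.assoc using M(3,4) that by blast
  then have "(*) (x * y) ` M \<subseteq> M" by blast
  moreover have "M \<noteq> {0}" using M(2) by auto
  ultimately show ?thesis using algebraic_int_if_stable M(1) by blast
qed

lemma algebraic_int_of_int [simp, intro]: "algebraic_int (of_int k :: 'a::field_char_0)"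
  by (rule int_imp_algebraic_int) auto

lemma algebraic_int_diff [intro]:
  "algebraic_int (x :: 'a::field_char_0) \<Longrightarrow> algebraic_int y \<Longrightarrow> algebraic_int (x - y)"
  using algebraic_int_add[of x "- y"] by simp

lemma algebraic_int_power' [intro]:
  "algebraic_int (x :: 'a::field_char_0) \<Longrightarrow> algebraic_int (x ^ n)"
  by (induction n) auto

text \<open>The minimal polynomial with denominators cleared: a generator, unique up to sign, of the
  integer polynomials vanishing at \<open>x\<close>. Integer coefficients let the same polynomial be
  evaluated in the number field and in the complex numbers.\<close>

definition int_minpoly_of :: "int poly \<Rightarrow> 'a::field_char_0 \<Rightarrow> bool" where
  "int_minpoly_of f x \<longleftrightarrow> content f = 1 \<and> (\<forall>h. ipoly h x = 0 \<longleftrightarrow> f dvd h)"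

text \<open>Pseudo-division by a vanishing polynomial of least degree leaves no remainder, so it
  divides every other one up to an integer factor; Gauss's lemma removes that factor for the
  primitive part.\<close>

lemma int_minpoly_exists:
  assumes "p \<noteq> 0" "ipoly p (x :: 'a::field_char_0) = 0"
  shows "\<exists>f. int_minpoly_of f x"
proof -
  define Q where "Q = (\<lambda>p. p \<noteq> 0 \<and> ipoly p x = 0)"
  obtain g where g: "Q g" "\<And>h. Q h \<Longrightarrow> degree g \<le> degree h"
    using ex_has_least_nat[of Q p degree] assms unfolding Q_def by blast
  define f where "f = primitive_part g"
  have cg: "content g \<noteq> 0" using g by (auto simp: Q_def)
  have gf: "g = smult (content g) f" by (simp add: f_def)
  have f: "f \<noteq> 0" "content f = 1" using g by (auto simp: f_def Q_def)
  have "ipoly g x = of_int (content g) * ipoly f x"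
    by (subst gf) (simp add: of_int_hom.map_poly_hom_smult)
  then have fx: "ipoly f x = 0" using g cg by (auto simp: Q_def)
  have "f dvd h" if hx: "ipoly h x = 0" for h
  proof -
    obtain q r where qr: "pseudo_divmod h f = (q, r)" by fastforce
    define c where "c = coeff f (degree f) ^ (Suc (degree h) - degree f)"
    have c: "c \<noteq> 0" using f by (simp add: c_def)
    have 1: "smult c h = f * q + r" and 2: "r = 0 \<or> degree r < degree f"
      using pseudo_divmod[OF f(1) qr] by (auto simp: c_def)
    have "r = smult c h - f * q" using 1 by simp
    then have "ipoly r x = 0"
      using hx fx by (simp add: of_int_poly_hom.hom_minus of_int_poly_hom.hom_mult of_int_hom.map_poly_hom_smult)
    moreover have "degree f = degree g" by (simp add: f_def)
    ultimately have "r = 0" using 2 g(2)[of r] unfolding Q_def by force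
    then have "smult c h = f * q" using 1 by simp
    then have "fract_poly f dvd fract_poly (smult c h)" by (metis dvd_triv_left fract_poly_mult)
    then have "fract_poly f dvd fract_poly h"
      using c by (simp add: fract_poly_smult dvd_smult_iff)
    then show ?thesis using fract_poly_dvdD f(2) by blast
  qed
  moreover have "ipoly h x = 0" if "f dvd h" for h
    using that fx by (auto simp: of_int_poly_hom.hom_mult)
  ultimately show ?thesis using f unfolding int_minpoly_of_def by blast
qed

lemma int_minpoly_nonzero: "int_minpoly_of f x \<Longrightarrow> f \<noteq> 0"
  by (auto simp: int_minpoly_of_def)

lemma int_minpoly_degree_pos:
  assumes "int_minpoly_of f (x :: 'a::field_char_0)"
  shows "degree f > 0"
proof (rule ccontr)
  assume "\<not> degree f > 0"
  then obtain c where "f = [:c:]" by (auto elim: degree_eq_zeroE)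
  moreover have "ipoly f x = 0" using assms by (auto simp: int_minpoly_of_def)
  ultimately show False using int_minpoly_nonzero[OF assms] by (simp add: map_poly_pCons)
qed

text \<open>The minimal polynomial divides a monic one, so its leading coefficient is a unit, and a
  change of sign makes it monic.\<close>

lemma monic_int_minpoly_exists:
  assumes "algebraic_int (x :: 'a::field_char_0)"
  shows "\<exists>f. lead_coeff f = 1 \<and> int_minpoly_of f x"
proof -
  obtain p where p: "ipoly p x = 0" "lead_coeff p = 1"
    using assms unfolding algebraic_int_altdef_ipoly by blast
  then have "p \<noteq> 0" by auto
  then obtain f where f: "int_minpoly_of f x" using int_minpoly_exists p by blast
  then obtain k where "p = f * k" using p by (auto simp: int_minpoly_of_def)
  then have "lead_coeff f * lead_coeff k = 1" using p(2) by (simp add: lead_coeff_mult)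
  then have "lead_coeff f = 1 \<or> lead_coeff f = - 1" by (auto simp: zmult_eq_1_iff)
  moreover have "content (- f) = content f" using content_smult[of "-1" f] by simp
  then have "int_minpoly_of (- f) x" using f by (simp add: int_minpoly_of_def)
  ultimately show ?thesis using f by (metis lead_coeff_minus minus_minus)
qed

text \<open>Irreducibility in disguise: the polynomial \<open>g\<close> of \<open>r\<close> divides
  \<open>f\<close>, so \<open>f\<close> divides \<open>g\<close> or the cofactor, and degrees
  exclude the latter. Thus \<open>x\<close> and \<open>r\<close> satisfy the same integer
  relations.\<close>

lemma int_minpoly_conjugate:
  assumes f: "int_minpoly_of f (x :: 'a::field_char_0)" and r: "ipoly f (r :: 'b::field_char_0) = 0"
  shows "int_minpoly_of f r"
proof -
  obtain g where g: "int_minpoly_of g r" using int_minpoly_exists[OF int_minpoly_nonzero[OF f] r] by blast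
  obtain k where k: "f = g * k" using g r by (auto simp: int_minpoly_of_def)
  have "ipoly g x * ipoly k x = 0"
    using f k by (metis dvd_refl int_minpoly_of_def of_int_poly_hom.hom_mult poly_mult)
  then consider "f dvd g" | "f dvd k" using f by (auto simp: int_minpoly_of_def)
  then show ?thesis
  proof cases
    case 1
    then have "f dvd h \<longleftrightarrow> g dvd h" for h using k by (meson dvd_trans dvd_triv_left)
    then show ?thesis using f g by (auto simp: int_minpoly_of_def)
  next
    case 2
    have "k \<noteq> 0" using k int_minpoly_nonzero[OF f] by auto
    then have "degree f \<le> degree k" using 2 dvd_imp_degree_le by blast
    moreover have "degree f = degree g + degree k"
      using k int_minpoly_nonzero[OF f] by (metis degree_mult_eq mult_eq_0_iff)
    ultimately show ?thesis using int_minpoly_degree_pos[OF g] by simp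
  qed
qed

lemma int_minpoly_pderiv_nonzero:
  assumes f: "int_minpoly_of f (x :: 'a::field_char_0)"
  shows "ipoly (pderiv f) x \<noteq> 0"
proof
  assume "ipoly (pderiv f) x = 0"
  then have "f dvd pderiv f" using f by (simp add: int_minpoly_of_def)
  moreover have "pderiv f \<noteq> 0" using int_minpoly_degree_pos[OF f] by (simp add: pderiv_eq_0_iff)
  ultimately have "degree f \<le> degree (pderiv f)" using dvd_imp_degree_le by blast
  then show False using int_minpoly_degree_pos[OF f] by (simp add: degree_pderiv)
qed

text \<open>A multiple root would be a conjugate of \<open>x\<close> at which the derivative
  vanishes, which degrees forbid.\<close>

lemma int_minpoly_rsquarefree:
  assumes f: "int_minpoly_of f (x :: 'a::field_char_0)"
  shows "rsquarefree (map_poly of_int f :: complex poly)"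
  unfolding rsquarefree_roots
  using int_minpoly_pderiv_nonzero[OF int_minpoly_conjugate[OF f]] by (auto simp: of_int_hom.map_poly_pderiv)

lemma int_minpoly_roots:
  assumes f: "int_minpoly_of f (x :: 'a::field_char_0)"
  shows "finite {r :: complex. ipoly f r = 0}"
    and "card {r :: complex. ipoly f r = 0} = degree f"
    and "lead_coeff f = 1 \<Longrightarrow> (\<Prod>r | ipoly f r = 0. - (r :: complex)) = of_int (coeff f 0)"
proof -
  let ?R = "{r :: complex. ipoly f r = 0}" and ?F = "map_poly of_int f :: complex poly"
  have F0: "?F \<noteq> 0" using int_minpoly_nonzero[OF f] by simp
  then show "finite ?R" by (rule poly_roots_finite)
  have eq: "smult (lead_coeff ?F) (\<Prod>r\<in>?R. [:- r, 1:]) = ?F"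
    using complex_poly_decompose_rsquarefree[OF int_minpoly_rsquarefree[OF f]] .
  have "degree (\<Prod>r\<in>?R. [:- r, 1:]) = (\<Sum>r\<in>?R. degree [:- r, 1:])"
    by (rule degree_prod_eq_sum_degree) auto
  also have "\<dots> = card ?R" by simp
  finally have "card ?R = degree (smult (lead_coeff ?F) (\<Prod>r\<in>?R. [:- r, 1:]))" using F0 by simp
  then have "card ?R = degree ?F" by (simp only: eq)
  then show "card ?R = degree f" by simp
  assume "lead_coeff f = 1"
  then have lc: "lead_coeff ?F = 1" by simp
  have "poly (smult (lead_coeff ?F) (\<Prod>r\<in>?R. [:- r, 1:])) 0 = (\<Prod>r\<in>?R. - r)"
    unfolding lc by (simp add: poly_prod)
  then have "poly ?F 0 = (\<Prod>r\<in>?R. - r)" by (simp only: eq)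
  then show "(\<Prod>r\<in>?R. - r) = of_int (coeff f 0)" by (simp add: poly_0_coeff_0)
qed

section \<open>Primitive elements\<close>

lemma common_denominator:
  fixes r :: "nat \<Rightarrow> rat"
  shows "\<exists>D p. D > (0::int) \<and> (\<forall>i<n. of_int (coeff p i) = of_int D * r i) \<and> (\<forall>i\<ge>n. coeff p i = 0)"
proof (induction n)
  case 0
  show ?case by (intro exI[of _ 1] exI[of _ "0 :: int poly"]) auto
next
  case (Suc n)
  then obtain D p where p: "D > (0::int)" "\<And>i. i < n \<Longrightarrow> of_int (coeff p i) = of_int D * r i"
    "\<And>i. i \<ge> n \<Longrightarrow> coeff p i = 0" by blast
  obtain a b where ab: "quotient_of (r n) = (a, b)" by fastforce
  then have b: "b > 0" and rn: "r n = of_int a / of_int b"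
    using quotient_of_denom_pos quotient_of_div by blast+
  define p' where "p' = smult b p + monom (D * a) n"
  have "of_int (coeff p' i) = of_int (D * b) * r i" if "i < Suc n" for i
  proof (cases "i < n")
    case True
    then show ?thesis using p(2) by (simp add: p'_def)
  next
    case False
    then have "i = n" using that by simp
    then show ?thesis using p(3)[of n] b by (simp add: p'_def rn)
  qed
  moreover have "coeff p' i = 0" if "i \<ge> Suc n" for i
    using p(3) that by (simp add: p'_def)
  moreover have "D * b > 0" using p(1) b by simp
  ultimately show ?case by blast
qed

lemma ipoly_eq_rat_comb:
  fixes x :: "'a::field_char_0"
  assumes "\<forall>i<n. of_int (coeff p i) = of_int D * r i" "\<forall>i\<ge>n. coeff p i = 0"
  shows "ipoly p x = of_int D * (\<Sum>i<n. of_rat (r i) * x ^ i)"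
proof -
  have "ipoly p x = (\<Sum>i<n. of_int (coeff p i) * x ^ i)"
  proof -
    have "ipoly p x = (\<Sum>i\<le>degree p. of_int (coeff p i) * x ^ i)" by (simp add: poly_altdef)
    also have "\<dots> = (\<Sum>i\<in>{..degree p} \<union> {..<n}. of_int (coeff p i) * x ^ i)"
      by (rule sum.mono_neutral_left) (auto simp: coeff_eq_0)
    also have "\<dots> = (\<Sum>i<n. of_int (coeff p i) * x ^ i)"
      by (rule sum.mono_neutral_right) (use assms(2) in auto)
    finally show ?thesis .
  qed
  also have "of_int (coeff p i) * x ^ i = of_int D * (of_rat (r i) * x ^ i)" if "i < n" for i
  proof -
    have "(of_int (coeff p i) :: 'a) = of_rat (of_int D * r i)"
      using assms(1) that by (metis of_rat_of_int_eq)
    then show ?thesis by (simp add: of_rat_mult)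
  qed
  then have "(\<Sum>i<n. of_int (coeff p i) * x ^ i) = (\<Sum>i<n. of_int D * (of_rat (r i) * x ^ i))"
    by (intro sum.cong) auto
  also have "\<dots> = of_int D * (\<Sum>i<n. of_rat (r i) * x ^ i)" by (simp add: sum_distrib_left)
  finally show ?thesis .
qed

lemma rat_comb_eq_0_imp:
  fixes x :: "'a::field_char_0"
  assumes f: "int_minpoly_of f x" and 0: "(\<Sum>i<degree f. of_rat (r i) * x ^ i) = 0"
  shows "\<forall>i<degree f. r i = 0"
proof -
  obtain D p where p: "D > (0::int)" "\<forall>i<degree f. of_int (coeff p i) = of_int D * r i"
    "\<forall>i\<ge>degree f. coeff p i = 0" using common_denominator by blast
  have "ipoly p x = 0" using ipoly_eq_rat_comb[OF p(2,3), of x] 0 by simp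
  then have "f dvd p" using f by (simp add: int_minpoly_of_def)
  have "p = 0"
  proof (rule ccontr)
    assume "p \<noteq> 0"
    then have "degree f \<le> degree p" using \<open>f dvd p\<close> dvd_imp_degree_le by blast
    then have "coeff p (degree p) = 0" using p(3) by blast
    then show False using \<open>p \<noteq> 0\<close> by simp
  qed
  then show ?thesis using p by simp
qed

text \<open>The number field is the whole type, equipped with a finite rational basis; the inherited
  \<open>dimension\<close> is its degree.\<close>

locale number_field_basis = finite_dimensional_vector_space
  "\<lambda>(r::rat) (x::'a::field_char_0). of_rat r * x" Basis for Basis
begin

declare scale_scale [simp del]

lemma inj_on_powers:
  assumes f: "int_minpoly_of f (x :: 'a)"
  shows "inj_on ((^) x) {..<degree f}"
proof (rule inj_onI)
  fix i j assume ij: "i \<in> {..<degree f}" "j \<in> {..<degree f}" "x ^ i = x ^ j"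
  define r :: "nat \<Rightarrow> rat" where "r = (\<lambda>k. (if k = i then 1 else 0) - (if k = j then 1 else 0))"
  have "(\<Sum>k<degree f. of_rat (r k) * x ^ k)
      = (\<Sum>k<degree f. (if k = i then x ^ k else 0) - (if k = j then x ^ k else 0))"
    by (intro sum.cong) (auto simp: r_def of_rat_diff)
  also have "\<dots> = 0" using ij by (simp add: sum_subtractf sum.delta)
  finally have "r i = 0" using rat_comb_eq_0_imp[OF f] ij by blast
  then show "i = j" by (auto simp: r_def split: if_splits)
qed

lemma independent_powers:
  assumes f: "int_minpoly_of f (x :: 'a)"
  shows "independent ((^) x ` {..<degree f})"
proof (rule independent_if_scalars_zero)
  fix u y assume 0: "(\<Sum>y\<in>(^) x ` {..<degree f}. of_rat (u y) * y) = 0" and y: "y \<in> (^) x ` {..<degree f}"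
  have "(\<Sum>i<degree f. of_rat (u (x ^ i)) * x ^ i) = 0"
    using 0 by (simp add: sum.reindex[OF inj_on_powers[OF f]])
  then have "\<forall>i<degree f. u (x ^ i) = 0" by (rule rat_comb_eq_0_imp[OF f])
  then show "u y = 0" using y by blast
qed simp

lemma degree_int_minpoly_le:
  assumes f: "int_minpoly_of f (x :: 'a)"
  shows "degree f \<le> dimension"
proof -
  have "degree f = card ((^) x ` {..<degree f})" by (simp add: card_image[OF inj_on_powers[OF f]])
  also have "\<dots> \<le> dim UNIV" by (rule independent_card_le_dim[OF _ independent_powers[OF f]]) auto
  finally show ?thesis by (simp add: dimension_def)
qed

lemma int_minpoly_exists': "\<exists>f. int_minpoly_of f (x :: 'a)"
proof -
  have "\<exists>p. p \<noteq> 0 \<and> ipoly p x = 0"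
  proof (cases "inj_on ((^) x) {..dimension}")
    \<comment> \<open>Coinciding powers would shrink the set tested for dependence below the
      critical size; a difference of two monomials handles them directly.\<close>
    case False
    then obtain i j where ij: "i \<noteq> j" "x ^ i = x ^ j" by (auto simp: inj_on_def)
    have "coeff (monom 1 i - monom 1 j :: int poly) i \<noteq> 0" using ij by simp
    then have "monom 1 i - monom 1 j \<noteq> (0 :: int poly)" by (metis coeff_0)
    moreover have "ipoly (monom 1 i - monom 1 j) x = 0"
      using ij by (simp add: of_int_poly_hom.hom_minus map_poly_monom poly_monom)
    ultimately show ?thesis by blast
  next
    case True
    let ?S = "(^) x ` {..dimension}"
    have "card ?S = Suc dimension" using card_image[OF True] by simp
    then have "dependent ?S" using dim_subset_UNIV[of ?S] by (intro dependent_biggerset_general) simp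
    then obtain u where u: "\<exists>v\<in>?S. u v \<noteq> 0" "(\<Sum>v\<in>?S. of_rat (u v) * v) = 0"
      by (subst (asm) dependent_finite) auto
    obtain D p where p: "D > (0::int)" "\<forall>i<Suc dimension. of_int (coeff p i) = of_int D * u (x ^ i)"
      "\<forall>i\<ge>Suc dimension. coeff p i = 0" using common_denominator[of "Suc dimension" "\<lambda>i. u (x ^ i)"] by blast
    have "ipoly p x = 0"
      using u(2) ipoly_eq_rat_comb[OF p(2,3), of x]
      by (simp add: sum.reindex[OF True] lessThan_Suc_atMost)
    moreover obtain i where "i \<le> dimension" "u (x ^ i) \<noteq> 0" using u(1) by auto
    then have "of_int (coeff p i) \<noteq> (0 :: rat)" using p(1,2) by (simp add: less_Suc_eq_le)
    then have "p \<noteq> 0" by auto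
    ultimately show ?thesis by blast
  qed
  then show ?thesis using int_minpoly_exists by blast
qed

definition primitive :: "'a \<Rightarrow> bool" where
  "primitive x \<longleftrightarrow> (\<exists>f. int_minpoly_of f x \<and> degree f = dimension)"

lemma span_powers_primitive:
  assumes "int_minpoly_of f (x :: 'a)" "degree f = dimension"
  shows "span ((^) x ` {..<dimension}) = UNIV"
proof -
  have "dim ((^) x ` {..<dimension}) = dimension"
    using dim_eq_card_independent[OF independent_powers[OF assms(1)]] card_image[OF inj_on_powers[OF assms(1)]]
    by (simp add: assms(2))
  then show ?thesis by (simp only: dim_eq_full)
qed

lemma primitive_rat_comb:
  assumes "primitive x"
  shows "\<exists>r. y = (\<Sum>i<dimension. of_rat (r i) * x ^ i)"
proof -
  obtain f where f: "int_minpoly_of f x" "degree f = dimension" using assms by (auto simp: primitive_def)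
  have "y \<in> span ((^) x ` {..<dimension})" using span_powers_primitive[OF f] by simp
  then obtain u where "y = (\<Sum>v\<in>(^) x ` {..<dimension}. of_rat (u v) * v)"
    by (auto simp: span_finite)
  also have "\<dots> = (\<Sum>i<dimension. of_rat (u (x ^ i)) * x ^ i)"
    using inj_on_powers[OF f(1)] by (simp add: sum.reindex f(2))
  finally show ?thesis by (intro exI[of _ "\<lambda>i. u (x ^ i)"])
qed

lemma primitive_ipoly:
  assumes "primitive x"
  shows "\<exists>D p. D > (0::int) \<and> of_int D * y = ipoly p x \<and> (\<forall>i\<ge>dimension. coeff p i = 0)"
proof -
  obtain r where r: "y = (\<Sum>i<dimension. of_rat (r i) * x ^ i)" using primitive_rat_comb[OF assms] by blast
  obtain D p where p: "D > (0::int)" "\<forall>i<dimension. of_int (coeff p i) = of_int D * r i"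
    "\<forall>i\<ge>dimension. coeff p i = 0" using common_denominator[of dimension r] by blast
  have "of_int D * y = ipoly p x" using ipoly_eq_rat_comb[OF p(2,3), of x] r by simp
  then show ?thesis using p by blast
qed

end

lemma rat_poly_bound:
  "\<exists>C \<ge> 0. \<forall>t. \<bar>t\<bar> \<le> 1 \<longrightarrow> \<bar>poly p t\<bar> \<le> (C :: rat)"
proof (induction p)
  case 0
  show ?case by auto
next
  case (pCons a p)
  then obtain C where C: "C \<ge> 0" "\<And>t. \<bar>t\<bar> \<le> 1 \<Longrightarrow> \<bar>poly p t\<bar> \<le> C" by blast
  have "\<bar>poly (pCons a p) t\<bar> \<le> \<bar>a\<bar> + C" if "\<bar>t\<bar> \<le> 1" for t
  proof -
    have "\<bar>t * poly p t\<bar> \<le> 1 * C" unfolding abs_mult using that C by (intro mult_mono) auto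
    then show ?thesis using abs_triangle_ineq[of a "t * poly p t"] by simp
  qed
  then show ?case using C by (intro exI[of _ "\<bar>a\<bar> + C"]) auto
qed

text \<open>The matrix \<open>1 + t R(t)\<close> is diagonally dominant for small \<open>t\<close>.\<close>

lemma trivial_kernel_near_identity:
  fixes R :: "nat \<Rightarrow> nat \<Rightarrow> rat poly"
  shows "\<exists>t>0. \<forall>l. (\<forall>j<n. (\<Sum>i<n. l i * ((if i = j then 1 else 0) + t * poly (R i j) t)) = 0)
    \<longrightarrow> (\<forall>i<n. l i = 0)"
proof -
  define Q where "Q i j c \<longleftrightarrow> c \<ge> 0 \<and> (\<forall>t. \<bar>t\<bar> \<le> 1 \<longrightarrow> \<bar>poly (R i j) t\<bar> \<le> c)" for i j c
  have "\<exists>c. Q i j c" for i j using rat_poly_bound unfolding Q_def by blast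
  then obtain C where "\<And>i j. Q i j (C i j)" by metis
  then have C: "\<And>i j. C i j \<ge> 0" "\<And>i j t. \<bar>t\<bar> \<le> 1 \<Longrightarrow> \<bar>poly (R i j) t\<bar> \<le> C i j" by (auto simp: Q_def)
  \<comment> \<open>\<open>S\<close> exceeds every column sum of the bounds, and the summand 1 keeps
    it positive. With \<open>t * S = 1 / 2\<close> the largest entry of a kernel vector is at most
    half of itself, hence 0.\<close>
  define S where "S = 1 + (\<Sum>j<n. \<Sum>i<n. C i j)"
  have S: "S \<ge> 1" using C(1) by (simp add: S_def sum_nonneg)
  define t where "t = 1 / (2 * S)"
  have t: "t > 0" "\<bar>t\<bar> \<le> 1" "t * S = 1 / 2" using S by (auto simp: t_def field_simps)
  have "l i = 0" if l: "\<forall>j<n. (\<Sum>i<n. l i * ((if i = j then 1 else 0) + t * poly (R i j) t)) = 0" and i: "i < n"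
    for l i
  proof -
    define m where "m = Max ((\<lambda>i. \<bar>l i\<bar>) ` {..<n})"
    have m: "\<bar>l i\<bar> \<le> m" if "i < n" for i using that by (simp add: m_def)
    have "m \<in> (\<lambda>i. \<bar>l i\<bar>) ` {..<n}" unfolding m_def using i by (intro Max_in) auto
    then obtain j where j: "j < n" "m = \<bar>l j\<bar>" by auto
    have "0 = (\<Sum>i<n. l i * (if i = j then 1 else 0) + l i * (t * poly (R i j) t))"
      using l j(1) by (simp add: ring_distribs)
    also have "\<dots> = l j + (\<Sum>i<n. l i * (t * poly (R i j) t))"
      using j(1) by (simp add: sum.distrib if_distrib[of "(*) _"] cong: if_cong)
    finally have "m = \<bar>\<Sum>i<n. l i * (t * poly (R i j) t)\<bar>" using j(2) by simp
    also have "\<dots> \<le> (\<Sum>i<n. m * (t * C i j))"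
    proof (rule order_trans[OF sum_abs sum_mono])
      fix i assume "i \<in> {..<n}"
      then show "\<bar>l i * (t * poly (R i j) t)\<bar> \<le> m * (t * C i j)"
        unfolding abs_mult using m[of i] C t by (intro mult_mono) auto
    qed
    also have "\<dots> = m * t * (\<Sum>i<n. C i j)" by (simp add: sum_distrib_left mult.assoc)
    also have "\<dots> \<le> m * t * S"
    proof (rule mult_left_mono)
      have "(\<Sum>i<n. C i j) \<le> (\<Sum>j<n. \<Sum>i<n. C i j)"
        using j(1) C(1) by (intro member_le_sum) (auto intro: sum_nonneg)
      then show "(\<Sum>i<n. C i j) \<le> S" by (simp add: S_def)
      show "0 \<le> m * t" using j t by simp
    qed
    also have "\<dots> = m / 2" using t(3) by (simp add: mult.assoc)
    finally have "m \<le> 0" by simp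
    then show ?thesis using m[OF i] by simp
  qed
  then show ?thesis using t(1) by blast
qed

context number_field_basis
begin

text \<open>Functionals dual to an independent set, taken as coordinates in an extended basis. They
  turn independence of a family depending on \<open>t\<close> into triviality of the kernel of a
  matrix of rational polynomials in \<open>t\<close>.\<close>

lemma rat_linear_functional:
  assumes "independent S" "v \<in> S"
  obtains \<phi> :: "'a \<Rightarrow> rat" where "\<And>x y. \<phi> (x + y) = \<phi> x + \<phi> y" "\<And>r x. \<phi> (of_rat r * x) = r * \<phi> x"
    "\<And>w. w \<in> S \<Longrightarrow> \<phi> w = (if w = v then 1 else 0)"
proof
  let ?B = "extend_basis S"
  let ?\<phi> = "\<lambda>x. representation ?B x v"
  have B: "independent ?B" "span ?B = UNIV" "S \<subseteq> ?B"
    using independent_extend_basis[OF assms(1)] span_extend_basis[OF assms(1)] extend_basis_superset[OF assms(1)]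
    by auto
  show "?\<phi> (x + y) = ?\<phi> x + ?\<phi> y" for x y using representation_add[OF B(1)] B(2) by simp
  show "?\<phi> (of_rat r * x) = r * ?\<phi> x" for r x using representation_scale[OF B(1)] B(2) by simp
  show "?\<phi> w = (if w = v then 1 else 0)" if "w \<in> S" for w
    using representation_basis[OF B(1), of w] that B(3) by auto
qed

text \<open>A functional that is linear only over the rationals still commutes with evaluation at a
  rational point.\<close>

lemma functional_poly:
  fixes \<phi> :: "'a \<Rightarrow> rat"
  assumes add: "\<And>x y. \<phi> (x + y) = \<phi> x + \<phi> y" and scale: "\<And>r x. \<phi> (of_rat r * x) = r * \<phi> x"
  shows "\<phi> (poly W (of_rat t)) = poly (map_poly \<phi> W) t"
proof -
  have "\<phi> 0 = 0" using add[of 0 0] by simp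
  then show ?thesis
    by (induction W) (auto simp: map_poly_pCons add scale)
qed

text \<open>Let \<open>c\<close> have maximal degree \<open>d\<close> and minimal polynomial \<open>f\<close>. If \<open>z\<close> is not in the span of the
  powers of \<open>c\<close>, choose \<open>b\<close> with \<open>f'(c) * b = z\<close> and put \<open>e = c + t * b\<close>. For \<open>t \<rightarrow> 0\<close> the elements
  \<open>e ^ i\<close> with \<open>i < d\<close> and \<open>f(e) / t\<close> tend to the independent elements \<open>c ^ i\<close> and \<open>z\<close>, so for some
  \<open>t\<close> they are independent themselves and \<open>e\<close> has degree greater than \<open>d\<close>.\<close>

theorem primitive_exists: "\<exists>x. primitive x"
proof -
  define deg where "deg x = degree (SOME f. int_minpoly_of f (x :: 'a))" for x
  have deg: "\<exists>f. int_minpoly_of f x \<and> degree f = deg x" for x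
    unfolding deg_def using someI_ex[OF int_minpoly_exists'[of x]] by blast
  have "deg x \<le> dimension" for x using deg[of x] degree_int_minpoly_le by metis
  then obtain c where c: "\<And>x. deg x \<le> deg c"
    using ex_has_greatest_nat[of "\<lambda>_. True" 0 deg "Suc dimension"] by (auto simp: less_Suc_eq_le)
  define d where "d = deg c"
  obtain f where f: "int_minpoly_of f c" "degree f = d" using deg d_def by blast
  have "d = dimension"
  proof (rule ccontr)
    assume "d \<noteq> dimension"
    let ?V = "(^) c ` {..<d}"
    have indV: "independent ?V" and injV: "inj_on ((^) c) {..<d}"
      using independent_powers[OF f(1)] inj_on_powers[OF f(1)] f(2) by auto
    have "dim ?V = d" using dim_eq_card_independent[OF indV] card_image[OF injV] by simp
    then have "span ?V \<noteq> UNIV" using \<open>d \<noteq> dimension\<close> dim_eq_full by metis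
    then obtain z where z: "z \<notin> span ?V" by blast
    have indS: "independent (insert z ?V)" using z indV by (simp add: independent_insert)
    define w where "w = ipoly (pderiv f) c"
    have "w \<noteq> 0" using int_minpoly_pderiv_nonzero[OF f(1)] by (simp add: w_def)
    define b where "b = z / w"
    define F where "F = (of_int_poly f :: 'a poly)"
    have "poly F c = 0" using f(1) by (simp add: F_def int_minpoly_of_def)
    \<comment> \<open>\<open>H\<close> is the restriction of \<open>F\<close> to the line through
      \<open>c\<close> in direction \<open>b\<close>. It vanishes at 0, so it is \<open>X\<close>
      times some \<open>K\<close>, and \<open>K\<close> takes at 0 the value
      \<open>w * b = z\<close>. Thus \<open>K\<close> is the polynomial form of
      \<open>f(e) / t\<close>.\<close>
    define H where "H = pcompose F [:c, b:]"
    have "poly H 0 = 0" using \<open>poly F c = 0\<close> by (simp add: H_def poly_pcompose)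
    then obtain K where K: "H = [:0, 1:] * K" using poly_eq_0_iff_dvd[of H 0] by (auto elim: dvdE)
    have "poly (pderiv H) 0 = w * b"
      by (simp add: H_def pderiv_pcompose poly_pcompose pderiv_pCons F_def w_def of_int_hom.map_poly_pderiv)
    then have K0: "poly K 0 = z" using \<open>w \<noteq> 0\<close> by (simp add: K pderiv_mult pderiv_pCons b_def)
    define v where "v i = (if i < d then c ^ i else z)" for i
    define W where "W i = (if i < d then [:c, b:] ^ i else K)" for i
    have W0: "poly (W i) 0 = v i" for i by (simp add: W_def v_def K0)
    have v_inj: "v i = v j \<longleftrightarrow> i = j" if "i \<le> d" "j \<le> d" for i j
      using that injV z span_base[of _ ?V] by (auto simp: v_def inj_on_def)
    have vS: "v i \<in> insert z ?V" for i by (auto simp: v_def)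
    have "\<exists>\<phi> :: 'a \<Rightarrow> rat. (\<forall>x y. \<phi> (x + y) = \<phi> x + \<phi> y) \<and> (\<forall>r x. \<phi> (of_rat r * x) = r * \<phi> x) \<and>
      (\<forall>w\<in>insert z ?V. \<phi> w = (if w = v j then 1 else 0))" for j
      by (rule rat_linear_functional[OF indS vS[of j]]) blast
    then obtain \<phi> :: "nat \<Rightarrow> 'a \<Rightarrow> rat" where phi_add: "\<And>j x y. \<phi> j (x + y) = \<phi> j x + \<phi> j y"
      and phi_scale: "\<And>j r x. \<phi> j (of_rat r * x) = r * \<phi> j x"
      and phi_S: "\<And>j w. w \<in> insert z ?V \<Longrightarrow> \<phi> j w = (if w = v j then 1 else 0)" by metis
    have phi0: "\<phi> j 0 = 0" for j using phi_add[of j 0 0] by simp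
    have "\<exists>R. \<forall>t. i \<le> d \<and> j \<le> d \<longrightarrow> poly (map_poly (\<phi> j) (W i)) t = (if i = j then 1 else 0) + t * poly R t" for i j
    proof (cases "i \<le> d \<and> j \<le> d")
      case True
      let ?P = "map_poly (\<phi> j) (W i)"
      obtain a R where aR: "?P = pCons a R" by (cases ?P) auto
      have "a = poly ?P 0" using aR by simp
      also have "\<dots> = \<phi> j (v i)"
        using functional_poly[of "\<phi> j" "W i" 0] phi_add phi_scale W0 by simp
      also have "\<dots> = (if i = j then 1 else 0)" using phi_S[OF vS[of i]] v_inj True by simp
      finally show ?thesis using aR by (intro exI[of _ R]) simp
    qed auto
    then obtain R where R: "\<And>i j t. i \<le> d \<Longrightarrow> j \<le> d \<Longrightarrow>
        poly (map_poly (\<phi> j) (W i)) t = (if i = j then 1 else 0) + t * poly (R i j) t" by metis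
    obtain t where t: "t > 0" and ker: "\<And>l. (\<forall>j<Suc d. (\<Sum>i<Suc d. l i * ((if i = j then 1 else 0) + t * poly (R i j) t)) = 0)
        \<Longrightarrow> \<forall>i<Suc d. l i = 0"
      using trivial_kernel_near_identity[of "Suc d" R] by blast
    define e where "e = c + of_rat t * b"
    have ev: "poly (W i) (of_rat t) = (if i < d then e ^ i else poly K (of_rat t))" for i
      by (simp add: W_def e_def poly_power)
    have indep: "\<forall>i<Suc d. l i = 0" if l: "(\<Sum>i<Suc d. of_rat (l i) * poly (W i) (of_rat t)) = 0" for l
    proof (rule ker, intro allI impI)
      fix j assume j: "j < Suc d"
      have phi_sum: "\<phi> j (\<Sum>i\<in>I. g i) = (\<Sum>i\<in>I. \<phi> j (g i))" if "finite I" for g and I :: "nat set"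
        using that by (induction I) (auto simp: phi0 phi_add)
      have "0 = \<phi> j (\<Sum>i<Suc d. of_rat (l i) * poly (W i) (of_rat t))" by (simp only: l phi0)
      also have "\<dots> = (\<Sum>i<Suc d. l i * poly (map_poly (\<phi> j) (W i)) t)"
        using functional_poly[of "\<phi> j"] phi_add phi_scale
        by (subst phi_sum) (auto intro!: sum.cong)
      also have "\<dots> = (\<Sum>i<Suc d. l i * ((if i = j then 1 else 0) + t * poly (R i j) t))"
        by (intro sum.cong) (use j R in auto)
      finally show "(\<Sum>i<Suc d. l i * ((if i = j then 1 else 0) + t * poly (R i j) t)) = 0" by simp
    qed
    obtain g where g: "int_minpoly_of g e" "degree g = deg e" using deg by blast
    have dg: "degree g \<le> d" using c g(2) d_def by simp
    \<comment> \<open>By maximality \<open>g\<close> has degree at most \<open>d\<close>. Cancelling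
      its coefficient at \<open>d\<close> against \<open>f\<close> leaves \<open>P\<close> of
      smaller degree; since \<open>g\<close> kills \<open>e\<close>, this is a relation between
      \<open>f(e)\<close> and lower powers of \<open>e\<close>, whose coefficients must vanish. Then
      \<open>k\<close> and \<open>P\<close> are 0, and so is \<open>g\<close>.\<close>
    define k where "k = coeff g d"
    define P where "P = smult (lead_coeff f) g - smult k f"
    have "coeff P i = 0" if "i \<ge> d" for i
    proof (cases "i = d")
      case True
      then show ?thesis using f(2) by (simp add: P_def k_def)
    next
      case False
      then show ?thesis using that dg f(2) by (simp add: P_def coeff_eq_0)
    qed
    then have "ipoly P e = of_int 1 * (\<Sum>i<d. of_rat (of_int (coeff P i)) * e ^ i)"
      by (intro ipoly_eq_rat_comb) auto
    then have "(\<Sum>i<d. of_rat (of_int (coeff P i)) * e ^ i) = ipoly P e" by (simp only: of_int_1 mult_1)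
    also have "\<dots> = - of_int k * ipoly f e"
      using g(1) by (simp add: P_def of_int_poly_hom.hom_minus of_int_hom.map_poly_hom_smult int_minpoly_of_def)
    also have "ipoly f e = of_rat t * poly K (of_rat t)"
    proof -
      have "poly H (of_rat t) = ipoly f e" by (simp add: H_def poly_pcompose F_def e_def)
      then show ?thesis by (simp add: K)
    qed
    finally have rel: "(\<Sum>i<d. of_rat (of_int (coeff P i)) * e ^ i) + of_int k * (of_rat t * poly K (of_rat t)) = 0"
      by (simp only: mult_minus_left add.left_inverse)
    define l where "l i = (if i < d then of_int (coeff P i) else of_int k * t)" for i
    have "(\<Sum>i<Suc d. of_rat (l i) * poly (W i) (of_rat t)) = 0"
      using rel by (simp add: ev l_def of_rat_mult mult.assoc)
    then have l0: "\<forall>i<Suc d. l i = 0" by (rule indep)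
    then have "k = 0" using t by (auto simp: l_def dest: spec[of _ d])
    have "coeff P i = 0" for i using l0 \<open>\<And>i. i \<ge> d \<Longrightarrow> coeff P i = 0\<close>
      by (cases "i < d") (auto simp: l_def dest: spec[of _ i])
    then have "P = 0" by (simp add: poly_eq_iff)
    then show False
      using \<open>k = 0\<close> int_minpoly_nonzero[OF g(1)] int_minpoly_nonzero[OF f(1)] by (simp add: P_def)
  qed
  then show ?thesis using f unfolding primitive_def by blast
qed

end

section \<open>Complex embeddings, norms and the lattice of integers\<close>

lemma complex_embeddings_iff:
  "\<sigma> \<in> complex_embeddings \<longleftrightarrow>
     (\<forall>x y. \<sigma> (x + y) = \<sigma> x + \<sigma> y) \<and> (\<forall>x y. \<sigma> (x * y) = \<sigma> x * \<sigma> y) \<and> \<sigma> 1 = 1"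
  by (auto simp: complex_embeddings_def Ring.ring_hom_def ring_of_type_algebra_def)

context
  fixes \<sigma> :: "'a::field_char_0 \<Rightarrow> complex"
  assumes \<sigma>: "\<sigma> \<in> complex_embeddings"
begin

lemma embedding_add: "\<sigma> (x + y) = \<sigma> x + \<sigma> y"
  and embedding_mult: "\<sigma> (x * y) = \<sigma> x * \<sigma> y"
  and embedding_1: "\<sigma> 1 = 1"
  using \<sigma> by (auto simp: complex_embeddings_iff)

lemma embedding_0: "\<sigma> 0 = 0"
  using embedding_add[of 0 0] by simp

lemma embedding_minus: "\<sigma> (- x) = - \<sigma> x"
  using embedding_add[of x "- x"] embedding_0 by (simp add: eq_neg_iff_add_eq_0 add.commute)

lemma embedding_diff: "\<sigma> (x - y) = \<sigma> x - \<sigma> y"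
  using embedding_add[of x "- y"] embedding_minus by simp

lemma embedding_of_nat: "\<sigma> (of_nat n) = of_nat n"
  by (induction n) (auto simp: embedding_0 embedding_add embedding_1)

lemma embedding_of_int: "\<sigma> (of_int k) = of_int k"
  by (cases k) (simp_all add: embedding_of_nat embedding_minus embedding_diff embedding_1 del: of_nat_Suc)

lemma embedding_power: "\<sigma> (x ^ n) = \<sigma> x ^ n"
  by (induction n) (auto simp: embedding_1 embedding_mult)

lemma embedding_sum: "\<sigma> (sum f A) = (\<Sum>a\<in>A. \<sigma> (f a))"
  by (induction A rule: infinite_finite_induct) (auto simp: embedding_0 embedding_add)

lemma embedding_ipoly: "\<sigma> (ipoly p x) = ipoly p (\<sigma> x)"
  by (simp add: poly_altdef embedding_sum embedding_mult embedding_power embedding_of_int)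

lemma embedding_root: "ipoly p x = 0 \<Longrightarrow> ipoly p (\<sigma> x) = 0"
  using embedding_ipoly[of p x] by (simp add: embedding_0)

lemma embedding_eq_0_iff: "\<sigma> x = 0 \<longleftrightarrow> x = 0"
proof
  assume "\<sigma> x = 0"
  show "x = 0"
  proof (rule ccontr)
    assume "x \<noteq> 0"
    then have "\<sigma> x * \<sigma> (inverse x) = 1" using embedding_mult[of x "inverse x"] by (simp add: embedding_1)
    then show False using \<open>\<sigma> x = 0\<close> by simp
  qed
qed (simp add: embedding_0)

lemma embedding_of_rat: "\<sigma> (of_rat r) = of_rat r"
proof -
  obtain a b where ab: "quotient_of r = (a, b)" by fastforce
  then have b: "b > 0" and "r * of_int b = of_int a"
    using quotient_of_denom_pos[OF ab] quotient_of_div[OF ab] by auto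
  from arg_cong[OF this(2), of "of_rat :: rat \<Rightarrow> 'a"] arg_cong[OF this(2), of "of_rat :: rat \<Rightarrow> complex"]
  have r: "of_rat r * of_int b = (of_int a :: 'a)" "of_rat r * of_int b = (of_int a :: complex)"
    by (simp_all add: of_rat_mult)
  have "\<sigma> (of_rat r) * of_int b = of_int a" using r(1) by (metis embedding_mult embedding_of_int)
  then have "\<sigma> (of_rat r) * of_int b = of_rat r * of_int b" using r(2) by simp
  then show ?thesis using b by simp
qed

end

lemma finite_if_unique:
  assumes "\<And>x y. x \<in> S \<Longrightarrow> y \<in> S \<Longrightarrow> x = y"
  shows "finite S"
proof (cases "S = {}")
  case False
  then obtain a where "a \<in> S" by blast
  then have "S \<subseteq> {a}" using assms by blast
  then show ?thesis using finite_subset by blast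
qed simp

context number_field_basis
begin

text \<open>Multiplying the equation of \<open>x\<close> by \<open>e ^ (n - 1)\<close>, where
  \<open>e\<close> is the leading coefficient, makes it monic in \<open>e * x\<close>.\<close>

lemma multiple_algebraic_int: "\<exists>m>0. algebraic_int (of_int m * (x :: 'a))"
proof -
  obtain f where f: "int_minpoly_of f x" using int_minpoly_exists' by blast
  define n e where "n = degree f" and "e = lead_coeff f"
  have n: "n > 0" using int_minpoly_degree_pos[OF f] by (simp add: n_def)
  have "e \<noteq> 0" using int_minpoly_nonzero[OF f] by (simp add: e_def)
  define y where "y = of_int e * x"
  have "(\<Sum>i\<le>n. of_int (coeff f i) * x ^ i) = ipoly f x" by (simp add: poly_altdef n_def)
  also have "\<dots> = 0" using f by (simp add: int_minpoly_of_def)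
  finally have "(\<Sum>i<n. of_int (coeff f i) * x ^ i) + of_int e * x ^ n = 0"
    by (simp add: e_def n_def flip: lessThan_Suc_atMost)
  then have ex: "of_int e * x ^ n = (\<Sum>i<n. of_int (- coeff f i) * x ^ i)"
    by (simp add: sum_negf add_eq_0_iff)
  have "y ^ n = of_int e ^ (n - 1) * (of_int e * x ^ n)"
    using n by (cases n) (auto simp: y_def power_mult_distrib)
  also have "\<dots> = (\<Sum>i<n. of_int e ^ (n - 1) * (of_int (- coeff f i) * x ^ i))"
    by (simp only: ex sum_distrib_left)
  also have "\<dots> = (\<Sum>i<n. of_int (- coeff f i * e ^ (n - 1 - i)) * y ^ i)"
  proof (rule sum.cong)
    fix i assume "i \<in> {..<n}"
    then have "n - 1 = (n - 1 - i) + i" by auto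
    then have "of_int e ^ (n - 1) = (of_int e ^ (n - 1 - i) * of_int e ^ i :: 'a)" by (metis power_add)
    then show "of_int e ^ (n - 1) * (of_int (- coeff f i) * x ^ i) = of_int (- coeff f i * e ^ (n - 1 - i)) * y ^ i"
      by (simp add: y_def power_mult_distrib mult_ac)
  qed simp
  finally have y: "algebraic_int y" using n by (rule algebraic_int_if_power_eq[rotated])
  show ?thesis
  proof (cases "e > 0")
    case True
    then show ?thesis using y y_def by blast
  next
    case False
    then have "- e > 0" using \<open>e \<noteq> 0\<close> by simp
    moreover have "of_int (- e) * x = - y" by (simp add: y_def)
    ultimately show ?thesis using y by (metis algebraic_int_minus)
  qed
qed

section \<open>Embeddings as roots of a minimal polynomial\<close>

lemma embeddings_bij_roots:
  assumes f: "int_minpoly_of f (x :: 'a)" "degree f = dimension"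
  shows "bij_betw (\<lambda>\<sigma>. \<sigma> x) complex_embeddings {r :: complex. ipoly f r = 0}"
proof -
  have px: "primitive x" using f by (auto simp: primitive_def)
  show ?thesis
  proof (rule bij_betwI')
    fix \<sigma> \<tau> :: "'a \<Rightarrow> complex" assume s: "\<sigma> \<in> complex_embeddings" "\<tau> \<in> complex_embeddings"
    show "\<sigma> x = \<tau> x \<longleftrightarrow> \<sigma> = \<tau>"
    proof
      assume eq: "\<sigma> x = \<tau> x"
      show "\<sigma> = \<tau>"
      proof
        fix y
        obtain r where "y = (\<Sum>i<dimension. of_rat (r i) * x ^ i)" using primitive_rat_comb[OF px] by blast
        then show "\<sigma> y = \<tau> y"
          using s eq by (simp add: embedding_sum embedding_mult embedding_power embedding_of_rat)
      qed
    qed simp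
  next
    fix \<sigma> :: "'a \<Rightarrow> complex" assume s: "\<sigma> \<in> complex_embeddings"
    show "\<sigma> x \<in> {r. ipoly f r = 0}"
      using embedding_root[OF s, of f x] f by (simp add: int_minpoly_of_def)
  next
    fix r :: complex assume "r \<in> {r. ipoly f r = 0}"
    then have fr: "int_minpoly_of f r" using int_minpoly_conjugate[OF f(1)] by simp
    \<comment> \<open>\<open>rel\<close> is the graph of the intended embedding, which sends
      \<open>p(x) / D\<close> to \<open>p(r) / D\<close>. It is single valued because
      \<open>f\<close> is the minimal polynomial of \<open>r\<close> as well, so integer relations
      of \<open>x\<close> transfer to \<open>r\<close>.\<close>
    define rel where "rel y z \<longleftrightarrow> (\<exists>D p. D \<noteq> (0::int) \<and> of_int D * y = ipoly p x \<and> of_int D * z = ipoly p r)"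
      for y :: 'a and z :: complex
    have ex: "\<exists>z. rel y z" for y
    proof -
      obtain D p where D: "D > (0::int)" "of_int D * y = ipoly p x" using primitive_ipoly[OF px] by blast
      then have "rel y (ipoly p r / of_int D)" unfolding rel_def by (intro exI[of _ D] exI[of _ p]) auto
      then show ?thesis by blast
    qed
    have unique: "z = z'" if zz: "rel y z" "rel y z'" for y z z'
    proof -
      obtain D p D' p' where D: "D \<noteq> 0" "of_int D * y = ipoly p x" "of_int D * z = ipoly p r"
        "D' \<noteq> 0" "of_int D' * y = ipoly p' x" "of_int D' * z' = ipoly p' r"
        using zz unfolding rel_def by blast
      define q where "q = smult D' p - smult D p'"
      have q: "ipoly q w = of_int D' * ipoly p w - of_int D * ipoly p' w" for w :: "'b::field_char_0"
        by (simp add: q_def of_int_poly_hom.hom_minus of_int_hom.map_poly_hom_smult)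
      have "ipoly q x = of_int D' * (of_int D * y) - of_int D * (of_int D' * y)" by (simp only: q D)
      also have "\<dots> = 0" by simp
      finally have "ipoly q r = 0" using f(1) fr by (simp add: int_minpoly_of_def)
      then have "of_int D' * (of_int D * z) = of_int D * (of_int D' * z')" by (simp only: q D) simp
      then show ?thesis using D(1,4) by simp
    qed
    define \<sigma> where "\<sigma> y = (SOME z. rel y z)" for y
    have \<sigma>: "rel y z \<longleftrightarrow> z = \<sigma> y" for y z
      using someI_ex[OF ex[of y]] unique unfolding \<sigma>_def by blast
    have "\<sigma> \<in> complex_embeddings"
      unfolding complex_embeddings_iff
    proof (intro conjI allI)
      fix y y'
      obtain D p D' p' where D: "D \<noteq> 0" "of_int D * y = ipoly p x" "of_int D * \<sigma> y = ipoly p r"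
        "D' \<noteq> 0" "of_int D' * y' = ipoly p' x" "of_int D' * \<sigma> y' = ipoly p' r"
        using \<sigma>[of y "\<sigma> y"] \<sigma>[of y' "\<sigma> y'"] unfolding rel_def by blast
      have q: "ipoly (smult D' p + smult D p') w = of_int D' * ipoly p w + of_int D * ipoly p' w"
        "ipoly (p * p') w = ipoly p w * ipoly p' w" for w :: "'b::field_char_0"
        by (simp_all add: of_int_poly_hom.hom_add of_int_poly_hom.hom_mult of_int_hom.map_poly_hom_smult)
      have "of_int (D * D') * (y + y') = of_int D' * (of_int D * y) + of_int D * (of_int D' * y')"
        "of_int (D * D') * (\<sigma> y + \<sigma> y') = of_int D' * (of_int D * \<sigma> y) + of_int D * (of_int D' * \<sigma> y')"
        by (simp_all add: algebra_simps)
      then have "of_int (D * D') * (y + y') = ipoly (smult D' p + smult D p') x"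
        "of_int (D * D') * (\<sigma> y + \<sigma> y') = ipoly (smult D' p + smult D p') r"
        by (simp_all only: D q)
      moreover have DD: "D * D' \<noteq> 0" using D by simp
      ultimately have "rel (y + y') (\<sigma> y + \<sigma> y')" unfolding rel_def by blast
      then show "\<sigma> (y + y') = \<sigma> y + \<sigma> y'" using \<sigma> by metis
      have "of_int (D * D') * (y * y') = (of_int D * y) * (of_int D' * y')"
        "of_int (D * D') * (\<sigma> y * \<sigma> y') = (of_int D * \<sigma> y) * (of_int D' * \<sigma> y')"
        by (simp_all add: algebra_simps)
      then have "of_int (D * D') * (y * y') = ipoly (p * p') x"
        "of_int (D * D') * (\<sigma> y * \<sigma> y') = ipoly (p * p') r"
        by (simp_all only: D q)
      then have "rel (y * y') (\<sigma> y * \<sigma> y')" using DD unfolding rel_def by blast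
      then show "\<sigma> (y * y') = \<sigma> y * \<sigma> y'" using \<sigma> by metis
    next
      have "rel 1 1" unfolding rel_def by (intro exI[of _ 1]) auto
      then show "\<sigma> 1 = 1" using \<sigma> by metis
    qed
    moreover have "rel x r" unfolding rel_def
      by (intro exI[of _ 1] exI[of _ "[:0, 1:]"]) (auto simp: of_int_hom.map_poly_pCons_hom)
    then have "r = \<sigma> x" using \<sigma> by metis
    ultimately show "\<exists>\<sigma>\<in>complex_embeddings. r = \<sigma> x" by blast
  qed
qed

lemma finite_complex_embeddings: "finite (complex_embeddings :: ('a \<Rightarrow> complex) set)"
  and card_complex_embeddings: "card (complex_embeddings :: ('a \<Rightarrow> complex) set) = dimension"
proof -
  obtain x f where f: "int_minpoly_of f (x :: 'a)" "degree f = dimension"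
    using primitive_exists by (auto simp: primitive_def)
  show "finite (complex_embeddings :: ('a \<Rightarrow> complex) set)"
    using bij_betw_finite[OF embeddings_bij_roots[OF f]] int_minpoly_roots(1)[OF f(1)] by simp
  show "card (complex_embeddings :: ('a \<Rightarrow> complex) set) = dimension"
    using bij_betw_same_card[OF embeddings_bij_roots[OF f]] int_minpoly_roots(2)[OF f(1)] f(2) by simp
qed

text \<open>Distinct values of the embeddings at \<open>x\<close> are distinct roots of its minimal
  polynomial, whose degree then reaches \<open>dimension\<close>. This criterion makes translates
  and products easy to test for primitivity.\<close>

lemma primitive_iff_separating:
  "primitive x \<longleftrightarrow> inj_on (\<lambda>\<sigma>. \<sigma> x) complex_embeddings"
proof
  assume "primitive x"
  then show "inj_on (\<lambda>\<sigma>. \<sigma> x) complex_embeddings"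
    using embeddings_bij_roots unfolding primitive_def bij_betw_def by blast
next
  assume inj: "inj_on (\<lambda>\<sigma>. \<sigma> x) complex_embeddings"
  obtain f where f: "int_minpoly_of f x" using int_minpoly_exists' by blast
  have "ipoly f (\<sigma> x) = 0" if "\<sigma> \<in> complex_embeddings" for \<sigma>
    using embedding_root[OF that, of f x] f by (simp add: int_minpoly_of_def)
  then have "(\<lambda>\<sigma>. \<sigma> x) ` complex_embeddings \<subseteq> {r. ipoly f r = 0}" by auto
  then have "card ((\<lambda>\<sigma>. \<sigma> x) ` complex_embeddings) \<le> degree f"
    using card_mono[OF int_minpoly_roots(1)[OF f]] int_minpoly_roots(2)[OF f] by simp
  then have "dimension \<le> degree f" using card_image[OF inj] card_complex_embeddings by simp
  then show "primitive x" using degree_int_minpoly_le[OF f] f unfolding primitive_def by force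
qed

lemma primitive_algebraic_int_exists: "\<exists>x. primitive x \<and> algebraic_int x"
proof -
  obtain x where x: "primitive x" using primitive_exists by blast
  obtain m where m: "m > 0" "algebraic_int (of_int m * x)" using multiple_algebraic_int by blast
  have "primitive (of_int m * x)"
    using x m(1) unfolding primitive_iff_separating inj_on_def by (simp add: embedding_mult embedding_of_int)
  then show ?thesis using m by blast
qed

section \<open>The lattice of powers and the index formula\<close>

definition power_lattice :: "'a \<Rightarrow> 'a set" where
  "power_lattice x = {ipoly p x | p. \<forall>i\<ge>dimension. coeff p i = 0}"

lemma power_lattice_eq_span: "power_lattice x = zspan ((^) x ` {..<dimension})"
proof
  show "power_lattice x \<subseteq> zspan ((^) x ` {..<dimension})"
  proof
    fix y assume "y \<in> power_lattice x"
    then obtain p where p: "y = ipoly p x" "\<forall>i\<ge>dimension. coeff p i = 0" by (auto simp: power_lattice_def)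
    have "y = of_int 1 * (\<Sum>i<dimension. of_rat (of_int (coeff p i)) * x ^ i)"
      unfolding p(1) by (rule ipoly_eq_rat_comb) (use p in auto)
    then have "y = (\<Sum>i<dimension. of_int (coeff p i) * x ^ i)" by simp
    also have "\<dots> \<in> zspan ((^) x ` {..<dimension})"
      by (intro Z.span_sum Z.span_scale Z.span_base) auto
    finally show "y \<in> zspan ((^) x ` {..<dimension})" .
  qed
  show "zspan ((^) x ` {..<dimension}) \<subseteq> power_lattice x"
  proof (rule Z.span_minimal)
    show "(^) x ` {..<dimension} \<subseteq> power_lattice x"
    proof
      fix y assume "y \<in> (^) x ` {..<dimension}"
      then obtain i where i: "i < dimension" "y = x ^ i" by auto
      then have "y = ipoly (monom 1 i) x" by (simp add: map_poly_monom poly_monom)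
      moreover have "\<forall>j\<ge>dimension. coeff (monom 1 i :: int poly) j = 0" using i by auto
      ultimately show "y \<in> power_lattice x" unfolding power_lattice_def by blast
    qed
    show "zsub (power_lattice x)"
    proof (rule zsubI)
      show "0 \<in> power_lattice x" unfolding power_lattice_def by (auto intro: exI[of _ "0 :: int poly"])
      fix y z assume "y \<in> power_lattice x" "z \<in> power_lattice x"
      then obtain p q where pq: "y = ipoly p x" "\<forall>i\<ge>dimension. coeff p i = 0"
        "z = ipoly q x" "\<forall>i\<ge>dimension. coeff q i = 0" by (auto simp: power_lattice_def)
      then have "y + z = ipoly (p + q) x" "\<forall>i\<ge>dimension. coeff (p + q) i = 0"
        by (simp_all add: of_int_poly_hom.hom_add)
      then show "y + z \<in> power_lattice x" unfolding power_lattice_def by blast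
    next
      fix y assume "y \<in> power_lattice x"
      then obtain p where p: "y = ipoly p x" "\<forall>i\<ge>dimension. coeff p i = 0" by (auto simp: power_lattice_def)
      then have "- y = ipoly (- p) x" "\<forall>i\<ge>dimension. coeff (- p) i = 0"
        by (simp_all add: of_int_poly_hom.hom_uminus)
      then show "- y \<in> power_lattice x" unfolding power_lattice_def by blast
    qed
  qed
qed

lemma zlattice_power_lattice:
  assumes "primitive x"
  shows "zlattice (power_lattice x)"
proof -
  have "zfg (power_lattice x)" unfolding zfg_def power_lattice_eq_span by blast
  moreover have "\<exists>m::int. m > 0 \<and> of_int m * y \<in> power_lattice x" for y
    using primitive_ipoly[OF assms, of y] unfolding power_lattice_def by blast
  ultimately show ?thesis unfolding zlattice_def by blast
qed

text \<open>Modulo \<open>x L\<close> an element of \<open>L\<close> is congruent to the constant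
  coefficient of a polynomial representing it, and an integer lies in \<open>x L\<close> exactly
  when the constant term \<open>m\<close> of \<open>f\<close> divides it. So the quotient is a copy
  of the integers modulo \<open>m\<close>, and \<open>m\<close> is up to sign the product of the
  conjugates.\<close>

lemma idx_power_lattice:
  assumes f: "int_minpoly_of f x" "lead_coeff f = 1" "degree f = dimension" and x: "x \<noteq> 0"
  defines "L \<equiv> power_lattice x"
  shows "(*) x ` L \<subseteq> L" and "real (idx L ((*) x ` L)) = (\<Prod>\<sigma>\<in>complex_embeddings. cmod (\<sigma> x))"
proof -
  have n: "dimension > 0" using int_minpoly_degree_pos[OF f(1)] f(3) by simp
  have fx: "ipoly f x = 0" using f(1) by (simp add: int_minpoly_of_def)
  show stable: "(*) x ` L \<subseteq> L"
  proof (rule image_subsetI)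
    fix y assume "y \<in> L"
    then obtain p where p: "y = ipoly p x" "\<forall>i\<ge>dimension. coeff p i = 0"
      by (auto simp: L_def power_lattice_def)
    \<comment> \<open>The shift may create a term of degree \<open>dimension\<close>; a multiple of
      the monic \<open>f\<close> removes it.\<close>
    define q where "q = pCons 0 p - smult (coeff p (dimension - 1)) f"
    have "x * y = ipoly q x"
      using fx p by (simp add: q_def of_int_poly_hom.hom_minus of_int_hom.map_poly_hom_smult of_int_hom.map_poly_pCons_hom)
    moreover have "coeff q i = 0" if "i \<ge> dimension" for i
    proof (cases "i = dimension")
      case True
      then show ?thesis using f n by (auto simp: q_def coeff_pCons split: nat.split)
    next
      case False
      then show ?thesis using that p(2) f(3) by (auto simp: q_def coeff_pCons coeff_eq_0 split: nat.split)
    qed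
    ultimately show "x * y \<in> L" unfolding L_def power_lattice_def by blast
  qed
  have px: "primitive x" using f by (auto simp: primitive_def)
  have zs: "zsub L" "zsub ((*) x ` L)" using zlattice_zsub[OF zlattice_power_lattice[OF px]] zsub_scale
    by (auto simp: L_def)
  obtain m f1 where mf: "f = pCons m f1" by (cases f) auto
  \<comment> \<open>Dropping the constant coefficient lowers all exponents by one, so a coefficient
    at \<open>dimension\<close> is harmless; this admits \<open>f\<close> itself.\<close>
  have tail: "ipoly p x \<in> L" if "\<forall>i\<ge>dimension. coeff (pCons k p) i = 0 \<or> i = dimension" for k p
    unfolding L_def power_lattice_def
  proof (intro CollectI exI conjI allI impI)
    fix i assume "dimension \<le> i"
    then have "coeff (pCons k p) (Suc i) = 0" using that[rule_format, of "Suc i"] by simp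
    then show "coeff p i = 0" by simp
  qed simp
  have "m \<noteq> 0"
  proof
    assume "m = 0"
    then have "ipoly f1 x = 0" using fx x by (simp add: mf of_int_hom.map_poly_pCons_hom)
    then have "f dvd f1" using f(1) by (simp add: int_minpoly_of_def)
    moreover have "f1 \<noteq> 0" using mf \<open>m = 0\<close> f(2) by auto
    ultimately have "degree f \<le> degree f1" using dvd_imp_degree_le by blast
    then show False using mf \<open>f1 \<noteq> 0\<close> by simp
  qed
  have m_mem: "of_int (m * k) \<in> (*) x ` L" for k
  proof -
    have "ipoly f1 x \<in> L" by (rule tail[of m]) (use f(3) in \<open>auto simp: mf[symmetric] coeff_eq_0\<close>)
    then have "x * ipoly f1 x \<in> (*) x ` L" by (rule imageI)
    moreover have "of_int m = - (x * ipoly f1 x)"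
      using fx by (simp add: mf of_int_hom.map_poly_pCons_hom eq_neg_iff_add_eq_0)
    ultimately have "of_int m \<in> (*) x ` L" using Z.subspace_neg[OF zs(2)] by metis
    then show ?thesis using Z.subspace_scale[OF zs(2), of "of_int m" k] by (simp add: mult.commute)
  qed
  have int_mem: "m dvd k" if k: "of_int k \<in> (*) x ` L" for k
  proof -
    obtain p where p: "of_int k = x * ipoly p x" using k by (auto simp: L_def power_lattice_def)
    then have "ipoly (pCons (- k) p) x = 0" by (simp add: of_int_hom.map_poly_pCons_hom)
    then have "f dvd pCons (- k) p" using f(1) by (simp add: int_minpoly_of_def)
    then obtain g where "pCons (- k) p = f * g" by (elim dvdE)
    then have "- k = m * coeff g 0" by (metis coeff_mult_0 coeff_pCons_0 mf)
    then show ?thesis by (metis dvd_minus_iff dvd_triv_left)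
  qed
  have "bij_betw (\<lambda>k. (+) (of_int k) ` (*) x ` L) {0..<\<bar>m\<bar>} (quot L ((*) x ` L))"
  proof (rule bij_betwI')
    fix k l assume kl: "k \<in> {0..<\<bar>m\<bar>}" "l \<in> {0..<\<bar>m\<bar>}"
    have "(+) (of_int k) ` (*) x ` L = (+) (of_int l) ` (*) x ` L \<longleftrightarrow> (of_int (k - l) :: 'a) \<in> (*) x ` L"
      by (simp only: coset_eq_iff[OF zs(2)] of_int_diff)
    also have "\<dots> \<longleftrightarrow> m dvd k - l" using int_mem[of "k - l"] m_mem by (metis dvdE)
    also have "\<dots> \<longleftrightarrow> k = l"
    proof
      assume "m dvd k - l"
      moreover have "\<bar>k - l\<bar> < \<bar>m\<bar>" using kl by auto
      ultimately show "k = l" using dvd_imp_le_int[of "k - l" m] by force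
    qed auto
    finally show "(+) (of_int k) ` (*) x ` L = (+) (of_int l) ` (*) x ` L \<longleftrightarrow> k = l" .
  next
    fix k
    have "of_int k = ipoly [:k:] x" by (simp add: of_int_hom.map_poly_pCons_hom)
    moreover have "\<forall>i\<ge>dimension. coeff [:k:] i = 0" using n by (auto simp: coeff_pCons split: nat.split)
    ultimately have "of_int k \<in> L" unfolding L_def power_lattice_def by blast
    then show "(+) (of_int k) ` (*) x ` L \<in> quot L ((*) x ` L)" by (auto simp: quot_def)
  next
    fix U assume "U \<in> quot L ((*) x ` L)"
    then obtain p where p: "U = (+) (ipoly p x) ` (*) x ` L" "\<forall>i\<ge>dimension. coeff p i = 0"
      by (auto simp: quot_def L_def power_lattice_def)
    obtain a p1 where ap: "p = pCons a p1" by (cases p) auto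
    define k where "k = a mod \<bar>m\<bar>"
    \<comment> \<open>The sign of \<open>m\<close> compensates for reducing modulo its absolute
      value.\<close>
    have "a = k + m * (sgn m * (a div \<bar>m\<bar>))"
      by (simp add: k_def mult.assoc[symmetric] abs_sgn[symmetric] mult.commute)
    then have "(of_int a :: 'a) = of_int k + of_int (m * (sgn m * (a div \<bar>m\<bar>)))"
      by (metis of_int_add)
    moreover have "ipoly p x = of_int a + x * ipoly p1 x" by (simp add: ap of_int_hom.map_poly_pCons_hom)
    ultimately have "ipoly p x - of_int k = x * ipoly p1 x + of_int (m * (sgn m * (a div \<bar>m\<bar>)))"
      by (smt (verit) add.commute add_diff_cancel_left' add.assoc)
    moreover have "ipoly p1 x \<in> L" by (rule tail[of a]) (use p(2) in \<open>auto simp: ap[symmetric]\<close>)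
    ultimately have "ipoly p x - of_int k \<in> (*) x ` L"
      using Z.subspace_add[OF zs(2) imageI m_mem] by metis
    then have "U = (+) (of_int k) ` (*) x ` L" using p(1) coset_eq_iff[OF zs(2)] by blast
    moreover have "k \<in> {0..<\<bar>m\<bar>}" using \<open>m \<noteq> 0\<close> by (simp add: k_def)
    ultimately show "\<exists>k\<in>{0..<\<bar>m\<bar>}. U = (+) (of_int k) ` (*) x ` L" by blast
  qed
  then have "idx L ((*) x ` L) = card {0..<\<bar>m\<bar>}" unfolding idx_def by (metis bij_betw_same_card)
  then have "real (idx L ((*) x ` L)) = \<bar>of_int m\<bar>" by simp
  also have "\<dots> = cmod (of_int (coeff f 0))" by (simp add: mf)
  also have "\<dots> = (\<Prod>r | ipoly f r = 0. cmod r)"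
    unfolding int_minpoly_roots(3)[OF f(1,2), symmetric] by (simp flip: prod_norm)
  also have "\<dots> = (\<Prod>\<sigma>\<in>complex_embeddings. cmod (\<sigma> x))"
    by (rule prod.reindex_bij_betw[OF embeddings_bij_roots[OF f(1,3)], symmetric])
  finally show "real (idx L ((*) x ` L)) = (\<Prod>\<sigma>\<in>complex_embeddings. cmod (\<sigma> x))" .
qed

text \<open>Stability under \<open>\<theta>\<close> puts all powers of a primitive element into
  \<open>M\<close>, and these span the field over the rationals; hence \<open>M\<close> has full
  rank.\<close>

lemma stable_lattice_exists:
  assumes \<theta>: "primitive \<theta>" "algebraic_int \<theta>" and x: "algebraic_int x"
  shows "\<exists>M. zlattice M \<and> (*) \<theta> ` M \<subseteq> M \<and> (*) x ` M \<subseteq> M"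
proof -
  obtain M where M: "zfg M" "1 \<in> M" "(*) \<theta> ` M \<subseteq> M" "(*) x ` M \<subseteq> M"
    using stable_fg_of_algebraic_ints[OF \<theta>(2) x] by blast
  have zM: "zsub M" using M(1) by (rule zfg_zsub)
  have pow: "\<theta> ^ i \<in> M" for i using M(2,3) by (induction i) auto
  have "zlattice M"
    unfolding zlattice_def
  proof (intro conjI allI M(1))
    fix y
    obtain D p where D: "D > (0::int)" "of_int D * y = ipoly p \<theta>" using primitive_ipoly[OF \<theta>(1)] by blast
    have "ipoly p \<theta> = (\<Sum>i\<le>degree p. of_int (coeff p i) * \<theta> ^ i)" by (simp add: poly_altdef)
    also have "\<dots> \<in> M" using pow by (intro Z.subspace_sum[OF zM] Z.subspace_scale[OF zM])
    finally show "\<exists>m>0. of_int m * y \<in> M" using D by metis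
  qed
  then show ?thesis using M by blast
qed

lemma monic_int_minpoly_primitive:
  assumes x: "primitive x" "algebraic_int x"
  shows "\<exists>f. int_minpoly_of f x \<and> lead_coeff f = 1 \<and> degree f = dimension"
proof -
  obtain f g where fg: "int_minpoly_of f x" "degree f = dimension" "lead_coeff g = 1" "int_minpoly_of g x"
    using monic_int_minpoly_exists[OF x(2)] x(1) by (auto simp: primitive_def)
  then have "f dvd g" "g dvd f" unfolding int_minpoly_of_def by (metis dvd_refl)+
  then have "degree f \<le> degree g" "degree g \<le> degree f"
    using dvd_imp_degree_le int_minpoly_nonzero[OF fg(1)] int_minpoly_nonzero[OF fg(4)] by blast+
  then have "degree g = dimension" using fg(2) by simp
  then show ?thesis using fg(3,4) by blast
qed

text \<open>For primitive \<open>b\<close> take \<open>L = \<int>[b]\<close>. In general, \<open>a\<close> and \<open>b * a\<close> are primitive for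
  a suitable integer translate \<open>a\<close> of a primitive element, and both sides are multiplicative.\<close>

theorem idx_scale_eq_prod_embeddings:
  assumes L: "zlattice L" and b: "(b :: 'a) \<noteq> 0" "(*) b ` L \<subseteq> L"
  shows "real (idx L ((*) b ` L)) = (\<Prod>\<sigma>\<in>complex_embeddings. cmod (\<sigma> b))"
proof -
  let ?E = "complex_embeddings :: ('a \<Rightarrow> complex) set" and ?N = "\<lambda>x. \<Prod>\<sigma>\<in>complex_embeddings. cmod (\<sigma> (x :: 'a))"
  obtain \<theta> :: 'a where \<theta>: "primitive \<theta>" "algebraic_int \<theta>" using primitive_algebraic_int_exists by blast
  have "L \<noteq> {0}"
  proof
    assume "L = {0}"
    moreover obtain m :: int where "m > 0" "of_int m * (1 :: 'a) \<in> L" using L unfolding zlattice_def by blast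
    ultimately show False by simp
  qed
  then have b_int: "algebraic_int b" using algebraic_int_if_stable b(2) L by (auto simp: zlattice_def)
  \<comment> \<open>These are the \<open>t\<close> for which \<open>\<theta> + t\<close> is 0 or
    \<open>b * (\<theta> + t)\<close> fails to separate embeddings. A pair of embeddings excludes at
    most one \<open>t\<close>: two solutions would force equal values at \<open>b\<close>, hence at
    \<open>\<theta>\<close>, which separates them.\<close>
  define bad :: "nat set" where "bad = {t. \<theta> + of_nat t = 0} \<union>
     (\<Union>\<sigma>\<in>?E. \<Union>\<tau>\<in>?E. {t. \<sigma> \<noteq> \<tau> \<and> \<sigma> b * (\<sigma> \<theta> + of_nat t) = \<tau> b * (\<tau> \<theta> + of_nat t)})"
  have "finite bad"
    unfolding bad_def
  proof (intro finite_UnI finite_UN_I finite_complex_embeddings)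
    show "finite {t. \<theta> + of_nat t = 0}"
      by (rule finite_if_unique) (metis add_left_cancel mem_Collect_eq of_nat_eq_iff)
    fix \<sigma> \<tau> assume s: "\<sigma> \<in> ?E" "\<tau> \<in> ?E"
    show "finite {t. \<sigma> \<noteq> \<tau> \<and> \<sigma> b * (\<sigma> \<theta> + of_nat t) = \<tau> b * (\<tau> \<theta> + of_nat t)}"
    proof (rule finite_if_unique)
      fix k l assume "k \<in> {t. \<sigma> \<noteq> \<tau> \<and> \<sigma> b * (\<sigma> \<theta> + of_nat t) = \<tau> b * (\<tau> \<theta> + of_nat t)}"
        "l \<in> {t. \<sigma> \<noteq> \<tau> \<and> \<sigma> b * (\<sigma> \<theta> + of_nat t) = \<tau> b * (\<tau> \<theta> + of_nat t)}"
      then have kl: "\<sigma> \<noteq> \<tau>" "\<sigma> b * (\<sigma> \<theta> + of_nat k) = \<tau> b * (\<tau> \<theta> + of_nat k)"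
        "\<sigma> b * (\<sigma> \<theta> + of_nat l) = \<tau> b * (\<tau> \<theta> + of_nat l)" by auto
      show "k = l"
      proof (rule ccontr)
        assume "k \<noteq> l"
        have "(\<sigma> b - \<tau> b) * (of_nat k - of_nat l) =
          (\<sigma> b * (\<sigma> \<theta> + of_nat k) - \<tau> b * (\<tau> \<theta> + of_nat k)) - (\<sigma> b * (\<sigma> \<theta> + of_nat l) - \<tau> b * (\<tau> \<theta> + of_nat l))"
          by (simp add: algebra_simps)
        also have "\<dots> = 0" using kl by simp
        finally have "\<sigma> b = \<tau> b" using \<open>k \<noteq> l\<close> by simp
        then have "\<sigma> \<theta> = \<tau> \<theta>" using kl(2) b(1) embedding_eq_0_iff[OF s(2)] by simp
        then show False using kl(1) \<theta>(1) s unfolding primitive_iff_separating inj_on_def by blast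
      qed
    qed
  qed
  then obtain t where t: "t \<notin> bad" using ex_new_if_finite[OF infinite_UNIV_nat] by blast
  define a where "a = \<theta> + of_nat t"
  have a0: "a \<noteq> 0" using t by (auto simp: a_def bad_def)
  have a_int: "algebraic_int a" using \<theta>(2) algebraic_int_of_int[of "int t"] by (auto simp: a_def)
  have sa: "\<sigma> a = \<sigma> \<theta> + of_nat t" if "\<sigma> \<in> ?E" for \<sigma>
    using that by (simp add: a_def embedding_add embedding_of_nat)
  have pa: "primitive a" using \<theta>(1) unfolding primitive_iff_separating inj_on_def by (simp add: sa)
  have pab: "primitive (b * a)"
    unfolding primitive_iff_separating inj_on_def using t sa by (auto simp: bad_def embedding_mult)
  obtain M where lM: "zlattice M" and M: "(*) \<theta> ` M \<subseteq> M" "(*) b ` M \<subseteq> M"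
    using stable_lattice_exists[OF \<theta> b_int] by blast
  have zM: "zsub M" using lM by (rule zlattice_zsub)
  have aM: "(*) a ` M \<subseteq> M"
  proof (rule image_subsetI)
    fix m assume m: "m \<in> M"
    have "a * m = \<theta> * m + of_int (int t) * m" by (simp add: a_def distrib_right)
    also have "\<dots> \<in> M"
      using M(1) m by (intro Z.subspace_add[OF zM] Z.subspace_scale[OF zM]) auto
    finally show "a * m \<in> M" .
  qed
  have abM: "(*) (b * a) ` M \<subseteq> M" using aM M(2) by (auto simp: mult.assoc)
  have prim: "real (idx M ((*) x ` M)) = ?N x"
    if x: "primitive x" "algebraic_int x" "x \<noteq> 0" "(*) x ` M \<subseteq> M" for x
  proof -
    obtain f where f: "int_minpoly_of f x" "lead_coeff f = 1" "degree f = dimension" using monic_int_minpoly_primitive[OF x(1,2)] by blast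
    show ?thesis
      using idx_power_lattice[OF f x(3)]
        idx_scale_lattice_independent[OF lM zlattice_power_lattice[OF x(1)] x(3,4)] by simp
  qed
  have "?N b * ?N a = ?N (b * a)" by (simp add: embedding_mult norm_mult prod.distrib)
  also have "\<dots> = real (idx M ((*) (b * a) ` M))"
    using prim[OF pab algebraic_int_mult[OF b_int a_int] _ abM] a0 b(1) by simp
  also have "\<dots> = real (idx M ((*) b ` M)) * real (idx M ((*) a ` M))"
    using idx_scale_mult[OF zM b(1) M(2) aM] by simp
  also have "real (idx M ((*) a ` M)) = ?N a" by (rule prim[OF pa a_int a0 aM])
  finally have "(?N b - real (idx M ((*) b ` M))) * ?N a = 0" by (simp add: algebra_simps)
  moreover have "?N a \<noteq> 0" using a0 by (simp add: finite_complex_embeddings embedding_eq_0_iff)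
  ultimately have "real (idx M ((*) b ` M)) = ?N b" by simp
  then show ?thesis using idx_scale_lattice_independent[OF L lM b M(2)] by simp
qed

text \<open>The product is an index in some lattice stable under \<open>x\<close>, hence a positive
  integer.\<close>

lemma prod_embeddings_ge_1:
  assumes "algebraic_int x" "x \<noteq> 0"
  shows "(\<Prod>\<sigma>\<in>complex_embeddings. cmod (\<sigma> (x :: 'a))) \<ge> 1"
proof -
  obtain \<theta> :: 'a where \<theta>: "primitive \<theta>" "algebraic_int \<theta>" using primitive_algebraic_int_exists by blast
  obtain M where M: "zlattice M" "(*) x ` M \<subseteq> M"
    using stable_lattice_exists[OF \<theta> assms(1)] by blast
  have "idx M ((*) x ` M) > 0"
    using idx_pos finite_quot_lattice[OF _ zlattice_scale[OF M(1) assms(2)]] zlattice_zsub[OF M(1)] M(1)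
    unfolding zlattice_def by blast
  then show ?thesis using idx_scale_eq_prod_embeddings[OF M(1) assms(2) M(2)] by simp
qed

text \<open>Every coset of \<open>\<int>[\<theta>]\<close> in the ring of integers has a representative with coordinates in
  \<open>[0, 1)\<close>. Two such representatives that are close differ by an algebraic integer of norm less
  than \<open>1\<close>, so they agree; hence there are finitely many cosets.\<close>

theorem zlattice_algebraic_ints: "zlattice {x :: 'a. algebraic_int x}"
proof -
  let ?O = "{x :: 'a. algebraic_int x}" and ?E = "complex_embeddings :: ('a \<Rightarrow> complex) set"
  obtain \<theta> :: 'a where \<theta>: "primitive \<theta>" "algebraic_int \<theta>" using primitive_algebraic_int_exists by blast
  define n where "n = dimension"
  have n: "n > 0"
    using \<theta>(1) int_minpoly_degree_pos unfolding primitive_def n_def by metis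
  define P where "P = power_lattice \<theta>"
  have lP: "zlattice P" using zlattice_power_lattice[OF \<theta>(1)] by (simp add: P_def)
  have zP: "zsub P" using lP by (rule zlattice_zsub)
  have zO: "zsub ?O" by (rule zsubI) auto
  have PO: "P \<subseteq> ?O"
    unfolding P_def power_lattice_eq_span by (rule Z.span_minimal[OF _ zO]) (use \<theta>(2) in auto)
  \<comment> \<open>\<open>B\<close> bounds every conjugate of a combination of the powers below
    \<open>n\<close> with coefficients of absolute value at most 1. As \<open>N > 2 * B\<close>,
    coefficients of size at most \<open>1 / N\<close> give conjugates of size at most 1 / 2.\<close>
  define B where "B = (\<Sum>\<sigma>\<in>?E. \<Sum>i<n. cmod (\<sigma> \<theta>) ^ i)"
  obtain N :: nat where N: "real N > 2 * B" using reals_Archimedean2 by blast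
  have "B \<ge> 0" by (simp add: B_def sum_nonneg)
  then have N0: "N > 0" using N by (cases N) auto
  define rep where "rep U x r \<longleftrightarrow> algebraic_int x \<and> U = (+) x ` P \<and> x = (\<Sum>i<n. of_rat (r i) * \<theta> ^ i) \<and>
    (\<forall>i<n. 0 \<le> r i \<and> r i < 1)" for U x and r :: "nat \<Rightarrow> rat"
  have "\<exists>x r. rep U x r" if U: "U \<in> quot ?O P" for U
  proof -
    obtain y where y: "algebraic_int y" "U = (+) y ` P" using U by (auto simp: quot_def)
    obtain r where r: "y = (\<Sum>i<n. of_rat (r i) * \<theta> ^ i)" using primitive_rat_comb[OF \<theta>(1)] unfolding n_def by blast
    define z where "z = (\<Sum>i<n. of_int \<lfloor>r i\<rfloor> * \<theta> ^ i)"
    have "z \<in> P" unfolding z_def P_def power_lattice_eq_span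
      by (intro Z.span_sum Z.span_scale Z.span_base) (auto simp: n_def)
    then have "algebraic_int (y - z)" "U = (+) (y - z) ` P"
      using y PO coset_eq_iff[OF zP, of y "y - z"] by auto
    moreover have "y - z = (\<Sum>i<n. of_rat (frac (r i)) * \<theta> ^ i)"
      by (simp add: r z_def frac_def of_rat_diff left_diff_distrib sum_subtractf)
    moreover have "\<forall>i<n. 0 \<le> frac (r i) \<and> frac (r i) < 1" by (simp add: frac_lt_1)
    ultimately have "rep U (y - z) (\<lambda>i. frac (r i))" unfolding rep_def by blast
    then show ?thesis by blast
  qed
  then obtain x r where rep: "\<And>U. U \<in> quot ?O P \<Longrightarrow> rep U (x U) (r U)" by metis
  \<comment> \<open>\<open>code\<close> names the cell of side \<open>1 / N\<close> of the unit cube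
    that contains the coordinates.\<close>
  define code where "code U = restrict (\<lambda>i. \<lfloor>of_nat N * r U i\<rfloor>) {..<n}" for U
  have "inj_on code (quot ?O P)"
  proof (rule inj_onI)
    fix U V assume U: "U \<in> quot ?O P" and V: "V \<in> quot ?O P" and eq: "code U = code V"
    define s where "s i = r U i - r V i" for i
    have s: "real_of_rat \<bar>s i\<bar> \<le> 1 / N" if "i < n" for i
    proof -
      have "\<lfloor>of_nat N * r U i\<rfloor> = \<lfloor>of_nat N * r V i\<rfloor>"
        using fun_cong[OF eq, of i] that by (simp add: code_def)
      then have "\<bar>of_nat N * r U i - of_nat N * r V i\<bar> < 1" by linarith
      then have "of_nat N * \<bar>s i\<bar> < 1" by (simp add: s_def abs_mult flip: right_diff_distrib)
      then have "\<bar>s i\<bar> \<le> 1 / of_nat N" using N0 by (simp add: field_simps)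
      then have "real_of_rat \<bar>s i\<bar> \<le> real_of_rat (1 / of_nat N)" by (simp only: of_rat_less_eq)
      then show ?thesis by (simp add: of_rat_divide)
    qed
    have d: "x U - x V = (\<Sum>i<n. of_rat (s i) * \<theta> ^ i)"
      using rep[OF U] rep[OF V] unfolding rep_def s_def
      by (simp add: of_rat_diff left_diff_distrib sum_subtractf)
    have small: "cmod (\<sigma> (x U - x V)) \<le> 1 / 2" if \<sigma>: "\<sigma> \<in> ?E" for \<sigma>
    proof -
      have "\<sigma> (x U - x V) = (\<Sum>i<n. of_rat (s i) * \<sigma> \<theta> ^ i)"
        unfolding d using \<sigma> by (simp add: embedding_sum embedding_mult embedding_of_rat embedding_power)
      also have "cmod \<dots> \<le> (\<Sum>i<n. cmod (of_rat (s i) * \<sigma> \<theta> ^ i))" by (rule norm_sum)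
      also have "\<dots> \<le> (\<Sum>i<n. 1 / N * cmod (\<sigma> \<theta>) ^ i)"
      proof (rule sum_mono)
        fix i assume "i \<in> {..<n}"
        moreover have "cmod (of_rat (s i)) = real_of_rat \<bar>s i\<bar>"
          by (cases "s i") (simp add: of_rat_rat norm_divide)
        ultimately show "cmod (of_rat (s i) * \<sigma> \<theta> ^ i) \<le> 1 / N * cmod (\<sigma> \<theta>) ^ i"
          using s by (simp only: norm_mult norm_power) (intro mult_right_mono, auto)
      qed
      also have "\<dots> = 1 / N * (\<Sum>i<n. cmod (\<sigma> \<theta>) ^ i)" by (simp add: sum_distrib_left)
      also have "\<dots> \<le> 1 / N * B"
        unfolding B_def using \<sigma> finite_complex_embeddings
        by (intro mult_left_mono member_le_sum) (auto intro: sum_nonneg)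
      also have "\<dots> \<le> 1 / 2" using N N0 by (simp add: field_simps)
      finally show ?thesis .
    qed
    have "(\<Prod>\<sigma>\<in>?E. cmod (\<sigma> (x U - x V))) \<le> (\<Prod>\<sigma>\<in>?E. 1 / 2)"
      by (rule prod_mono) (use small in auto)
    also have "\<dots> = (1 / 2) ^ n" by (simp add: card_complex_embeddings n_def)
    also have "\<dots> < 1" using n by (simp add: power_less_one_iff)
    finally have lt: "(\<Prod>\<sigma>\<in>?E. cmod (\<sigma> (x U - x V))) < 1" .
    have "algebraic_int (x U - x V)" using rep[OF U] rep[OF V] unfolding rep_def by blast
    then have "x U - x V = 0" using prod_embeddings_ge_1 lt by (meson not_le)
    then have "x U = x V" by simp
    then show "U = V" using rep[OF U] rep[OF V] unfolding rep_def by metis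
  qed
  moreover have "code ` quot ?O P \<subseteq> PiE {..<n} (\<lambda>_. {0..int N})"
  proof (rule image_subsetI)
    fix U assume "U \<in> quot ?O P"
    then have r: "0 \<le> r U i" "r U i < 1" if "i < n" for i using rep that unfolding rep_def by blast+
    have "0 \<le> \<lfloor>of_nat N * r U i\<rfloor>" "\<lfloor>of_nat N * r U i\<rfloor> \<le> int N" if "i < n" for i
    proof -
      show "0 \<le> \<lfloor>of_nat N * r U i\<rfloor>" using r(1)[OF that] by simp
      have "of_nat N * r U i \<le> of_nat N * 1" using r(2)[OF that] by (intro mult_left_mono) auto
      then show "\<lfloor>of_nat N * r U i\<rfloor> \<le> int N" by (simp add: floor_le_iff)
    qed
    then show "code U \<in> PiE {..<n} (\<lambda>_. {0..int N})" by (auto simp: code_def)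
  qed
  moreover have "finite (PiE {..<n} (\<lambda>_. {0..int N}))" by (intro finite_PiE) auto
  ultimately have "finite (quot ?O P)" using finite_imageD finite_subset by metis
  then have "zfg ?O" using zfg_finite_quot[of P ?O] lP zO PO by (auto simp: zlattice_def)
  moreover have "\<exists>m>0. of_int m * y \<in> ?O" for y using multiple_algebraic_int by simp
  ultimately show ?thesis by (simp add: zlattice_def)
qed

end

section \<open>Factorization of ideals\<close>

abbreviation algints :: "'a::field_char_0 set" where
  "algints \<equiv> {x. algebraic_int x}"

text \<open>Ideals are plain sets of field elements here, so that the index calculus applies to them
  directly; agreement with the ring-theoretic notion is \<open>ideal_iff\<close>.\<close>

definition is_ideal :: "'a::field_char_0 set \<Rightarrow> bool" where
  "is_ideal I \<longleftrightarrow> zsub I \<and> I \<subseteq> algints \<and> (\<forall>x y. algebraic_int x \<longrightarrow> y \<in> I \<longrightarrow> x * y \<in> I)"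

definition iprod :: "'a::field_char_0 set \<Rightarrow> 'a set \<Rightarrow> 'a set" where
  "iprod I J = zspan {x * y |x y. x \<in> I \<and> y \<in> J}"

primrec ipow :: "'a::field_char_0 set \<Rightarrow> nat \<Rightarrow> 'a set" where
  "ipow P 0 = algints"
| "ipow P (Suc m) = iprod (ipow P m) P"

definition is_prime :: "'a::field_char_0 set \<Rightarrow> bool" where
  "is_prime P \<longleftrightarrow> is_ideal P \<and> 1 \<notin> P \<and> P \<noteq> {0} \<and>
     (\<forall>x y. algebraic_int x \<longrightarrow> algebraic_int y \<longrightarrow> x * y \<in> P \<longrightarrow> x \<in> P \<or> y \<in> P)"

lemma zsub_algints: "zsub (algints :: 'a::field_char_0 set)"
  by (rule zsubI) auto

lemma is_idealD:
  assumes "is_ideal I"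
  shows ideal_zsub: "zsub I" and ideal_int: "x \<in> I \<Longrightarrow> algebraic_int x"
    and ideal_mult: "algebraic_int x \<Longrightarrow> y \<in> I \<Longrightarrow> x * y \<in> I"
    and ideal_mult': "algebraic_int x \<Longrightarrow> y \<in> I \<Longrightarrow> y * x \<in> I"
    and ideal_0: "0 \<in> I"
    and ideal_add: "y \<in> I \<Longrightarrow> z \<in> I \<Longrightarrow> y + z \<in> I"
  using assms Z.subspace_0 Z.subspace_add
  by (auto simp: is_ideal_def mult.commute)

lemma is_idealI:
  assumes "0 \<in> I" "\<And>x y. x \<in> I \<Longrightarrow> y \<in> I \<Longrightarrow> x + y \<in> I" "\<And>x. x \<in> I \<Longrightarrow> algebraic_int x"
    "\<And>x y. algebraic_int x \<Longrightarrow> y \<in> I \<Longrightarrow> x * y \<in> I"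
  shows "is_ideal I"
proof -
  have "zsub I" using assms(4)[of "- 1"] by (intro zsubI assms(1,2)) auto
  then show ?thesis using assms by (auto simp: is_ideal_def)
qed

lemma is_ideal_algints: "is_ideal (algints :: 'a::field_char_0 set)"
  by (rule is_idealI) auto

lemma ideal_eq_algints: "is_ideal I \<Longrightarrow> 1 \<in> I \<Longrightarrow> I = algints"
  using ideal_int ideal_mult[of I _ 1] by force

lemma is_ideal_scale:
  assumes I: "is_ideal I" and g: "(*) g ` I \<subseteq> algints"
  shows "is_ideal ((*) g ` I)"
proof (rule is_idealI)
  show "0 \<in> (*) g ` I" using ideal_0[OF I] by (rule rev_image_eqI) simp
  fix x y assume "x \<in> (*) g ` I" "y \<in> (*) g ` I"
  then show "x + y \<in> (*) g ` I" using ideal_add[OF I] by (auto simp flip: distrib_left)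
next
  fix x y :: 'a assume "algebraic_int x" "y \<in> (*) g ` I"
  then show "x * y \<in> (*) g ` I" using ideal_mult[OF I] by (auto simp: mult.left_commute[of x g])
qed (use g in auto)

lemma is_ideal_principal: "algebraic_int a \<Longrightarrow> is_ideal ((*) a ` algints)"
  by (rule is_ideal_scale[OF is_ideal_algints]) auto

definition isum :: "'a::field_char_0 set \<Rightarrow> 'a set \<Rightarrow> 'a set" where
  "isum I J = {x + y |x y. x \<in> I \<and> y \<in> J}"

lemma isum_add: "x \<in> I \<Longrightarrow> y \<in> J \<Longrightarrow> x + y \<in> isum I J"
  by (auto simp: isum_def)

lemma is_ideal_isum:
  assumes I: "is_ideal I" and J: "is_ideal J"
  shows "is_ideal (isum I J)" and "I \<subseteq> isum I J" and "J \<subseteq> isum I J"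
proof -
  show "I \<subseteq> isum I J" "J \<subseteq> isum I J"
    using isum_add[OF _ ideal_0[OF J]] isum_add[OF ideal_0[OF I]] by force+
  show "is_ideal (isum I J)"
  proof (rule is_idealI)
    show "0 \<in> isum I J" using isum_add[OF ideal_0[OF I] ideal_0[OF J]] by simp
  next
    fix x y assume "x \<in> isum I J" "y \<in> isum I J"
    then obtain a b c d where *: "a \<in> I" "b \<in> J" "c \<in> I" "d \<in> J" "x = a + b" "y = c + d"
      by (auto simp: isum_def)
    have "x + y = (a + c) + (b + d)" by (simp add: *)
    then show "x + y \<in> isum I J" using * ideal_add[OF I] ideal_add[OF J] isum_add by metis
  next
    fix x y :: 'a assume x: "algebraic_int x" and "y \<in> isum I J"
    then obtain a b where "a \<in> I" "b \<in> J" "y = a + b" by (auto simp: isum_def)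
    then show "x * y \<in> isum I J"
      using isum_add[OF ideal_mult[OF I x] ideal_mult[OF J x]] by (simp add: distrib_left)
  qed (use ideal_int[OF I] ideal_int[OF J] in \<open>auto simp: isum_def\<close>)
qed

lemma one_mem_ideal:
  assumes I: "is_ideal I" and x: "x \<in> I" "1 - x ^ k \<in> I" and k: "k > 0"
  shows "1 \<in> I"
proof -
  have "x * x ^ (k - 1) \<in> I" using ideal_mult'[OF I _ x(1)] ideal_int[OF I x(1)] by blast
  then have "x ^ k \<in> I" using k by (simp add: power_eq_if)
  from ideal_add[OF I x(2) this] show ?thesis by simp
qed

lemma principal_subset_iff:
  assumes "is_ideal I" shows "(*) a ` algints \<subseteq> I \<longleftrightarrow> a \<in> I"
proof
  assume "(*) a ` algints \<subseteq> I"
  moreover have "a * 1 \<in> (*) a ` algints" by (intro imageI) simp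
  ultimately show "a \<in> I" by auto
qed (use ideal_mult'[OF assms] in auto)

lemma iprod_mult: "x \<in> I \<Longrightarrow> y \<in> J \<Longrightarrow> x * y \<in> iprod I J"
  unfolding iprod_def by (rule Z.span_base) auto

lemma iprod_subset:
  assumes "zsub K" "\<And>x y. x \<in> I \<Longrightarrow> y \<in> J \<Longrightarrow> x * y \<in> K"
  shows "iprod I J \<subseteq> K"
  unfolding iprod_def by (rule Z.span_minimal) (use assms in auto)

lemma zsub_scale_preimage: "zsub K \<Longrightarrow> zsub {x. c * x \<in> K}"
  by (rule zsubI) (auto simp: ring_distribs Z.subspace_0 intro: Z.subspace_add Z.subspace_neg)

lemma is_ideal_iprod:
  assumes "is_ideal I" "is_ideal J"
  shows "is_ideal (iprod I J)" and "iprod I J \<subseteq> I" and "iprod I J \<subseteq> J"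
proof -
  show 1: "iprod I J \<subseteq> I" and 2: "iprod I J \<subseteq> J"
    using assms by (intro iprod_subset ideal_zsub; blast intro: ideal_mult ideal_mult' ideal_int)+
  have z: "zsub (iprod I J)" unfolding iprod_def by simp
  show "is_ideal (iprod I J)"
    unfolding is_ideal_def
  proof (intro conjI allI impI z)
    show "iprod I J \<subseteq> algints" using 1 assms ideal_int by blast
    fix x y :: 'a assume x: "algebraic_int x" and "y \<in> iprod I J"
    have "iprod I J \<subseteq> {y. x * y \<in> iprod I J}"
      by (intro iprod_subset zsub_scale_preimage z)
         (use ideal_mult[OF assms(1) x] in \<open>auto simp: mult.assoc[symmetric] intro: iprod_mult\<close>)
    then show "x * y \<in> iprod I J" using \<open>y \<in> iprod I J\<close> by blast
  qed
qed

lemma iprod_mono: "I \<subseteq> I' \<Longrightarrow> J \<subseteq> J' \<Longrightarrow> iprod I J \<subseteq> iprod I' J'"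
  unfolding iprod_def by (rule Z.span_mono) auto

lemma iprod_swap:
  assumes "is_ideal I" "is_ideal J" "is_ideal K"
  shows "iprod (iprod I J) K \<subseteq> iprod (iprod I K) J"
proof (rule iprod_subset)
  show z: "zsub (iprod (iprod I K) J)" unfolding iprod_def by simp
  fix x y assume x: "x \<in> iprod I J" and y: "y \<in> K"
  have "iprod I J \<subseteq> {x. y * x \<in> iprod (iprod I K) J}"
  proof (intro iprod_subset zsub_scale_preimage z CollectI)
    fix i j assume "i \<in> I" "j \<in> J"
    then have "i * y * j \<in> iprod (iprod I K) J" using y by (intro iprod_mult)
    then show "y * (i * j) \<in> iprod (iprod I K) J" by (simp add: mult_ac)
  qed
  then show "x * y \<in> iprod (iprod I K) J" using x by (auto simp: mult.commute)
qed

lemma iprod_algints: "is_ideal I \<Longrightarrow> iprod algints I = I"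
  using is_ideal_iprod(3)[OF is_ideal_algints] iprod_mult[of 1 algints _ I] by force

lemma is_prime_ideal: "is_prime P \<Longrightarrow> is_ideal P"
  by (simp add: is_prime_def)

lemma is_ideal_ipow: "is_ideal P \<Longrightarrow> is_ideal (ipow P m)"
  by (induction m) (auto simp: is_ideal_algints is_ideal_iprod)

lemma ipow_Suc_subset: "is_ideal P \<Longrightarrow> ipow P (Suc m) \<subseteq> ipow P m"
  using is_ideal_iprod(2)[OF is_ideal_ipow] by auto

lemma ipow_antimono: "is_ideal P \<Longrightarrow> m \<le> n \<Longrightarrow> ipow P n \<subseteq> ipow P m"
  by (rule lift_Suc_antimono_le[of "ipow P"]) (use ipow_Suc_subset in auto)

lemma ipow_1: "is_ideal P \<Longrightarrow> ipow P 1 = P"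
  by (simp add: iprod_algints)

lemma iprod_nonzero:
  assumes "is_ideal I" "is_ideal J" "I \<noteq> {0}" "J \<noteq> {0}"
  shows "iprod I J \<noteq> {0}"
proof -
  obtain x y where "x \<in> I" "x \<noteq> 0" "y \<in> J" "y \<noteq> 0" using assms ideal_0 by blast
  then have "x * y \<in> iprod I J" "x * y \<noteq> 0" using iprod_mult by auto
  then show ?thesis by blast
qed

text \<open>First isomorphism theorem for coset counts: on differences \<open>f\<close> pulls
  \<open>B'\<close> back to \<open>B\<close>, and it reaches all of \<open>A'\<close> modulo
  \<open>B'\<close>.\<close>

lemma idx_iso:
  assumes z: "zsub B" "zsub B'" and f: "\<And>x y. f (x - y) = f x - f y"
    and into: "\<And>x. x \<in> A \<Longrightarrow> f x \<in> A'" and ker: "\<And>x y. x \<in> A \<Longrightarrow> y \<in> A \<Longrightarrow> f (x - y) \<in> B' \<longleftrightarrow> x - y \<in> B"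
    and surj: "\<And>y. y \<in> A' \<Longrightarrow> \<exists>x\<in>A. y - f x \<in> B'"
  shows "idx A B = idx A' B'"
proof -
  define r where "r U = (SOME x. x \<in> A \<and> U = (+) x ` B)" for U
  have r: "r U \<in> A" "U = (+) (r U) ` B" if "U \<in> quot A B" for U
  proof -
    have "\<exists>x. x \<in> A \<and> U = (+) x ` B" using that by (auto simp: quot_def)
    from someI_ex[OF this] show "r U \<in> A" "U = (+) (r U) ` B" by (auto simp: r_def)
  qed
  have "bij_betw (\<lambda>U. (+) (f (r U)) ` B') (quot A B) (quot A' B')"
  proof (rule bij_betwI')
    fix U V assume U: "U \<in> quot A B" and V: "V \<in> quot A B"
    have "(+) (f (r U)) ` B' = (+) (f (r V)) ` B' \<longleftrightarrow> f (r U - r V) \<in> B'"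
      by (simp only: coset_eq_iff[OF z(2)] f)
    also have "\<dots> \<longleftrightarrow> (+) (r U) ` B = (+) (r V) ` B"
      using ker r(1) U V coset_eq_iff[OF z(1)] by blast
    also have "\<dots> \<longleftrightarrow> U = V" using r(2) U V by metis
    finally show "(+) (f (r U)) ` B' = (+) (f (r V)) ` B' \<longleftrightarrow> U = V" .
  next
    fix U assume "U \<in> quot A B"
    then show "(+) (f (r U)) ` B' \<in> quot A' B'" using r(1) into by (auto simp: quot_def)
  next
    fix W assume "W \<in> quot A' B'"
    then obtain y where y: "y \<in> A'" "W = (+) y ` B'" by (auto simp: quot_def)
    obtain x where x: "x \<in> A" "y - f x \<in> B'" using surj[OF y(1)] by blast
    define U where "U = (+) x ` B"
    have U: "U \<in> quot A B" using x by (auto simp: U_def quot_def)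
    have "x - r U \<in> B" using r(2)[OF U] U_def coset_eq_iff[OF z(1)] by metis
    then have "f x - f (r U) \<in> B'" using ker[OF x(1) r(1)[OF U]] f by simp
    from Z.subspace_add[OF z(2) x(2) this] have "y - f (r U) \<in> B'" by simp
    then have "W = (+) (f (r U)) ` B'" using y(2) coset_eq_iff[OF z(2)] by blast
    then show "\<exists>U\<in>quot A B. W = (+) (f (r U)) ` B'" using U by blast
  qed
  then show ?thesis unfolding idx_def by (rule bij_betw_same_card)
qed

text \<open>Two powers of \<open>x\<close> agree in a finite quotient. The factor
  \<open>1 - x ^ k\<close> obtained in this way substitutes for inverting \<open>x\<close> modulo an
  ideal.\<close>

lemma power_collision:
  assumes "finite (quot algints I)" "zsub I" "algebraic_int x"
  shows "\<exists>i k. k > 0 \<and> x ^ i * (1 - x ^ k) \<in> I"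
proof -
  have "(\<lambda>i. (+) (x ^ i) ` I) ` UNIV \<subseteq> quot algints I"
    using assms(3) by (auto simp: quot_def)
  then have "\<not> inj (\<lambda>i. (+) (x ^ i) ` I)"
    using assms(1) finite_subset finite_imageD infinite_UNIV_nat by blast
  then obtain i j where ij: "i < j" "(+) (x ^ i) ` I = (+) (x ^ j) ` I"
    unfolding inj_def by (metis linorder_neqE_nat)
  then have "x ^ i - x ^ j \<in> I" using coset_eq_iff[OF assms(2)] by blast
  also have "x ^ j = x ^ i * x ^ (j - i)" using ij(1) by (simp flip: power_add)
  finally have "x ^ i * (1 - x ^ (j - i)) \<in> I" by (simp add: right_diff_distrib)
  then show ?thesis using ij(1) by (intro exI[of _ i] exI[of _ "j - i"]) simp
qed

lemma prime_power_mem: "is_prime P \<Longrightarrow> algebraic_int x \<Longrightarrow> x ^ n \<in> P \<Longrightarrow> x \<in> P"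
proof (induction n)
  case (Suc n)
  then have "x \<in> P \<or> x ^ n \<in> P" unfolding is_prime_def by (metis algebraic_int_power' power_Suc)
  then show ?case using Suc by blast
qed (simp add: is_prime_def)

context number_field_basis
begin

section \<open>Finite index of nonzero ideals and invertibility of primes\<close>

lemma ideal_lattice:
  assumes I: "is_ideal (I :: 'a set)" "I \<noteq> {0}"
  shows "zlattice I"
proof -
  obtain a where a: "a \<in> I" "a \<noteq> 0" using I ideal_0 by blast
  define A where "A = (*) a ` (algints :: 'a set)"
  have A: "zlattice A" unfolding A_def by (rule zlattice_scale[OF zlattice_algebraic_ints a(2)])
  have AI: "A \<subseteq> I" using principal_subset_iff[OF I(1)] a by (simp add: A_def)
  have "finite (quot algints A)" using finite_quot_lattice[OF _ A] zlattice_algebraic_ints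
    unfolding zlattice_def by blast
  then have "finite (quot I A)"
    using finite_quot_mono[of algints A I A] zlattice_zsub[OF A] I(1) ideal_int by blast
  then have "zfg I" using zfg_finite_quot[of A I] A AI ideal_zsub[OF I(1)] unfolding zlattice_def by blast
  then show ?thesis using A AI unfolding zlattice_def by blast
qed

lemma finite_quot_ideal:
  assumes I: "is_ideal (I :: 'a set)" "I \<noteq> {0}"
  shows "finite (quot algints I)"
  using finite_quot_lattice[OF _ ideal_lattice[OF I]] zlattice_algebraic_ints unfolding zlattice_def by blast

text \<open>This makes the index a termination measure, in place of an ascending chain
  condition.\<close>

lemma ideal_idx_less:
  assumes I: "is_ideal (I :: 'a set)" "I \<noteq> {0}" and J: "is_ideal J" "I \<subseteq> J" "I \<noteq> J"
  shows "idx algints J < idx algints I"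
  using idx_mono(2)[OF finite_quot_ideal[OF I] J(2) _ zsub_algints ideal_zsub[OF I(1)] ideal_zsub[OF J(1)] J(3)]
    ideal_int[OF J(1)] by blast

text \<open>An element \<open>x\<close> of \<open>A\<close> outside \<open>P\<close> is invertible
  modulo \<open>P\<close>: primality reduces the collision of powers to \<open>1 - x ^ k\<close> in
  \<open>P\<close>, so \<open>A\<close> contains 1.\<close>

lemma prime_maximal:
  assumes P: "is_prime (P :: 'a set)" and A: "is_ideal A" "P \<subseteq> A" "P \<noteq> A"
  shows "A = algints"
proof -
  obtain x where x: "x \<in> A" "x \<notin> P" using A by blast
  have xi: "algebraic_int x" using x A ideal_int by blast
  have PI: "is_ideal P" "P \<noteq> {0}" using P by (auto simp: is_prime_def)
  obtain i k where ik: "k > 0" "x ^ i * (1 - x ^ k) \<in> P"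
    using power_collision[OF finite_quot_ideal[OF PI] ideal_zsub[OF PI(1)] xi] by blast
  have "algebraic_int (1 - x ^ k)" using xi by blast
  then have "x ^ i \<in> P \<or> 1 - x ^ k \<in> P" using P ik xi unfolding is_prime_def by blast
  then have "1 - x ^ k \<in> P" using prime_power_mem[OF P xi] x by blast
  then have "1 - x ^ k \<in> A" using A by blast
  then have "1 \<in> A" by (rule one_mem_ideal[OF A(1) x(1) _ ik(1)])
  then show ?thesis using ideal_eq_algints[OF A(1)] by simp
qed

text \<open>Some ideal \<open>(a : b)\<close> contained in the prime \<open>P\<close> has minimal index; by minimality every element of \<open>P\<close>
  is multiplied into it by some element outside of \<open>P\<close>.\<close>

lemma prime_fractional_multiplier:
  assumes P: "is_prime (P :: 'a set)"
  shows "\<exists>g. \<not> algebraic_int g \<and> (*) g ` P \<subseteq> algints"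
proof -
  have PI: "is_ideal P" "P \<noteq> {0}" using P by (auto simp: is_prime_def)
  obtain a where a: "a \<in> P" "a \<noteq> 0" using PI ideal_0 by blast
  have ai: "algebraic_int a" using a PI ideal_int by blast
  define N where "N b = {y. algebraic_int y \<and> y * b \<in> (*) a ` algints}" for b
  have aI: "is_ideal ((*) a ` algints)" using is_ideal_principal[OF ai] .
  have NI: "is_ideal (N b)" if "algebraic_int b" for b
    by (rule is_idealI) (auto simp: N_def ideal_0[OF aI] distrib_right mult.assoc
      intro: ideal_add[OF aI] ideal_mult[OF aI])
  have N0: "N b \<noteq> {0}" if "algebraic_int b" for b
  proof -
    have "a \<in> N b" using ai that by (auto simp: N_def)
    then show ?thesis using a by blast
  qed
  define Q where "Q b \<longleftrightarrow> algebraic_int b \<and> N b \<subseteq> P" for b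
  have "N 1 \<subseteq> P"
  proof
    fix y assume "y \<in> N 1"
    then obtain x where "algebraic_int x" "y = a * x" by (auto simp: N_def)
    then show "y \<in> P" using ideal_mult'[OF PI(1) _ a(1)] by blast
  qed
  then have "Q 1" by (auto simp: Q_def)
  then obtain b where b: "Q b" and min: "\<And>c. Q c \<Longrightarrow> idx algints (N b) \<le> idx algints (N c)"
    using ex_has_least_nat[of Q 1 "\<lambda>b. idx algints (N b)"] by blast
  have bi: "algebraic_int b" and bP: "N b \<subseteq> P" using b by (auto simp: Q_def)
  \<comment> \<open>Without such a multiplier for \<open>x\<close>, replacing \<open>b\<close> by
    \<open>x * b\<close> keeps the ideal inside \<open>P\<close>, and minimality makes both ideals
    equal. Then \<open>x\<close> can be cancelled modulo \<open>N b\<close>, and a collision of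
    powers puts \<open>1 - x ^ k\<close>, hence 1, into \<open>P\<close>.\<close>
  have ex: "\<exists>s. algebraic_int s \<and> s \<notin> P \<and> s * x \<in> N b" if x: "x \<in> P" for x
  proof (rule ccontr)
    assume none: "\<not> ?thesis"
    have xi: "algebraic_int x" using x PI ideal_int by blast
    have xbi: "algebraic_int (x * b)" using xi bi by blast
    have mem: "s \<in> N (x * b) \<longleftrightarrow> s * x \<in> N b" if "algebraic_int s" for s
      using that xi by (auto simp: N_def mult.assoc)
    have "N (x * b) \<subseteq> P"
    proof
      fix s assume s: "s \<in> N (x * b)"
      then have "algebraic_int s" by (simp add: N_def)
      then show "s \<in> P" using none mem s by blast
    qed
    then have "Q (x * b)" using xbi by (simp add: Q_def)
    then have "idx algints (N b) \<le> idx algints (N (x * b))" by (rule min)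
    moreover have sub: "N b \<subseteq> N (x * b)"
    proof
      fix s assume s: "s \<in> N b"
      then have "algebraic_int s" by (simp add: N_def)
      then show "s \<in> N (x * b)" using mem ideal_mult'[OF NI[OF bi] xi s] by blast
    qed
    ultimately have eq: "N (x * b) = N b"
      using ideal_idx_less[OF NI[OF bi] N0[OF bi] NI[OF xbi] sub] by force
    have cancel: "s \<in> N b" if "algebraic_int s" "s * x \<in> N b" for s
      using mem[OF that(1)] that(2) eq by simp
    have cancel_pow: "s \<in> N b" if "algebraic_int s" "s * x ^ i \<in> N b" for s i
      using that
    proof (induction i)
      case (Suc i)
      have "s * x ^ i * x \<in> N b" using Suc.prems(2) by (simp add: mult_ac)
      then show ?case using Suc cancel[of "s * x ^ i"] xi by blast
    qed simp
    obtain i k where ik: "k > 0" "x ^ i * (1 - x ^ k) \<in> N b"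
      using power_collision[OF finite_quot_ideal[OF NI[OF bi] N0[OF bi]] ideal_zsub[OF NI[OF bi]] xi] by blast
    then have "1 - x ^ k \<in> N b" using cancel_pow[of "1 - x ^ k" i] xi by (metis algebraic_int_1 algebraic_int_diff algebraic_int_power' mult.commute)
    then have "1 - x ^ k \<in> P" using bP by blast
    then have "1 \<in> P" by (rule one_mem_ideal[OF PI(1) x _ ik(1)])
    then show False using P by (simp add: is_prime_def)
  qed
  obtain S where S: "finite S" "P = zspan S" using ideal_lattice[OF PI] by (auto simp: zlattice_def zfg_def)
  \<comment> \<open>One multiplier serves finitely many elements: the product of the individual ones
    avoids \<open>P\<close> by primality.\<close>
  have "\<exists>s. algebraic_int s \<and> s \<notin> P \<and> (\<forall>x\<in>T. s * x \<in> N b)" if "finite T" "T \<subseteq> P" for T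
    using that
  proof (induction T)
    case empty
    have "algebraic_int (1 :: 'a)" "1 \<notin> P" using P by (auto simp: is_prime_def)
    then show ?case by blast
  next
    case (insert x T)
    then obtain s where s: "algebraic_int s" "s \<notin> P" "\<forall>x\<in>T. s * x \<in> N b" by blast
    obtain s' where s': "algebraic_int s'" "s' \<notin> P" "s' * x \<in> N b" using ex insert.prems by blast
    have "s * s' \<notin> P" using P s s' unfolding is_prime_def by blast
    moreover have "s * s' * y \<in> N b" if "y \<in> insert x T" for y
    proof (cases "y = x")
      case True
      then show ?thesis using ideal_mult[OF NI[OF bi] s(1) s'(3)] by (simp add: mult.assoc)
    next
      case False
      then have "s * y \<in> N b" using s that by blast
      then show ?thesis using ideal_mult[OF NI[OF bi] s'(1)] by (simp add: mult.assoc mult.left_commute)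
    qed
    ultimately show ?case using s s' by blast
  qed
  then obtain s where s: "algebraic_int s" "s \<notin> P" "\<forall>x\<in>S. s * x \<in> N b"
    using S Z.span_superset[of S] by blast
  have "P \<subseteq> {x. s * x \<in> N b}"
    unfolding S(2) by (rule Z.span_minimal[OF _ zsub_scale_preimage[OF ideal_zsub[OF NI[OF bi]]]]) (use s in auto)
  then have sP: "s * x * b \<in> (*) a ` algints" if "x \<in> P" for x using that by (auto simp: N_def)
  have "(*) (b * s / a) ` P \<subseteq> algints"
  proof (rule image_subsetI)
    fix x assume "x \<in> P"
    then obtain y where y: "algebraic_int y" "s * x * b = a * y" using sP by blast
    then have "b * s / a * x = y" using a(2) by (simp add: field_simps)
    then show "b * s / a * x \<in> algints" using y by simp
  qed
  \<comment> \<open>If this quotient were integral, \<open>s\<close> would multiply \<open>b\<close>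
    into the ideal of \<open>a\<close>, so \<open>s\<close> would lie in \<open>N b\<close> and
    hence in \<open>P\<close>.\<close>
  moreover have "\<not> algebraic_int (b * s / a)"
  proof
    assume "algebraic_int (b * s / a)"
    then have "a * (b * s / a) \<in> (*) a ` algints" by blast
    then have "s \<in> N b" using s(1) a(2) by (simp add: N_def mult.commute)
    then show False using s bP by blast
  qed
  ultimately show ?thesis by blast
qed

text \<open>Multiplication by such a \<open>g\<close> replaces the inverse ideal of \<open>P\<close>, which is generated by \<open>1\<close> and \<open>g\<close>.\<close>

definition inverter :: "'a set \<Rightarrow> 'a \<Rightarrow> bool" where
  "inverter P g \<longleftrightarrow> (*) g ` P \<subseteq> algints \<and> (\<exists>p\<in>P. \<exists>p'\<in>P. 1 = p + g * p')"

text \<open>\<open>P + g P\<close> is an ideal. It exceeds \<open>P\<close>, since otherwise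
  \<open>g\<close> would stabilize a lattice and be integral; by maximality it is the whole ring,
  and 1 splits accordingly.\<close>

lemma inverter_exists:
  assumes P: "is_prime (P :: 'a set)"
  shows "\<exists>g. inverter P g"
proof -
  have PI: "is_ideal P" "P \<noteq> {0}" using P by (auto simp: is_prime_def)
  obtain g where g: "\<not> algebraic_int g" "(*) g ` P \<subseteq> algints" using prime_fractional_multiplier[OF P] by blast
  define A where "A = isum P ((*) g ` P)"
  have A: "is_ideal A" and PA: "P \<subseteq> A" and gA: "(*) g ` P \<subseteq> A"
    unfolding A_def using is_ideal_isum[OF PI(1) is_ideal_scale[OF PI(1) g(2)]] by blast+
  have "P \<noteq> A"
  proof
    assume "P = A"
    then have "(*) g ` P \<subseteq> P" using gA by simp
    then show False
      using algebraic_int_if_stable ideal_lattice[OF PI] PI(2) g(1) unfolding zlattice_def by blast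
  qed
  then have "A = algints" by (rule prime_maximal[OF P A PA])
  then have "1 \<in> A" by simp
  then show ?thesis using g(2) unfolding inverter_def A_def isum_def by blast
qed

lemma stable_imp_algebraic_int:
  assumes "is_ideal (I :: 'a set)" "I \<noteq> {0}" "(*) g ` I \<subseteq> I"
  shows "algebraic_int g"
  using algebraic_int_if_stable ideal_lattice[OF assms(1,2)] assms unfolding zlattice_def by blast

lemma inverterD:
  assumes "inverter P g"
  shows "\<exists>p p'. p \<in> P \<and> p' \<in> P \<and> (\<forall>x. x = x * p + g * (x * p')) \<and> (\<forall>y\<in>P. algebraic_int (g * y))"
proof -
  obtain p p' where p: "p \<in> P" "p' \<in> P" "1 = p + g * p'" using assms unfolding inverter_def by blast
  have "x = x * p + g * (x * p')" for x
  proof -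
    have "x = x * (p + g * p')" using p(3) by simp
    then show ?thesis by (simp add: algebra_simps)
  qed
  moreover have "\<forall>y\<in>P. algebraic_int (g * y)" using assms unfolding inverter_def by blast
  ultimately show ?thesis using p by blast
qed

lemma inverter_not_int:
  assumes "is_prime P" "inverter P g"
  shows "\<not> algebraic_int g"
proof
  assume g: "algebraic_int g"
  have I: "is_ideal P" using assms by (simp add: is_prime_def)
  obtain p p' where p: "p \<in> P" "p' \<in> P" "1 = p + g * p'" using assms unfolding inverter_def by blast
  then have "1 \<in> P" using ideal_add[OF I p(1) ideal_mult[OF I g p(2)]] by simp
  then show False using assms by (simp add: is_prime_def)
qed

text \<open>For \<open>I\<close> inside \<open>P\<close> and an inverter \<open>g\<close> of
  \<open>P\<close>, this is \<open>I\<close> times the inverse of \<open>P\<close>.\<close>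

definition div_ideal :: "'a \<Rightarrow> 'a set \<Rightarrow> 'a set" where
  "div_ideal g I = isum I ((*) g ` I)"

text \<open>The splitting \<open>x = x p + (g x) p'\<close> recovers \<open>I\<close> from the
  product with \<open>P\<close>. The quotient is strictly larger because equality would make
  \<open>g\<close> integral.\<close>

lemma div_ideal:
  assumes P: "is_prime P" and g: "inverter P g" and I: "is_ideal I" "I \<subseteq> P"
  shows is_ideal_div_ideal: "is_ideal (div_ideal g I)"
    and iprod_div_ideal: "iprod (div_ideal g I) P = I"
    and div_ideal_superset: "I \<subseteq> div_ideal g I"
    and div_ideal_neq: "I \<noteq> {0} \<Longrightarrow> I \<noteq> div_ideal g I"
proof -
  obtain p p' where p: "p \<in> P" "p' \<in> P" "\<And>x. x = x * p + g * (x * p')"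
    "\<And>y. y \<in> P \<Longrightarrow> algebraic_int (g * y)" using inverterD[OF g] by blast
  have PI: "is_ideal P" using P by (simp add: is_prime_def)
  have "(*) g ` I \<subseteq> algints" using p(4) I(2) by blast
  then have D: "is_ideal (div_ideal g I)" and sup: "I \<subseteq> div_ideal g I" and gD: "(*) g ` I \<subseteq> div_ideal g I"
    unfolding div_ideal_def using is_ideal_isum[OF I(1) is_ideal_scale[OF I(1)]] by blast+
  show "is_ideal (div_ideal g I)" "I \<subseteq> div_ideal g I" by (rule D sup)+
  show "iprod (div_ideal g I) P = I"
  proof
    show "iprod (div_ideal g I) P \<subseteq> I"
    proof (rule iprod_subset[OF ideal_zsub[OF I(1)]])
      fix x y assume "x \<in> div_ideal g I" and y: "y \<in> P"
      then obtain a b where *: "a \<in> I" "b \<in> I" "x = a + g * b" by (auto simp: div_ideal_def isum_def)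
      have "x * y = a * y + b * (g * y)" by (simp add: * algebra_simps)
      also have "\<dots> \<in> I"
        using ideal_mult'[OF I(1) _ *(1)] ideal_mult'[OF I(1) p(4)[OF y] *(2)] ideal_int[OF PI y]
        by (intro ideal_add[OF I(1)]) auto
      finally show "x * y \<in> I" .
    qed
    show "I \<subseteq> iprod (div_ideal g I) P"
    proof
      fix x assume x: "x \<in> I"
      have "g * x \<in> div_ideal g I" using gD x by blast
      then have "(g * x) * p' \<in> iprod (div_ideal g I) P" "x * p \<in> iprod (div_ideal g I) P"
        using p(1,2) sup x by (auto intro!: iprod_mult)
      moreover have "x = x * p + (g * x) * p'" using p(3)[of x] by (simp add: mult.assoc)
      ultimately show "x \<in> iprod (div_ideal g I) P"
        using ideal_add[OF is_ideal_iprod(1)[OF D PI]] by metis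
    qed
  qed
  assume "I \<noteq> {0}"
  show "I \<noteq> div_ideal g I"
  proof
    assume eq: "I = div_ideal g I"
    then have "(*) g ` I \<subseteq> I" using gD by simp
    then have "algebraic_int g" using stable_imp_algebraic_int[OF I(1) \<open>I \<noteq> {0}\<close>] by blast
    then show False using inverter_not_int[OF P g] by simp
  qed
qed

lemma inverter_iprod:
  assumes P: "is_prime P" and g: "inverter P g" and I: "is_ideal I" and y: "y \<in> iprod I P"
  shows "g * y \<in> I"
proof -
  have p: "algebraic_int (g * y)" if "y \<in> P" for y
    using g that unfolding inverter_def by blast
  have "iprod I P \<subseteq> {y. g * y \<in> I}"
  proof (intro iprod_subset zsub_scale_preimage ideal_zsub[OF I] CollectI)
    fix x y assume "x \<in> I" "y \<in> P"
    then have "x * (g * y) \<in> I" using ideal_mult'[OF I p] by blast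
    then show "g * (x * y) \<in> I" by (simp add: mult.left_commute)
  qed
  then show ?thesis using y by blast
qed

text \<open>Equality would make \<open>I\<close> stable under an inverter of \<open>P\<close>, which
  would then be integral; this takes the place of Nakayama's lemma.\<close>

lemma iprod_prime_neq:
  assumes P: "is_prime (P :: 'a set)" and I: "is_ideal I" "I \<noteq> {0}"
  shows "iprod I P \<noteq> I"
proof
  obtain g where g: "inverter P g" using inverter_exists[OF P] by blast
  assume eq: "iprod I P = I"
  have "(*) g ` I \<subseteq> I" using inverter_iprod[OF P g I(1)] eq by blast
  then show False using stable_imp_algebraic_int[OF I] inverter_not_int[OF P g] by blast
qed

text \<open>A proper ideal of least index above \<open>I\<close> is prime: adjoining any further
  integer already yields 1.\<close>

lemma prime_above_exists:
  assumes I: "is_ideal (I :: 'a set)" "I \<noteq> {0}" "I \<noteq> algints"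
  shows "\<exists>Q. is_prime Q \<and> I \<subseteq> Q"
proof -
  define S where "S = (\<lambda>J. is_ideal J \<and> I \<subseteq> J \<and> J \<noteq> algints)"
  obtain Q where Q: "S Q" and min: "\<And>J. S J \<Longrightarrow> idx algints Q \<le> idx algints J"
    using ex_has_least_nat[of S I "idx algints"] I unfolding S_def by blast
  have QI: "is_ideal Q" "I \<subseteq> Q" "Q \<noteq> algints" using Q by (auto simp: S_def)
  have Q0: "Q \<noteq> {0}" using QI I ideal_0 by blast
  have "x \<in> Q \<or> y \<in> Q" if xy: "algebraic_int x" "algebraic_int y" "x * y \<in> Q" for x y
  proof (rule ccontr)
    assume n: "\<not> (x \<in> Q \<or> y \<in> Q)"
    define J where "J = isum Q ((*) x ` algints)"
    have J: "is_ideal J" and QJ: "Q \<subseteq> J" and xJ: "(*) x ` algints \<subseteq> J"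
      unfolding J_def using is_ideal_isum[OF QI(1) is_ideal_principal[OF xy(1)]] by blast+
    have "x \<in> J" using xJ principal_subset_iff[OF J] by simp
    then have "Q \<noteq> J" using n by blast
    then have "idx algints J < idx algints Q" by (rule ideal_idx_less[OF QI(1) Q0 J QJ])
    then have "\<not> S J" using min by force
    then have "1 \<in> J" using J QJ QI(2) unfolding S_def by auto
    then obtain q z where qz: "q \<in> Q" "algebraic_int z" "1 = q + x * z" by (auto simp: J_def isum_def)
    have "y = y * (q + x * z)" using qz(3) by simp
    also have "\<dots> = y * q + z * (x * y)" by (simp add: algebra_simps)
    also have "\<dots> \<in> Q" using ideal_mult[OF QI(1)] xy qz by (intro ideal_add[OF QI(1)]) auto
    finally show False using n by simp
  qed
  moreover have "1 \<notin> Q" using QI ideal_eq_algints by blast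
  ultimately have "is_prime Q" using QI Q0 unfolding is_prime_def by blast
  then show ?thesis using QI by blast
qed

text \<open>For \<open>J\<close> the whole ring this is maximality of \<open>P\<close>. Otherwise
  \<open>J\<close> lies in a prime \<open>Q\<close>, and dividing both \<open>J\<close> and
  \<open>A\<close> by \<open>Q\<close> produces the same situation with a smaller index of
  \<open>J\<close>.\<close>

lemma iprod_prime_maximal:
  assumes P: "is_prime (P :: 'a set)" and J: "is_ideal J" "J \<noteq> {0}"
    and A: "is_ideal A" "iprod J P \<subseteq> A" "A \<subseteq> J" "A \<noteq> iprod J P"
  shows "A = J"
  using J A
proof (induction "idx algints J" arbitrary: J A rule: less_induct)
  case less
  note J = less.prems(1,2) and A = less.prems(3-6)
  have PI: "is_ideal P" using P by (simp add: is_prime_def)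
  show ?case
  proof (cases "J = algints")
    case True
    then show ?thesis using prime_maximal[OF P A(1)] A iprod_algints[OF PI] by auto
  next
    case False
    then obtain Q where Q: "is_prime Q" "J \<subseteq> Q" using prime_above_exists[OF J] by blast
    have QI: "is_ideal Q" using Q by (simp add: is_prime_def)
    obtain g where g: "inverter Q g" using inverter_exists[OF Q(1)] by blast
    define J' A' where "J' = div_ideal g J" and "A' = div_ideal g A"
    have J': "is_ideal J'" "iprod J' Q = J" "J \<subseteq> J'" "J \<noteq> J'"
      using div_ideal[OF Q(1) g J(1) Q(2)] J(2) by (auto simp: J'_def)
    have AQ: "A \<subseteq> Q" using A(3) Q(2) by blast
    have A': "is_ideal A'" "iprod A' Q = A"
      using is_ideal_div_ideal[OF Q(1) g A(1) AQ] iprod_div_ideal[OF Q(1) g A(1) AQ] by (auto simp: A'_def)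
    have "J' \<noteq> {0}" using J'(3) J ideal_0 by blast
    have "A' = J'"
    proof (rule less.hyps[OF _ J'(1) \<open>J' \<noteq> {0}\<close> A'(1)])
      show "idx algints J' < idx algints J" by (rule ideal_idx_less[OF J J'(1,3,4)])
      show "A' \<subseteq> J'" using A(3) by (auto simp: A'_def J'_def div_ideal_def isum_def)
      show "iprod J' P \<subseteq> A'"
      proof (rule iprod_subset[OF ideal_zsub[OF A'(1)]])
        fix x y assume "x \<in> J'" and y: "y \<in> P"
        then obtain a b where ab: "a \<in> J" "b \<in> J" "x = a + g * b" by (auto simp: J'_def div_ideal_def isum_def)
        have "x * y = a * y + g * (b * y)" by (simp add: ab algebra_simps)
        moreover have "a * y \<in> A" "b * y \<in> A" using ab y A(2) iprod_mult by blast+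
        ultimately show "x * y \<in> A'" unfolding A'_def div_ideal_def isum_def by blast
      qed
      show "A' \<noteq> iprod J' P"
      proof
        assume "A' = iprod J' P"
        then have "A = iprod (iprod J' P) Q" using A'(2) by simp
        also have "\<dots> \<subseteq> iprod (iprod J' Q) P" by (rule iprod_swap[OF J'(1) PI QI])
        finally have "A \<subseteq> iprod J P" using J'(2) by simp
        then show False using A(2,4) by blast
      qed
    qed
    then show ?thesis using A'(2) J'(2) by simp
  qed
qed

text \<open>Multiplication by an element \<open>a\<close> of \<open>J\<close> outside
  \<open>J P\<close> identifies the residue ring of \<open>P\<close> with the quotient of
  \<open>J\<close> by \<open>J P\<close>. It is onto because no ideal lies strictly between these
  two; its kernel is a proper ideal containing the maximal \<open>P\<close>.\<close>

lemma idx_iprod_prime: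
  assumes P: "is_prime (P :: 'a set)" and J: "is_ideal J" "J \<noteq> {0}"
  shows "idx J (iprod J P) = idx algints P"
proof -
  have PI: "is_ideal P" using P by (simp add: is_prime_def)
  have JP: "is_ideal (iprod J P)" "iprod J P \<subseteq> J" using is_ideal_iprod[OF J(1) PI] by auto
  obtain a where a: "a \<in> J" "a \<notin> iprod J P" using iprod_prime_neq[OF P J] JP by blast
  define A where "A = isum (iprod J P) ((*) a ` algints)"
  have aI: "is_ideal ((*) a ` algints)" using ideal_int[OF J(1) a(1)] by (rule is_ideal_principal)
  have A: "is_ideal A" and sub: "iprod J P \<subseteq> A" and aA: "(*) a ` algints \<subseteq> A"
    unfolding A_def using is_ideal_isum[OF JP(1) aI] by blast+
  have "(*) a ` algints \<subseteq> J" using principal_subset_iff[OF J(1)] a(1) by blast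
  then have AJ: "A \<subseteq> J" using JP(2) ideal_add[OF J(1)] by (auto simp: A_def isum_def)
  have "a \<in> A" using aA principal_subset_iff[OF A] by simp
  then have "A = J" using iprod_prime_maximal[OF P J A sub AJ] a by blast
  define K where "K = {x. algebraic_int x \<and> a * x \<in> iprod J P}"
  have K: "is_ideal K"
    using ideal_0[OF JP(1)] ideal_add[OF JP(1)] ideal_mult[OF JP(1)]
    by (intro is_idealI) (auto simp: K_def distrib_left mult.left_commute)
  have "P \<subseteq> K" using a(1) iprod_mult ideal_int[OF PI] by (auto simp: K_def)
  moreover have "K \<noteq> algints"
  proof
    assume "K = algints"
    then have "1 \<in> K" by simp
    then show False using a by (simp add: K_def)
  qed
  ultimately have "P = K" using prime_maximal[OF P K] by blast
  have "idx algints P = idx J (iprod J P)"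
  proof (rule idx_iso[of _ _ "(*) a"])
    show "zsub P" "zsub (iprod J P)" using PI JP ideal_zsub by blast+
    show "a * (x - y) = a * x - a * y" for x y by (rule right_diff_distrib)
    show "a * x \<in> J" if "x \<in> algints" for x using ideal_mult'[OF J(1) _ a(1)] that by blast
    fix x y assume "x \<in> (algints :: 'a set)" "y \<in> (algints :: 'a set)"
    then have "algebraic_int (x - y)" by blast
    then have "a * (x - y) \<in> iprod J P \<longleftrightarrow> x - y \<in> K" by (simp add: K_def)
    then show "a * (x - y) \<in> iprod J P \<longleftrightarrow> x - y \<in> P" unfolding \<open>P = K\<close>[symmetric] .
  next
    fix y assume "y \<in> J"
    then have "y \<in> A" using \<open>A = J\<close> by simp
    then obtain q z where "q \<in> iprod J P" "algebraic_int z" "y = q + a * z" by (auto simp: A_def isum_def)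
    then show "\<exists>x\<in>algints. y - a * x \<in> iprod J P" by (intro bexI[of _ z]) auto
  qed
  then show ?thesis by simp
qed

lemma idx_prime_ge_2:
  assumes P: "is_prime (P :: 'a set)"
  shows "idx algints P \<ge> 2"
proof -
  have PI: "is_ideal P" "P \<noteq> {0}" "P \<noteq> algints" using P by (auto simp: is_prime_def)
  have "idx algints (algints :: 'a set) < idx algints P"
    using ideal_idx_less[OF PI(1,2) is_ideal_algints _ PI(3)] ideal_int[OF PI(1)] by blast
  moreover have "idx algints (algints :: 'a set) > 0"
    using idx_pos finite_quot_ideal[OF is_ideal_algints] zsub_algints[where 'a = 'a] algebraic_int_1
    by (metis idx_pos mem_Collect_eq singletonD zero_neq_one)
  ultimately show ?thesis by simp
qed

lemma ipow_nonzero: "is_prime P \<Longrightarrow> ipow P m \<noteq> ({0} :: 'a set)"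
proof (induction m)
  case 0
  have "(1 :: 'a) \<in> algints" by simp
  then show ?case by (metis ipow.simps(1) singletonD zero_neq_one)
next
  case (Suc m)
  then show ?case using iprod_nonzero[of "ipow P m" P] is_ideal_ipow[of P m] by (auto simp: is_prime_def)
qed

text \<open>Exponential growth of the index bounds the powers of \<open>P\<close> that contain a
  given nonzero element, so the maximum defining \<open>pord\<close> exists.\<close>

lemma idx_ipow:
  assumes P: "is_prime (P :: 'a set)"
  shows "idx algints (ipow P m) \<ge> 2 ^ m"
proof (induction m)
  case 0
  show ?case using idx_pos[OF finite_quot_ideal[OF is_ideal_ipow ipow_nonzero[OF P, of 0]] zsub_algints]
      is_prime_ideal[OF P] by simp
next
  case (Suc m)
  have PI: "is_ideal P" using P by (rule is_prime_ideal)
  have I: "is_ideal (ipow P m)" "ipow P m \<noteq> {0}" using is_ideal_ipow[OF PI] ipow_nonzero[OF P] by auto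
  have "idx algints (ipow P (Suc m)) = idx algints (ipow P m) * idx (ipow P m) (ipow P (Suc m))"
    using I is_ideal_ipow[OF PI, of "Suc m"] ipow_Suc_subset[OF PI, of m] ideal_int[OF I(1)]
    by (intro idx_tower zsub_algints ideal_zsub) auto
  also have "idx (ipow P m) (ipow P (Suc m)) = idx algints P" using idx_iprod_prime[OF P I] by simp
  finally show ?case using Suc idx_prime_ge_2[OF P] mult_le_mono by fastforce
qed

section \<open>Orders at a prime and factorization\<close>

definition pord :: "'a set \<Rightarrow> 'a \<Rightarrow> nat" where
  "pord P a = (GREATEST m. a \<in> ipow P m)"

text \<open>The index of the principal ideal of \<open>a\<close> bounds \<open>m\<close>, so
  \<open>GREATEST\<close> is attained; as the powers of \<open>P\<close> decrease, one number then
  describes all memberships.\<close>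

lemma mem_ipow_iff:
  assumes P: "is_prime P" and a: "algebraic_int a" "a \<noteq> 0"
  shows "a \<in> ipow P m \<longleftrightarrow> m \<le> pord P a"
proof -
  have PI: "is_ideal P" using P by (rule is_prime_ideal)
  have aI: "is_ideal ((*) a ` algints)" "(*) a ` algints \<noteq> {0}"
    using is_ideal_principal[OF a(1)] principal_subset_iff[OF is_ideal_principal[OF a(1)], of a] a(2) by blast+
  have bound: "m \<le> idx algints ((*) a ` algints)" if "a \<in> ipow P m" for m
  proof -
    have "(*) a ` algints \<subseteq> ipow P m" using principal_subset_iff[OF is_ideal_ipow[OF PI]] that by blast
    then have "idx algints (ipow P m) \<le> idx algints ((*) a ` algints)"
      using idx_mono(1)[OF finite_quot_ideal[OF aI]] ideal_int[OF is_ideal_ipow[OF PI]] zsub_algints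
        ideal_zsub[OF aI(1)] ideal_zsub[OF is_ideal_ipow[OF PI]] by blast
    then show ?thesis using idx_ipow[OF P, of m] less_exp[of m] by linarith
  qed
  have "a \<in> ipow P 0" using a by simp
  then have "a \<in> ipow P (pord P a)" unfolding pord_def using GreatestI_nat bound by metis
  moreover have "m \<le> pord P a" if "a \<in> ipow P m"
    unfolding pord_def using that bound by (rule Greatest_le_nat)
  ultimately show ?thesis using ipow_antimono[OF PI, of m "pord P a"] by blast
qed

lemma inverter_ipow:
  assumes P: "is_prime P" and g: "inverter P g"
  shows "y \<in> ipow P (i + j) \<Longrightarrow> g ^ i * y \<in> ipow P j"
proof (induction i arbitrary: y)
  case (Suc i)
  have "g * y \<in> ipow P (i + j)"
    using inverter_iprod[OF P g is_ideal_ipow[OF is_prime_ideal[OF P]]] Suc.prems by simp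
  then have "g ^ i * (g * y) \<in> ipow P j" by (rule Suc.IH)
  then show ?case by (simp add: mult_ac)
qed simp

text \<open>One factor \<open>P\<close> is removed at a time: if \<open>g * a\<close> lay in too
  high a power, then so would \<open>a = a p + (g a) p'\<close>.\<close>

lemma inverter_power_not_mem:
  assumes P: "is_prime P" and g: "inverter P g"
  shows "a \<in> ipow P m \<Longrightarrow> a \<notin> ipow P (Suc m) \<Longrightarrow> g ^ m * a \<notin> P"
proof (induction m arbitrary: a)
  case 0
  then show ?case using iprod_algints[OF is_prime_ideal[OF P]] by simp
next
  case (Suc m)
  have PI: "is_ideal P" using P by (rule is_prime_ideal)
  obtain p p' where p: "p \<in> P" "p' \<in> P" "\<And>x. x = x * p + g * (x * p')"
    "\<And>y. y \<in> P \<Longrightarrow> algebraic_int (g * y)" using inverterD[OF g] by blast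
  have 1: "g * a \<in> ipow P m" using inverter_iprod[OF P g is_ideal_ipow[OF PI]] Suc.prems(1) by simp
  have "g * a \<notin> ipow P (Suc m)"
  proof
    assume "g * a \<in> ipow P (Suc m)"
    then have "(g * a) * p' \<in> ipow P (Suc (Suc m))" "a * p \<in> ipow P (Suc (Suc m))"
      using Suc.prems(1) p(1,2) iprod_mult by (simp_all del: ipow.simps(2) add: ipow.simps(2)[of P "Suc m"])
    then have "a * p + (g * a) * p' \<in> ipow P (Suc (Suc m))" by (intro ideal_add[OF is_ideal_ipow[OF PI]])
    then show False using Suc.prems(2) p(3)[of a] by (simp add: mult.assoc)
  qed
  from Suc.IH[OF 1 this] show ?case by (simp add: mult_ac)
qed

text \<open>Multiplied by \<open>g ^ m\<close> and \<open>g ^ n\<close>, the factors become integers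
  outside \<open>P\<close>. If \<open>a * b\<close> had larger order, the product of these integers
  would still lie in \<open>P\<close>, against primality.\<close>

lemma pord_mult:
  assumes P: "is_prime P" and a: "algebraic_int a" "a \<noteq> 0" and b: "algebraic_int b" "b \<noteq> 0"
  shows "pord P (a * b) = pord P a + pord P b"
proof -
  define m n where "m = pord P a" and "n = pord P b"
  have PI: "is_ideal P" using P by (rule is_prime_ideal)
  obtain g where g: "inverter P g" using inverter_exists[OF P] by blast
  have ab: "algebraic_int (a * b)" "a * b \<noteq> 0" using a b by auto
  have mem: "a \<in> ipow P m" "a \<notin> ipow P (Suc m)" "b \<in> ipow P n" "b \<notin> ipow P (Suc n)"
    using mem_ipow_iff[OF P a] mem_ipow_iff[OF P b] by (simp_all add: m_def n_def del: ipow.simps)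
  have "ipow P i \<subseteq> {y. x * y \<in> ipow P (j + i)}" if "x \<in> ipow P j" for x i j
  proof (induction i)
    case 0
    then show ?case using ideal_mult'[OF is_ideal_ipow[OF PI] _ that] by auto
  next
    case (Suc i)
    have "iprod (ipow P i) P \<subseteq> {y. x * y \<in> ipow P (j + Suc i)}"
    proof (intro iprod_subset zsub_scale_preimage ideal_zsub[OF is_ideal_ipow[OF PI]] CollectI)
      fix u v assume "u \<in> ipow P i" "v \<in> P"
      then have "(x * u) * v \<in> iprod (ipow P (j + i)) P" using Suc by (intro iprod_mult) auto
      then show "x * (u * v) \<in> ipow P (j + Suc i)" by (simp add: mult.assoc)
    qed
    then show ?case by simp
  qed
  then have "a * b \<in> ipow P (m + n)" using mem by blast
  then have "m + n \<le> pord P (a * b)" using mem_ipow_iff[OF P ab] by blast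
  moreover have "\<not> m + n < pord P (a * b)"
  proof
    assume "m + n < pord P (a * b)"
    then have "a * b \<in> ipow P ((m + n) + 1)" using mem_ipow_iff[OF P ab] by (simp del: ipow.simps)
    then have "g ^ (m + n) * (a * b) \<in> ipow P 1" by (rule inverter_ipow[OF P g])
    then have "g ^ (m + n) * (a * b) \<in> P" using ipow_1[OF PI] by simp
    then have *: "(g ^ m * a) * (g ^ n * b) \<in> P" by (simp add: power_add mult_ac)
    have "g ^ m * a \<in> ipow P 0" "g ^ n * b \<in> ipow P 0" using inverter_ipow[OF P g, of _ _ 0] mem by auto
    then have "g ^ m * a \<in> P \<or> g ^ n * b \<in> P" using P * unfolding is_prime_def by simp
    then show False using inverter_power_not_mem[OF P g] mem by blast
  qed
  ultimately show ?thesis by (simp add: m_def n_def)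
qed

text \<open>Dividing \<open>I\<close> by a prime above it lowers the index. The factorization is
  recorded through the index and through the prime powers containing \<open>I\<close>, so no product
  of ideals over the multiset has to be formed.\<close>

lemma ideal_factorization:
  assumes I: "is_ideal (I :: 'a set)" "I \<noteq> {0}"
  shows "\<exists>Ms. (\<forall>P\<in>#Ms. is_prime P) \<and> idx algints I = (\<Prod>P\<in>#Ms. idx algints P) \<and>
    (\<forall>P m. is_prime P \<longrightarrow> (I \<subseteq> ipow P m \<longleftrightarrow> m \<le> count Ms P))"
  using I
proof (induction "idx algints I" arbitrary: I rule: less_induct)
  case less
  note I = less.prems
  show ?case
  proof (cases "I = algints")
    case True
    have fin: "finite (quot algints (algints :: 'a set))"
      using finite_quot_ideal[OF I] True by simp
    have "quot algints (algints :: 'a set) = {algints}"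
    proof -
      have "(+) x ` algints = (+) 0 ` (algints :: 'a set)" if "algebraic_int x" for x :: 'a
        using coset_eq_iff[OF zsub_algints, of x 0] that by simp
      then show ?thesis by (auto simp: quot_def intro!: image_eqI[of _ _ 0])
    qed
    then have "idx algints I = 1" using True by (simp add: idx_def)
    moreover have "I \<subseteq> ipow P m \<longleftrightarrow> m = 0" if P: "is_prime P" for P m
    proof
      assume "I \<subseteq> ipow P m"
      show "m = 0"
      proof (rule ccontr)
        assume "m \<noteq> 0"
        then have "ipow P m \<subseteq> ipow P 1" using ipow_antimono[OF is_prime_ideal[OF P], of 1 m] by simp
        then have "1 \<in> P" using ipow_1[OF is_prime_ideal[OF P]] \<open>I \<subseteq> ipow P m\<close> True by auto
        then show False using P by (simp add: is_prime_def)
      qed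
    qed (simp add: True)
    ultimately show ?thesis by (intro exI[of _ "{#}"]) simp
  next
    case False
    then obtain Q where Q: "is_prime Q" "I \<subseteq> Q" using prime_above_exists[OF I] by blast
    have QI: "is_ideal Q" using Q by (simp add: is_prime_def)
    obtain g where g: "inverter Q g" using inverter_exists[OF Q(1)] by blast
    define J where "J = div_ideal g I"
    have J: "is_ideal J" "iprod J Q = I" "I \<subseteq> J" "I \<noteq> J"
      using div_ideal[OF Q(1) g I(1) Q(2)] I(2) by (auto simp: J_def)
    have J0: "J \<noteq> {0}" using J I ideal_0 by blast
    obtain Ms where Ms: "\<forall>P\<in>#Ms. is_prime P" "idx algints J = (\<Prod>P\<in>#Ms. idx algints P)"
      "\<And>P m. is_prime P \<Longrightarrow> J \<subseteq> ipow P m \<longleftrightarrow> m \<le> count Ms P"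
      using less.hyps[OF ideal_idx_less[OF I J(1,3,4)] J(1) J0] by blast
    have "idx algints I = idx algints J * idx J I"
      using J I ideal_int by (intro idx_tower zsub_algints ideal_zsub) blast+
    also have "idx J I = idx algints Q" using idx_iprod_prime[OF Q(1) J(1) J0] J(2) by simp
    finally have 1: "idx algints I = (\<Prod>P\<in>#add_mset Q Ms. idx algints P)" by (simp add: Ms(2) mult.commute)
    have 2: "I \<subseteq> ipow P m \<longleftrightarrow> m \<le> count (add_mset Q Ms) P" if P: "is_prime P" for P m
    proof (cases "P = Q")
      case True
      show ?thesis
      proof (cases m)
        case 0
        then show ?thesis using ideal_int[OF I(1)] by auto
      next
        case (Suc k)
        have "I \<subseteq> ipow Q (Suc k) \<longleftrightarrow> J \<subseteq> ipow Q k"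
        proof
          assume "J \<subseteq> ipow Q k"
          then have "iprod J Q \<subseteq> iprod (ipow Q k) Q" by (intro iprod_mono) auto
          then show "I \<subseteq> ipow Q (Suc k)" by (simp add: J(2))
        next
          assume *: "I \<subseteq> ipow Q (Suc k)"
          \<comment> \<open>The splitting of 1 by the inverter cancels the factor
            \<open>Q\<close>.\<close>
          obtain p p' where p: "p \<in> Q" "p' \<in> Q" "\<And>x. x = x * p + g * (x * p')"
    "\<And>y. y \<in> Q \<Longrightarrow> algebraic_int (g * y)" using inverterD[OF g] by blast
          show "J \<subseteq> ipow Q k"
          proof
            fix x assume "x \<in> J"
            then have "x * p \<in> ipow Q (Suc k)" "x * p' \<in> ipow Q (Suc k)" using p iprod_mult J(2) * by blast+
            then have "x * p \<in> ipow Q k" "g * (x * p') \<in> ipow Q k"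
              using ipow_Suc_subset[OF QI, of k] inverter_iprod[OF Q(1) g is_ideal_ipow[OF QI]] by auto
            then have "x * p + g * (x * p') \<in> ipow Q k" by (rule ideal_add[OF is_ideal_ipow[OF QI]])
            then show "x \<in> ipow Q k" using p(3)[of x] by simp
          qed
        qed
        then show ?thesis using Ms(3)[OF Q(1), of k] True Suc by (simp del: ipow.simps)
      qed
    next
      case False
      have PI: "is_ideal P" using P by (rule is_prime_ideal)
      \<comment> \<open>An element of \<open>Q\<close> outside \<open>P\<close> has order 0 at
        \<open>P\<close>; multiplication by it takes \<open>J\<close> into \<open>I\<close> without
        changing orders at \<open>P\<close>.\<close>
      have "\<not> Q \<subseteq> P" using prime_maximal[OF Q(1) PI] False P by (auto simp: is_prime_def)
      then obtain s where s: "s \<in> Q" "s \<notin> P" by blast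
      have s': "algebraic_int s" "s \<noteq> 0" using s ideal_int[OF QI] ideal_0[OF PI] by auto
      have "\<not> 1 \<le> pord P s" using mem_ipow_iff[OF P s', of 1] ipow_1[OF PI] s(2) by simp
      then have s0: "pord P s = 0" by simp
      have "I \<subseteq> ipow P m \<longleftrightarrow> J \<subseteq> ipow P m"
      proof
        assume *: "I \<subseteq> ipow P m"
        show "J \<subseteq> ipow P m"
        proof
          fix x assume x: "x \<in> J"
          show "x \<in> ipow P m"
          proof (cases "x = 0")
            case True
            then show ?thesis using ideal_0[OF is_ideal_ipow[OF PI]] by simp
          next
            case False
            have xi: "algebraic_int x" using x J(1) ideal_int by blast
            have "x * s \<in> ipow P m" using iprod_mult[OF x s(1)] J(2) * by blast
            moreover have "algebraic_int (x * s)" "x * s \<noteq> 0" using xi s' False by auto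
            ultimately have "m \<le> pord P (x * s)" using mem_ipow_iff[OF P] by blast
            then have "m \<le> pord P x" using pord_mult[OF P xi False s'] s0 by simp
            then show ?thesis using mem_ipow_iff[OF P xi False] by blast
          qed
        qed
      qed (use J(3) in blast)
      then show ?thesis using Ms(3)[OF P] False by simp
    qed
    show ?thesis using 1 2 Ms(1) Q(1) by (intro exI[of _ "add_mset Q Ms"]) (auto simp del: count_add_mset)
  qed
qed

theorem idx_principal_eq_prod:
  assumes a: "algebraic_int (a :: 'a)" "a \<noteq> 0"
  shows "finite {P. is_prime P \<and> pord P a \<noteq> 0}"
    and "idx algints ((*) a ` algints) = (\<Prod>P | is_prime P \<and> pord P a \<noteq> 0. idx algints P ^ pord P a)"
proof -
  let ?I = "(*) a ` (algints :: 'a set)"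
  have I: "is_ideal ?I" "?I \<noteq> {0}"
    using is_ideal_principal[OF a(1)] principal_subset_iff[OF is_ideal_principal[OF a(1)], of a] a(2) by blast+
  obtain Ms where Ms: "\<forall>P\<in>#Ms. is_prime P" "idx algints ?I = (\<Prod>P\<in>#Ms. idx algints P)"
    "\<And>P m. is_prime P \<Longrightarrow> ?I \<subseteq> ipow P m \<longleftrightarrow> m \<le> count Ms P"
    using ideal_factorization[OF I] by blast
  have cnt: "count Ms P = pord P a" if P: "is_prime P" for P
  proof -
    have "m \<le> count Ms P \<longleftrightarrow> m \<le> pord P a" for m
      using Ms(3)[OF P] mem_ipow_iff[OF P a] principal_subset_iff[OF is_ideal_ipow[OF is_prime_ideal[OF P]]] by blast
    then show ?thesis using le_antisym by blast
  qed
  have set: "set_mset Ms = {P. is_prime P \<and> pord P a \<noteq> 0}"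
    using Ms(1) cnt by (auto simp flip: count_greater_zero_iff)
  then show "finite {P. is_prime P \<and> pord P a \<noteq> 0}" using finite_set_mset[of Ms] by simp
  have "(\<Prod>P\<in>#Ms. idx algints P) = (\<Prod>P\<in>set_mset Ms. idx algints P ^ count Ms P)"
    by (rule image_prod_mset_multiplicity)
  also have "\<dots> = (\<Prod>P | is_prime P \<and> pord P a \<noteq> 0. idx algints P ^ pord P a)"
    unfolding set by (rule prod.cong) (auto simp: cnt)
  finally show "idx algints ?I = (\<Prod>P | is_prime P \<and> pord P a \<noteq> 0. idx algints P ^ pord P a)"
    using Ms(2) by simp
qed

end

section \<open>Places and the product formula\<close>

lemma ring_of_integers_simps:
  "carrier ring_of_integers = algints"
  "x \<otimes>\<^bsub>ring_of_integers\<^esub> y = x * y"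
  "x \<oplus>\<^bsub>ring_of_integers\<^esub> y = x + y"
  "\<one>\<^bsub>ring_of_integers\<^esub> = 1"
  "\<zero>\<^bsub>ring_of_integers\<^esub> = 0"
  by (simp_all add: ring_of_integers_def ring_of_type_algebra_def)

lemma cring_ring_of_integers: "cring (ring_of_integers :: 'a::field_char_0 ring)"
proof (rule cringI)
  show "abelian_group (ring_of_integers :: 'a ring)"
  proof (rule abelian_groupI)
    fix x :: 'a assume "x \<in> carrier ring_of_integers"
    then show "\<exists>y\<in>carrier ring_of_integers. y \<oplus>\<^bsub>ring_of_integers\<^esub> x = \<zero>\<^bsub>ring_of_integers\<^esub>"
      by (intro bexI[of _ "- x"]) (auto simp: ring_of_integers_simps)
  qed (auto simp: ring_of_integers_simps)
  show "Group.comm_monoid (ring_of_integers :: 'a ring)"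
    by (rule comm_monoidI) (auto simp: ring_of_integers_simps)
qed (auto simp: ring_of_integers_simps distrib_right)

lemma ideal_iff: "ideal I ring_of_integers \<longleftrightarrow> is_ideal I"
proof
  assume I: "ideal I ring_of_integers"
  interpret ideal I ring_of_integers by (rule I)
  show "is_ideal I"
    using additive_subgroup.zero_closed[OF is_additive_subgroup]
      additive_subgroup.a_closed[OF is_additive_subgroup] I_l_closed Icarr
    by (intro is_idealI) (auto simp: ring_of_integers_simps)
next
  assume I: "is_ideal I"
  let ?R = "ring_of_integers :: 'a ring"
  interpret cring ?R by (rule cring_ring_of_integers)
  show "ideal I ?R"
  proof (rule idealI)
    show "ring ?R" by (rule ring_axioms)
    show "subgroup I (add_monoid ?R)"
    proof (rule add.subgroupI)
      show "I \<subseteq> carrier ?R" using ideal_int[OF I] by (auto simp: ring_of_integers_simps)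
      show "I \<noteq> {}" using ideal_0[OF I] by blast
      fix x assume x: "x \<in> I"
      have "\<ominus>\<^bsub>?R\<^esub> x = - x"
        by (rule minus_equality) (use x ideal_int[OF I] in \<open>auto simp: ring_of_integers_simps\<close>)
      moreover have "- x \<in> I" using ideal_mult[OF I _ x, of "- 1"] by simp
      ultimately show "\<ominus>\<^bsub>?R\<^esub> x \<in> I" by simp
    qed (use ideal_add[OF I] in \<open>auto simp: ring_of_integers_simps\<close>)
  qed (use ideal_mult[OF I] ideal_mult'[OF I] in \<open>auto simp: ring_of_integers_simps\<close>)
qed

lemma finite_places_eq: "finite_places = {P :: 'a::field_char_0 set. is_prime P}"
proof -
  have "primeideal P ring_of_integers \<and> P \<noteq> {0} \<longleftrightarrow> is_prime P" for P :: "'a set"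
  proof
    assume P: "primeideal P ring_of_integers \<and> P \<noteq> {0}"
    then interpret primeideal P ring_of_integers by simp
    have I: "is_ideal P" using is_ideal by (simp add: ideal_iff)
    then have "1 \<notin> P" using I_notcarr ideal_eq_algints by (auto simp: ring_of_integers_simps)
    then show "is_prime P" using I P I_prime by (auto simp: is_prime_def ring_of_integers_simps)
  next
    assume P: "is_prime P"
    then have "primeideal P ring_of_integers"
      by (intro primeidealI cring_ring_of_integers)
         (auto simp: is_prime_def ideal_iff ring_of_integers_simps)
    then show "primeideal P ring_of_integers \<and> P \<noteq> {0}" using P by (simp add: is_prime_def)
  qed
  then show ?thesis by (simp add: finite_places_def)
qed

lemma ideal_norm_eq: "ideal_norm P = idx algints P"
proof -
  have "carrier (ring_of_integers Quot P) = quot algints P"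
    by (auto simp: FactRing_def A_RCOSETS_def' a_r_coset_def' ring_of_integers_simps quot_def add.commute image_iff)
  then show ?thesis by (simp add: ideal_norm_def idx_def)
qed

lemma ideal_prod_eq:
  assumes "is_ideal I" "is_ideal J"
  shows "ideal_prod ring_of_integers I J = iprod I J"
proof
  show "ideal_prod ring_of_integers I J \<subseteq> iprod I J"
  proof
    fix x assume "x \<in> ideal_prod ring_of_integers I J"
    then show "x \<in> iprod I J"
      by induction (auto simp: ring_of_integers_simps intro: iprod_mult ideal_add[OF is_ideal_iprod(1)[OF assms]])
  qed
  interpret cring "ring_of_integers :: 'a ring" by (rule cring_ring_of_integers)
  have "is_ideal (ideal_prod ring_of_integers I J)"
    using ideal_prod_is_ideal[of I J] assms by (simp add: ideal_iff)
  then show "iprod I J \<subseteq> ideal_prod ring_of_integers I J"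
    using ideal_prod.prod[of _ I _ J ring_of_integers]
    by (intro iprod_subset ideal_zsub) (auto simp: ring_of_integers_simps)
qed

lemma ideal_power_eq:
  assumes "is_ideal P"
  shows "P [^]\<^bsub>ideals_set ring_of_integers\<^esub> (m::nat) = ipow P m"
proof (induction m)
  case 0
  show ?case by (simp add: nat_pow_def ideals_set_def ring_of_integers_simps)
next
  case (Suc m)
  have "P [^]\<^bsub>ideals_set ring_of_integers\<^esub> Suc m =
      ideal_prod ring_of_integers (P [^]\<^bsub>ideals_set ring_of_integers\<^esub> m) P"
    by (simp add: nat_pow_def ideals_set_def)
  then show ?case by (simp add: Suc.IH ideal_prod_eq is_ideal_ipow assms)
qed

context number_field_basis
begin

section \<open>Valuations and the product formula over embeddings\<close>

lemma ideal_order_eq: "is_prime P \<Longrightarrow> ideal_order P a = pord P a"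
  by (simp add: ideal_order_def pord_def ideal_power_eq is_prime_ideal)

text \<open>Additivity of \<open>pord\<close> makes the difference independent of the fraction
  chosen, so the definite description has a unique solution.\<close>

lemma valuation_eq:
  assumes P: "is_prime P" and ab: "algebraic_int a" "algebraic_int b" "a \<noteq> 0" "b \<noteq> 0"
  shows "valuation P (a / b) = int (pord P a) - int (pord P b)"
  unfolding valuation_def
proof (rule the_equality)
  show "\<exists>c d. algebraic_int c \<and> algebraic_int d \<and> c \<noteq> 0 \<and> d \<noteq> 0 \<and> a / b = c / d \<and>
      int (pord P a) - int (pord P b) = int (ideal_order P c) - int (ideal_order P d)"
    using ab ideal_order_eq[OF P] by (intro exI[of _ a] exI[of _ b]) auto
next
  fix m assume "\<exists>c d. algebraic_int c \<and> algebraic_int d \<and> c \<noteq> 0 \<and> d \<noteq> 0 \<and> a / b = c / d \<and>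
      m = int (ideal_order P c) - int (ideal_order P d)"
  then obtain c d where cd: "algebraic_int c" "algebraic_int d" "c \<noteq> 0" "d \<noteq> 0" "a / b = c / d"
      "m = int (pord P c) - int (pord P d)" using ideal_order_eq[OF P] by auto
  have "a * d = c * b" using ab cd by (simp add: field_simps)
  then have "pord P a + pord P d = pord P c + pord P b"
    using pord_mult[OF P] ab cd by metis
  then show "m = int (pord P a) - int (pord P b)" using cd(6) by linarith
qed

lemma fraction_exists:
  "\<exists>a b. algebraic_int a \<and> algebraic_int b \<and> b \<noteq> 0 \<and> (x :: 'a) = a / b"
proof -
  obtain m where m: "m > 0" "algebraic_int (of_int m * x)" using multiple_algebraic_int by blast
  then have "x = (of_int m * x) / of_int m" by simp
  then show ?thesis using m by (metis algebraic_int_of_int less_irrefl of_int_eq_0_iff)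
qed

lemma valuation_mult:
  assumes P: "is_prime P" and xy: "x \<noteq> 0" "y \<noteq> (0 :: 'a)"
  shows "valuation P (x * y) = valuation P x + valuation P y"
proof -
  obtain a b c d where ab: "algebraic_int a" "algebraic_int b" "b \<noteq> 0" "x = a / b"
    "algebraic_int c" "algebraic_int d" "d \<noteq> 0" "y = c / d" using fraction_exists by metis
  then have 0: "a \<noteq> 0" "c \<noteq> 0" using xy by auto
  have "x * y = (a * c) / (b * d)" using ab by simp
  then show ?thesis
    using valuation_eq[OF P, of "a * c" "b * d"] valuation_eq[OF P, of a b] valuation_eq[OF P, of c d]
      pord_mult[OF P] algebraic_int_mult[OF ab(1,5)] algebraic_int_mult[OF ab(2,6)] ab 0 by simp
qed

lemma valuation_pord:
  assumes "is_prime P" "algebraic_int a" "a \<noteq> (0 :: 'a)"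
  shows "valuation P a = int (pord P a)"
proof -
  have "\<not> 1 \<le> pord P 1"
    using mem_ipow_iff[OF assms(1), of 1 1] ipow_1[OF is_prime_ideal[OF assms(1)]] assms(1)
    by (simp add: is_prime_def)
  then show ?thesis using valuation_eq[OF assms(1,2) _ assms(3), of 1] by simp
qed

lemma finite_valuation_support:
  assumes "x \<noteq> (0 :: 'a)"
  shows "finite {P. is_prime P \<and> valuation P x \<noteq> 0}"
proof -
  obtain a b where ab: "algebraic_int a" "algebraic_int b" "b \<noteq> 0" "x = a / b" using fraction_exists by blast
  then have "a \<noteq> 0" using assms by auto
  have "{P. is_prime P \<and> valuation P x \<noteq> 0} \<subseteq> {P. is_prime P \<and> pord P a \<noteq> 0} \<union> {P. is_prime P \<and> pord P b \<noteq> 0}"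
    using valuation_eq ab \<open>a \<noteq> 0\<close> by auto
  then show ?thesis
    using idx_principal_eq_prod(1) ab \<open>a \<noteq> 0\<close> finite_subset by blast
qed

lemma ideal_norm_ge_2: "is_prime (P :: 'a set) \<Longrightarrow> ideal_norm P \<ge> 2"
  by (simp add: ideal_norm_eq idx_prime_ge_2)

text \<open>The freedom in \<open>S\<close> lets one set of primes serve several products at once.
  The two expressions for an index give the formula for numerator and denominator
  separately.\<close>

theorem product_formula_embeddings:
  assumes "x \<noteq> (0 :: 'a)" "finite S" "S \<subseteq> {P. is_prime P}" "{P. is_prime P \<and> valuation P x \<noteq> 0} \<subseteq> S"
  shows "(\<Prod>P\<in>S. real (ideal_norm P) powi (- valuation P x)) * (\<Prod>\<sigma>\<in>complex_embeddings. cmod (\<sigma> x)) = 1"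
proof -
  obtain a b where ab: "algebraic_int a" "algebraic_int b" "b \<noteq> 0" "x = a / b" using fraction_exists by blast
  then have "a \<noteq> 0" using assms by auto
  let ?N = "\<lambda>x. \<Prod>\<sigma>\<in>complex_embeddings. cmod (\<sigma> (x :: 'a))"
  \<comment> \<open>\<open>T\<close> also contains the primes whose contributions to
    \<open>a\<close> and \<open>b\<close> cancel in \<open>x\<close>.\<close>
  define T where "T = S \<union> {P. is_prime P \<and> pord P a \<noteq> 0} \<union> {P. is_prime P \<and> pord P b \<noteq> 0}"
  have T: "finite T" "T \<subseteq> {P. is_prime P}"
    using assms idx_principal_eq_prod(1) ab \<open>a \<noteq> 0\<close> by (auto simp: T_def)
  have norm: "?N c = (\<Prod>P\<in>T. real (ideal_norm P) ^ pord P c)"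
    if c: "algebraic_int c" "c \<noteq> 0" "{P. is_prime P \<and> pord P c \<noteq> 0} \<subseteq> T" for c
  proof -
    have "(*) c ` algints \<subseteq> algints" using c(1) by auto
    then have "?N c = real (idx algints ((*) c ` algints))"
      using idx_scale_eq_prod_embeddings[OF zlattice_algebraic_ints c(2)] by simp
    also have "\<dots> = (\<Prod>P | is_prime P \<and> pord P c \<noteq> 0. real (ideal_norm P) ^ pord P c)"
      by (simp add: idx_principal_eq_prod(2)[OF c(1,2)] ideal_norm_eq)
    also have "\<dots> = (\<Prod>P\<in>T. real (ideal_norm P) ^ pord P c)"
      by (rule prod.mono_neutral_left) (use T c(3) in \<open>auto intro!: gr0I\<close>)
    finally show ?thesis .
  qed
  have Nab: "?N x * ?N b = ?N a"
    using ab by (simp add: prod.distrib[symmetric] norm_mult[symmetric] embedding_mult[symmetric])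
  have "(\<Prod>P\<in>S. real (ideal_norm P) powi (- valuation P x)) = (\<Prod>P\<in>T. real (ideal_norm P) powi (- valuation P x))"
    by (rule prod.mono_neutral_left) (use T assms in \<open>auto simp: T_def\<close>)
  also have "\<dots> = (\<Prod>P\<in>T. real (ideal_norm P) ^ pord P b / real (ideal_norm P) ^ pord P a)"
  proof (rule prod.cong)
    fix P assume "P \<in> T"
    then have P: "is_prime P" using T by auto
    have "- valuation P x = int (pord P b) - int (pord P a)" using valuation_eq[OF P] ab \<open>a \<noteq> 0\<close> by simp
    then show "real (ideal_norm P) powi (- valuation P x) = real (ideal_norm P) ^ pord P b / real (ideal_norm P) ^ pord P a"
      using ideal_norm_ge_2[OF P] by (simp add: power_int_diff)
  qed simp
  also have "\<dots> = ?N b / ?N a"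
  proof -
    have "{P. is_prime P \<and> pord P a \<noteq> 0} \<subseteq> T" "{P. is_prime P \<and> pord P b \<noteq> 0} \<subseteq> T"
      by (auto simp: T_def)
    from norm[OF ab(1) \<open>a \<noteq> 0\<close> this(1)] norm[OF ab(2,3) this(2)] show ?thesis
      by (simp only: prod_dividef)
  qed
  finally have eq: "(\<Prod>P\<in>S. real (ideal_norm P) powi (- valuation P x)) = ?N b / ?N a" .
  have "?N a \<noteq> 0" using \<open>a \<noteq> 0\<close> by (simp add: finite_complex_embeddings embedding_eq_0_iff)
  then show ?thesis unfolding eq using Nab by (metis divide_self mult.commute times_divide_eq_left)
qed

end

section \<open>Archimedean places as conjugate pairs\<close>

definition conj_rel :: "(('a::field_char_0 \<Rightarrow> complex) \<times> ('a \<Rightarrow> complex)) set" where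
  "conj_rel = {(\<sigma>, \<tau>). \<sigma> \<in> complex_embeddings \<and> \<tau> \<in> complex_embeddings \<and> (\<tau> = \<sigma> \<or> \<tau> = cnj \<circ> \<sigma>)}"

lemma arch_places_eq: "arch_places = complex_embeddings // conj_rel"
  by (simp add: arch_places_def conj_rel_def)

lemma cnj_cnj_comp: "cnj \<circ> (cnj \<circ> \<sigma>) = \<sigma>"
  by (auto simp: fun_eq_iff)

lemma equiv_conj_rel: "equiv complex_embeddings (conj_rel :: (('a::field_char_0 \<Rightarrow> complex) \<times> ('a \<Rightarrow> complex)) set)"
proof (rule equivI)
  show "conj_rel \<subseteq> complex_embeddings \<times> (complex_embeddings :: ('a \<Rightarrow> complex) set)"
    by (auto simp: conj_rel_def)
  show "refl_on complex_embeddings (conj_rel :: (('a \<Rightarrow> complex) \<times> ('a \<Rightarrow> complex)) set)"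
    by (auto simp: refl_on_def conj_rel_def)
  show "sym (conj_rel :: (('a \<Rightarrow> complex) \<times> ('a \<Rightarrow> complex)) set)"
    by (auto simp: sym_def conj_rel_def cnj_cnj_comp)
  show "trans (conj_rel :: (('a \<Rightarrow> complex) \<times> ('a \<Rightarrow> complex)) set)"
    by (auto simp: trans_def conj_rel_def cnj_cnj_comp)
qed

lemma cnj_embedding: "\<sigma> \<in> complex_embeddings \<Longrightarrow> cnj \<circ> \<sigma> \<in> complex_embeddings"
  by (simp add: complex_embeddings_iff)

lemma conj_class: "\<sigma> \<in> complex_embeddings \<Longrightarrow> conj_rel `` {\<sigma>} = {\<sigma>, cnj \<circ> \<sigma>}"
  by (auto simp: conj_rel_def cnj_embedding)

lemma arch_placeE:
  assumes "v \<in> arch_places"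
  shows "(SOME \<sigma>. \<sigma> \<in> v) \<in> complex_embeddings" and "v = {SOME \<sigma>. \<sigma> \<in> v, cnj \<circ> (SOME \<sigma>. \<sigma> \<in> v)}"
proof -
  obtain \<tau> where \<tau>: "\<tau> \<in> complex_embeddings" "v = {\<tau>, cnj \<circ> \<tau>}"
    using assms conj_class by (auto simp: arch_places_eq quotient_def)
  define \<sigma> where "\<sigma> = (SOME \<sigma>. \<sigma> \<in> v)"
  have "\<tau> \<in> v" by (simp add: \<tau>(2))
  then have "\<sigma> \<in> v" unfolding \<sigma>_def by (rule someI[of "\<lambda>\<sigma>. \<sigma> \<in> v"])
  then have "\<sigma> = \<tau> \<or> \<sigma> = cnj \<circ> \<tau>" by (simp add: \<tau>(2))
  then have *: "\<sigma> \<in> complex_embeddings" "v = {\<sigma>, cnj \<circ> \<sigma>}"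
    using \<tau> cnj_embedding[OF \<tau>(1)] cnj_cnj_comp[of \<tau>] by auto
  show "(SOME \<sigma>. \<sigma> \<in> v) \<in> complex_embeddings" by (rule *(1)[unfolded \<sigma>_def])
  show "v = {SOME \<sigma>. \<sigma> \<in> v, cnj \<circ> (SOME \<sigma>. \<sigma> \<in> v)}" by (rule *(2)[unfolded \<sigma>_def])
qed

text \<open>For a real embedding the closure lies in the real line and the class is a single map.
  Otherwise 1 and a nonreal value span the plane, and the class has two members.\<close>

lemma arch_local_degree_eq:
  assumes "v \<in> (arch_places :: ('a::field_char_0 \<Rightarrow> complex) set set)"
  shows "arch_local_degree v = card v"
proof -
  define \<sigma> where "\<sigma> = (SOME \<sigma>. \<sigma> \<in> v)"
  have \<sigma>: "\<sigma> \<in> complex_embeddings" "v = {\<sigma>, cnj \<circ> \<sigma>}"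
    unfolding \<sigma>_def by (rule arch_placeE[OF assms])+
  have one: "1 \<in> closure (range \<sigma>)"
    using closure_subset[of "range \<sigma>"] embedding_1[OF \<sigma>(1)] by (metis rangeI subsetD)
  have deg: "arch_local_degree v = dim (closure (range \<sigma>))" by (simp add: arch_local_degree_def \<sigma>_def)
  show ?thesis
  proof (cases "\<forall>x. \<sigma> x \<in> \<real>")
    case True
    then have "cnj \<circ> \<sigma> = \<sigma>" by (auto simp: fun_eq_iff Reals_cnj_iff)
    then have "card v = 1" by (simp add: \<sigma>(2))
    have "closure (range \<sigma>) \<subseteq> \<real>" using True by (intro closure_minimal closed_complex_Reals) auto
    also have "\<dots> \<subseteq> span {1}" by (auto simp: span_singleton Reals_def scaleR_conv_of_real)
    finally have "dim (closure (range \<sigma>)) \<le> card {1 :: complex}" by (intro dim_le_card) auto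
    moreover have "dim (closure (range \<sigma>)) \<noteq> 0" using one by (metis dim_eq_0 singletonD subsetD zero_neq_one)
    ultimately have "dim (closure (range \<sigma>)) = 1" by (metis One_nat_def card_1_singleton_iff le_Suc_eq le_zero_eq)
    then show ?thesis using deg \<open>card v = 1\<close> by metis
  next
    case False
    then obtain x where x: "\<sigma> x \<notin> \<real>" by blast
    then have "(cnj \<circ> \<sigma>) x \<noteq> \<sigma> x" by (simp add: Reals_cnj_iff)
    then have "cnj \<circ> \<sigma> \<noteq> \<sigma>" by metis
    then have "card v = 2" by (simp add: \<sigma>(2))
    have "\<sigma> x \<notin> span {1}"
    proof
      assume "\<sigma> x \<in> span {1}"
      then show False using x by (auto simp: span_singleton scaleR_conv_of_real)
    qed
    then have "dim {\<sigma> x, 1} = 2" by (simp add: dim_insert)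
    moreover have "{\<sigma> x, 1} \<subseteq> closure (range \<sigma>)" using one closure_subset[of "range \<sigma>"] by auto
    ultimately have "2 \<le> dim (closure (range \<sigma>))" by (metis dim_subset)
    moreover have "dim (closure (range \<sigma>)) \<le> 2" using dim_subset_UNIV[of "closure (range \<sigma>)"] by simp
    ultimately show ?thesis using deg \<open>card v = 2\<close> by simp
  qed
qed

context number_field_basis
begin

lemma finite_arch_places: "finite (arch_places :: ('a \<Rightarrow> complex) set set)"
  unfolding arch_places_eq
  by (rule finite_quotient[OF finite_complex_embeddings]) (auto simp: conj_rel_def)

text \<open>The local degree is the size of the conjugation class, and its members have equal
  absolute values, so each place contributes the product over its class.\<close>

lemma prod_arch_places:
  "(\<Prod>v\<in>arch_places. normalized_abs (Arch_Place v) x) = (\<Prod>\<sigma>\<in>complex_embeddings. cmod (\<sigma> (x :: 'a)))"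
proof -
  have "normalized_abs (Arch_Place v) x = (\<Prod>\<sigma>\<in>v. cmod (\<sigma> x))" if v: "v \<in> arch_places" for v
  proof -
    have "cmod (\<tau> x) = arch_abs v x" if "\<tau> \<in> v" for \<tau>
    proof -
      define \<sigma> where "\<sigma> = (SOME \<sigma>. \<sigma> \<in> v)"
      have "v = {\<sigma>, cnj \<circ> \<sigma>}" unfolding \<sigma>_def by (rule arch_placeE(2)[OF v])
      then have "\<tau> = \<sigma> \<or> \<tau> = cnj \<circ> \<sigma>" using that by blast
      then have "cmod (\<tau> x) = cmod (\<sigma> x)" by auto
      then show ?thesis by (simp add: arch_abs_def \<sigma>_def)
    qed
    then show ?thesis by (simp add: arch_local_degree_eq[OF v])
  qed
  then have "(\<Prod>v\<in>arch_places. normalized_abs (Arch_Place v) x) = (\<Prod>v\<in>arch_places. \<Prod>\<sigma>\<in>v. cmod (\<sigma> x))"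
    by (rule prod.cong[OF refl])
  also have "\<dots> = (\<Prod>\<sigma>\<in>\<Union> arch_places. cmod (\<sigma> x))"
  proof (rule prod.Union_disjoint[symmetric, unfolded o_def])
    show "\<forall>A\<in>arch_places. finite (A :: ('a \<Rightarrow> complex) set)" using arch_placeE(2) by (metis finite.simps)
    show "\<forall>A\<in>arch_places. \<forall>B\<in>arch_places. A \<noteq> B \<longrightarrow> A \<inter> B = ({} :: ('a \<Rightarrow> complex) set)"
      using quotient_disj[OF equiv_conj_rel] by (auto simp: arch_places_eq)
  qed
  also have "\<Union> arch_places = (complex_embeddings :: ('a \<Rightarrow> complex) set)"
    unfolding arch_places_eq by (rule Union_quotient[OF equiv_conj_rel])
  finally show ?thesis .
qed

end

section \<open>Heights\<close>

lemma prod'_eq_prod: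
  assumes "finite S" "S \<subseteq> A" "\<And>x. x \<in> A - S \<Longrightarrow> f x = 1"
  shows "prod' f A = prod f S"
  using prod.mono_neutral_left'[of S A f] prod.eq_sum[OF assms(1), of f] assms by auto

lemma prod_ge_1_eq_1_iff:
  fixes f :: "'b \<Rightarrow> real"
  assumes "finite S" "\<And>x. x \<in> S \<Longrightarrow> f x \<ge> 1"
  shows "prod f S \<ge> 1" and "prod f S = 1 \<longleftrightarrow> (\<forall>x\<in>S. f x = 1)"
proof -
  show ge: "prod f S \<ge> 1" using assms by (intro prod_ge_1) auto
  show "prod f S = 1 \<longleftrightarrow> (\<forall>x\<in>S. f x = 1)"
  proof
    assume 1: "prod f S = 1"
    show "\<forall>x\<in>S. f x = 1"
    proof
      fix x assume x: "x \<in> S"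
      have "prod f (S - {x}) \<ge> 1" using assms by (intro prod_ge_1) auto
      then have "f x * 1 \<le> f x * prod f (S - {x})" using assms(2)[OF x] by (intro mult_left_mono) auto
      also have "\<dots> = 1" using prod.remove[OF assms(1) x, of f] 1 by simp
      finally show "f x = 1" using assms(2)[OF x] by simp
    qed
  qed simp
qed

text \<open>For positive values, take the root of order \<open>k * n\<close>. Zero is treated apart,
  since rewriting powers as \<open>powr\<close> assumes a positive base.\<close>

lemma powr_inverse_eq:
  fixes a b c :: real
  assumes "a \<ge> 0" "b \<ge> 0" "c > 0" "k > 0" "n > 0" and eq: "a ^ k = c ^ n * b ^ k"
  shows "a powr (1 / real n) = c powr (1 / real k) * b powr (1 / real n)"
proof (cases "b = 0")
  case True
  then have "a = 0" using eq assms by (simp add: power_0_left)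
  then show ?thesis using True by simp
next
  case False
  then have b: "b > 0" using assms by simp
  then have "a ^ k > 0" using eq assms by simp
  then have a: "a > 0" using assms by (cases "a = 0") (auto simp: power_0_left)
  have "a powr real k = c powr real n * b powr real k"
    using eq a b assms by (simp add: powr_realpow)
  then have "(a powr real k) powr (1 / (real k * real n)) = (c powr real n * b powr real k) powr (1 / (real k * real n))"
    by simp
  then show ?thesis using a b assms by (simp add: powr_powr powr_mult field_simps)
qed

lemma power_cross_mult:
  fixes a b u w :: "'a::comm_monoid_mult"
  shows "(a ^ s * u) ^ t * (b ^ t * w) ^ s = (a ^ t * w) ^ s * (b ^ s * u) ^ t"
proof -
  have "(x ^ s) ^ t = (x ^ t) ^ s" for x :: 'a by (metis power_mult mult.commute)
  then show ?thesis by (simp only: power_mult_distrib mult_ac)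
qed

text \<open>Both tuples are scalings of one tuple \<open>z\<close> over the closure. The two scalars
  cancel when the relations for \<open>i\<close> and \<open>i0\<close> are multiplied crosswise,
  which leaves an equation between elements of the base field.\<close>

lemma represents_proportional:
  fixes x y :: "'n::finite \<Rightarrow> 'a::field_char_0"
  assumes p: "p \<in> weighted_projective_space q" and x: "represents x p" and y: "represents y p"
  shows "\<exists>i0 \<nu>. x i0 \<noteq> 0 \<and> \<nu> \<noteq> 0 \<and> (\<forall>i. y i ^ q i0 = \<nu> ^ q i * x i ^ q i0)"
proof -
  obtain z where z: "p = weighted_equiv q `` {z}"
    using p by (auto simp: weighted_projective_space_def quotient_def)
  obtain l where l: "l \<noteq> 0" "\<And>i. to_ac (x i) = l ^ q i * z i" and z0: "\<exists>i. z i \<noteq> 0"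
    using x by (auto simp: represents_def z weighted_equiv_def)
  obtain m where m: "m \<noteq> 0" "\<And>i. to_ac (y i) = m ^ q i * z i"
    using y by (auto simp: represents_def z weighted_equiv_def)
  obtain i0 where i0: "z i0 \<noteq> 0" using z0 by blast
  have "to_ac (x i0) \<noteq> 0" "to_ac (y i0) \<noteq> 0" using l m i0 by simp_all
  then have xy0: "x i0 \<noteq> 0" "y i0 \<noteq> 0" by auto
  have "y i ^ q i0 = (y i0 / x i0) ^ q i * x i ^ q i0" for i
  proof -
    have "to_ac (y i ^ q i0 * x i0 ^ q i) = to_ac (y i0 ^ q i * x i ^ q i0)"
      by (simp only: to_ac_mult to_ac_power l m power_cross_mult)
    then have "y i ^ q i0 * x i0 ^ q i = y i0 ^ q i * x i ^ q i0" by (simp only: to_ac_eq_iff)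
    then show ?thesis using xy0 by (simp add: power_divide field_simps)
  qed
  then show ?thesis using xy0 by (intro exI[of _ i0] exI[of _ "y i0 / x i0"]) auto
qed

lemma represents_nonzero:
  assumes "p \<in> weighted_projective_space q" "represents x p"
  shows "\<exists>i. x i \<noteq> 0"
  using represents_proportional[OF assms assms(2)] by blast

context number_field_basis
begin

text \<open>For a nonzero tuple \<open>theta\<close> is 0 outside this finite set, so all finite
  factors there are 1 and \<open>prod'\<close> becomes an ordinary product.\<close>

definition weight_support :: "('n::finite \<Rightarrow> 'a) \<Rightarrow> 'a set set" where
  "weight_support x = {P. is_prime P \<and> (\<exists>i. x i \<noteq> 0 \<and> valuation P (x i) \<noteq> 0)}"

lemma finite_weight_support: "finite (weight_support x)"
proof -
  have "weight_support x = (\<Union>i\<in>{i. x i \<noteq> 0}. {P. is_prime P \<and> valuation P (x i) \<noteq> 0})"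
    by (auto simp: weight_support_def)
  then show ?thesis using finite_valuation_support by auto
qed

lemma theta_outside_support:
  assumes "is_prime P" "P \<notin> weight_support x" "\<exists>i. x i \<noteq> 0"
  shows "theta q x P = 0"
proof -
  have "(\<lambda>i. real_of_int (valuation P (x i)) / real (q i)) ` {i. x i \<noteq> 0} = {0}"
    using assms by (force simp: weight_support_def)
  then show ?thesis by (simp add: theta_def)
qed

text \<open>The norm exceeds 1, so the largest factor comes from the smallest weighted valuation;
  vanishing coordinates contribute 0, which is below it.\<close>

lemma local_height_Finite_Place:
  fixes x :: "'n::finite \<Rightarrow> 'a"
  assumes P: "is_prime P" and x: "\<exists>i. x i \<noteq> 0" and q: "\<And>i. q i > 0"
  shows "local_height q x (Finite_Place P) = real (ideal_norm P) powr (- theta q x P)"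
  unfolding local_height_def
proof (rule Max_eqI)
  have N: "real (ideal_norm P) \<ge> 2" using ideal_norm_ge_2[OF P] by simp
  have eq: "normalized_abs (Finite_Place P) (x i) powr (1 / real (q i)) =
      real (ideal_norm P) powr (- (real_of_int (valuation P (x i)) / real (q i)))" if "x i \<noteq> 0" for i
    using that N q[of i] by (simp add: powr_real_of_int' powr_powr flip: powr_real_of_int')
  let ?A = "(\<lambda>i. real_of_int (valuation P (x i)) / real (q i)) ` {i. x i \<noteq> 0}"
  have fin: "finite ?A" "?A \<noteq> {}" using x by auto
  fix t assume "t \<in> range (\<lambda>i. normalized_abs (Finite_Place P) (x i) powr (1 / real (q i)))"
  then obtain i where t: "t = normalized_abs (Finite_Place P) (x i) powr (1 / real (q i))" by auto
  show "t \<le> real (ideal_norm P) powr (- theta q x P)"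
  proof (cases "x i = 0")
    case False
    then have "theta q x P \<le> real_of_int (valuation P (x i)) / real (q i)"
      unfolding theta_def using fin by (intro Min_le) auto
    then show ?thesis unfolding t eq[OF False] using N by (intro powr_mono) auto
  qed (simp add: t)
next
  have N: "real (ideal_norm P) \<ge> 2" using ideal_norm_ge_2[OF P] by simp
  let ?A = "(\<lambda>i. real_of_int (valuation P (x i)) / real (q i)) ` {i. x i \<noteq> 0}"
  have "theta q x P \<in> ?A" unfolding theta_def using x by (intro Min_in) auto
  then obtain i where i: "x i \<noteq> 0" "theta q x P = real_of_int (valuation P (x i)) / real (q i)" by auto
  have "normalized_abs (Finite_Place P) (x i) powr (1 / real (q i)) = real (ideal_norm P) powr (- theta q x P)"
    using i N q[of i] by (simp add: powr_powr flip: powr_real_of_int')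
  then show "real (ideal_norm P) powr (- theta q x P) \<in> range (\<lambda>i. normalized_abs (Finite_Place P) (x i) powr (1 / real (q i)))"
    by (rule range_eqI[OF sym])
qed simp

lemma prod'_places:
  fixes f :: "'a place \<Rightarrow> real"
  assumes S: "finite S" "S \<subseteq> {P. is_prime P}" "\<And>P. is_prime P \<Longrightarrow> P \<notin> S \<Longrightarrow> f (Finite_Place P) = 1"
  shows "prod' f places = (\<Prod>P\<in>S. f (Finite_Place P)) * (\<Prod>v\<in>arch_places. f (Arch_Place v))"
proof -
  have "prod' f places = prod f (Finite_Place ` S \<union> Arch_Place ` arch_places)"
    by (rule prod'_eq_prod) (use S finite_arch_places in \<open>auto simp: places_def finite_places_eq\<close>)
  also have "\<dots> = prod f (Finite_Place ` S) * prod f (Arch_Place ` arch_places)"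
    by (rule prod.union_disjoint) (use S finite_arch_places in auto)
  also have "\<dots> = (\<Prod>P\<in>S. f (Finite_Place P)) * (\<Prod>v\<in>arch_places. f (Arch_Place v))"
    by (simp add: prod.reindex inj_on_def)
  finally show ?thesis .
qed

lemma arch_embedding: "v \<in> arch_places \<Longrightarrow> \<exists>\<sigma>\<in>complex_embeddings. \<forall>x. arch_abs v x = cmod (\<sigma> (x :: 'a))"
  using arch_placeE(1) unfolding arch_abs_def by blast

lemma arch_local_degree_pos: "v \<in> arch_places \<Longrightarrow> arch_local_degree (v :: ('a \<Rightarrow> complex) set) > 0"
  using arch_local_degree_eq arch_placeE(2) by (metis card_gt_0_iff empty_not_insert finite.simps)

lemma normalized_abs_mult:
  assumes "v \<in> places"
  shows "normalized_abs v (x * y) = normalized_abs v x * normalized_abs v (y :: 'a)"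
proof (cases v)
  case (Finite_Place P)
  then have P: "is_prime P" using assms by (auto simp: places_def finite_places_eq)
  then show ?thesis
    using ideal_norm_ge_2[OF P] valuation_mult[OF P] by (simp add: Finite_Place power_int_add power_int_diff power_int_minus field_simps)
next
  case (Arch_Place w)
  then have w: "w \<in> arch_places" using assms by (auto simp: places_def)
  obtain \<sigma> where \<sigma>: "\<sigma> \<in> complex_embeddings" "\<And>x. arch_abs w x = cmod (\<sigma> x)" using arch_embedding[OF w] by blast
  show ?thesis by (simp add: Arch_Place \<sigma>(2) embedding_mult[OF \<sigma>(1)] norm_mult power_mult_distrib)
qed

lemma normalized_abs_pos_iff:
  assumes "v \<in> places"
  shows "normalized_abs v x > 0 \<longleftrightarrow> x \<noteq> (0 :: 'a)" and "normalized_abs v x \<ge> 0"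
proof -
  have "(normalized_abs v x > 0 \<longleftrightarrow> x \<noteq> 0) \<and> normalized_abs v x \<ge> 0"
  proof (cases v)
    case (Finite_Place P)
    then have P: "is_prime P" using assms by (auto simp: places_def finite_places_eq)
    then show ?thesis using ideal_norm_ge_2[OF P] by (simp add: Finite_Place)
  next
    case (Arch_Place w)
    then have w: "w \<in> arch_places" using assms by (auto simp: places_def)
    obtain \<sigma> where \<sigma>: "\<sigma> \<in> complex_embeddings" "\<And>x. arch_abs w x = cmod (\<sigma> x)" using arch_embedding[OF w] by blast
    show ?thesis
      using arch_local_degree_pos[OF w] by (auto simp: Arch_Place \<sigma>(2) zero_less_power_eq embedding_eq_0_iff[OF \<sigma>(1)])
  qed
  then show "normalized_abs v x > 0 \<longleftrightarrow> x \<noteq> 0" "normalized_abs v x \<ge> 0" by auto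
qed

lemma normalized_abs_power:
  assumes "v \<in> places" "x \<noteq> (0 :: 'a) \<or> n > 0"
  shows "normalized_abs v (x ^ n) = normalized_abs v x ^ n"
proof -
  have 1: "normalized_abs v 1 = 1"
    using normalized_abs_mult[OF assms(1), of 1 1] normalized_abs_pos_iff(1)[OF assms(1), of 1] by simp
  show ?thesis by (induction n) (auto simp: normalized_abs_mult[OF assms(1)] 1)
qed

lemma local_height_proportional:
  assumes v: "v \<in> places" and q: "\<And>i. q i > 0" and \<nu>: "\<nu> \<noteq> (0 :: 'a)"
    and eq: "\<And>i. y i ^ k = \<nu> ^ q i * x i ^ k" and k: "k > 0"
  shows "local_height q y v = normalized_abs v \<nu> powr (1 / real k) * local_height q x v"
proof -
  let ?c = "normalized_abs v \<nu> powr (1 / real k)"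
  let ?f = "\<lambda>i. normalized_abs v (x i) powr (1 / real (q i))"
  have "normalized_abs v (y i) powr (1 / real (q i)) = ?c * ?f i" for i
  proof (rule powr_inverse_eq)
    show "normalized_abs v (y i) ^ k = normalized_abs v \<nu> ^ q i * normalized_abs v (x i) ^ k"
      using arg_cong[OF eq[of i], of "normalized_abs v"] k q[of i]
      by (simp add: normalized_abs_mult[OF v] normalized_abs_power[OF v])
  qed (use normalized_abs_pos_iff[OF v] q k \<nu> in auto)
  then have "local_height q y v = Max ((*) ?c ` range ?f)"
    by (simp add: local_height_def image_image)
  also have "\<dots> = ?c * Max (range ?f)"
    by (rule mono_Max_commute[symmetric]) (auto simp: mono_def mult_left_mono)
  finally show ?thesis by (simp add: local_height_def)
qed

theorem prod_local_height_proportional: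
  fixes x y :: "'n::finite \<Rightarrow> 'a"
  assumes x: "\<exists>i. x i \<noteq> 0" and q: "\<And>i. q i > 0" and \<nu>: "\<nu> \<noteq> 0"
    and eq: "\<And>i. y i ^ k = \<nu> ^ q i * x i ^ k" and k: "k > 0"
  shows "prod' (local_height q y) places = prod' (local_height q x) places"
proof -
  \<comment> \<open>These primes cover both \<open>x\<close> and \<open>\<nu>\<close>, and hence
    \<open>y\<close>.\<close>
  define S where "S = weight_support x \<union> {P. is_prime P \<and> valuation P \<nu> \<noteq> 0}"
  have S: "finite S" "S \<subseteq> {P. is_prime P}"
    using finite_weight_support finite_valuation_support[OF \<nu>] by (auto simp: S_def weight_support_def)
  let ?c = "\<lambda>v. normalized_abs v \<nu>"
  have LH: "local_height q y v = ?c v powr (1 / real k) * local_height q x v" if "v \<in> places" for v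
    using local_height_proportional[OF that q \<nu> eq k] .
  have fin: "Finite_Place P \<in> places" if "is_prime P" for P :: "'a set"
    using that by (simp add: places_def finite_places_eq)
  have arch: "Arch_Place v \<in> places" if "v \<in> arch_places" for v :: "('a \<Rightarrow> complex) set"
    using that by (simp add: places_def)
  have xo: "local_height q x (Finite_Place P) = 1" if "is_prime P" "P \<notin> S" for P
    using local_height_Finite_Place[OF that(1) x q] theta_outside_support[OF that(1) _ x, of q] that
      ideal_norm_ge_2[OF that(1)] by (simp add: S_def)
  have co: "?c (Finite_Place P) = 1" if "is_prime P" "P \<notin> S" for P
    using that \<nu> by (simp add: S_def)
  have yo: "local_height q y (Finite_Place P) = 1" if "is_prime P" "P \<notin> S" for P
    using LH[OF fin[OF that(1)]] xo[OF that] co[OF that] by simp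
  have "prod' (local_height q y) places =
      (\<Prod>P\<in>S. local_height q y (Finite_Place P)) * (\<Prod>v\<in>arch_places. local_height q y (Arch_Place v))"
    by (rule prod'_places[of S "local_height q y", OF S yo])
  also have "(\<Prod>P\<in>S. local_height q y (Finite_Place P)) =
      (\<Prod>P\<in>S. ?c (Finite_Place P) powr (1 / real k)) * (\<Prod>P\<in>S. local_height q x (Finite_Place P))"
    unfolding prod.distrib[symmetric] by (rule prod.cong[OF refl LH[OF fin]]) (use S in auto)
  also have "(\<Prod>v\<in>arch_places. local_height q y (Arch_Place v)) =
      (\<Prod>v\<in>arch_places. ?c (Arch_Place v) powr (1 / real k)) * (\<Prod>v\<in>arch_places. local_height q x (Arch_Place v))"
    unfolding prod.distrib[symmetric] by (rule prod.cong[OF refl LH[OF arch]])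
  also have "(\<Prod>P\<in>S. ?c (Finite_Place P) powr (1 / real k)) = (\<Prod>P\<in>S. ?c (Finite_Place P)) powr (1 / real k)"
    by (rule prod_powr_distrib[symmetric])
  also have "(\<Prod>v\<in>arch_places. ?c (Arch_Place v) powr (1 / real k)) = (\<Prod>v\<in>arch_places. ?c (Arch_Place v)) powr (1 / real k)"
    by (rule prod_powr_distrib[symmetric])
  finally have "prod' (local_height q y) places =
      ((\<Prod>P\<in>S. ?c (Finite_Place P)) powr (1 / real k) * (\<Prod>v\<in>arch_places. ?c (Arch_Place v)) powr (1 / real k)) *
      ((\<Prod>P\<in>S. local_height q x (Finite_Place P)) * (\<Prod>v\<in>arch_places. local_height q x (Arch_Place v)))"
    by (simp only: mult_ac)
  also have "(\<Prod>P\<in>S. ?c (Finite_Place P)) powr (1 / real k) * (\<Prod>v\<in>arch_places. ?c (Arch_Place v)) powr (1 / real k) =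
      ((\<Prod>P\<in>S. ?c (Finite_Place P)) * (\<Prod>v\<in>arch_places. ?c (Arch_Place v))) powr (1 / real k)"
    by (rule powr_mult[symmetric])
  also have "(\<Prod>P\<in>S. ?c (Finite_Place P)) * (\<Prod>v\<in>arch_places. ?c (Arch_Place v)) = 1"
    using product_formula_embeddings[OF \<nu> S] \<nu> prod_arch_places[of \<nu>] by (simp add: S_def)
  also have "(\<Prod>P\<in>S. local_height q x (Finite_Place P)) * (\<Prod>v\<in>arch_places. local_height q x (Arch_Place v)) =
      prod' (local_height q x) places"
    by (rule prod'_places[of S "local_height q x", OF S xo, symmetric])
  finally show ?thesis by simp
qed

theorem defect_identity:
  fixes x :: "'n::finite \<Rightarrow> 'a"
  assumes p: "p \<in> rational_points q" and x: "represents x p" and q: "\<And>i. q i > 0"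
  shows "weighted_height q p = tautological_height q x / defect q x"
    and "weighted_height q p \<le> tautological_height q x"
    and "weighted_height q p = tautological_height q x \<longleftrightarrow> (\<forall>P\<in>finite_places. theta q x P \<in> \<int>)"
proof -
  have p': "p \<in> weighted_projective_space q" using p by (simp add: rational_points_def)
  have x0: "\<exists>i. x i \<noteq> 0" by (rule represents_nonzero[OF p' x])
  define S where "S = weight_support x"
  have S: "finite S" "S \<subseteq> {P. is_prime P}" using finite_weight_support by (auto simp: S_def weight_support_def)
  let ?N = "\<lambda>P. real (ideal_norm P)" and ?\<theta> = "theta q x"
  have N: "?N P \<ge> 2" if "is_prime P" for P :: "'a set" using ideal_norm_ge_2[OF that] by simp
  have out: "?\<theta> P = 0" if "is_prime P" "P \<notin> S" for P
    using theta_outside_support[OF that(1) _ x0] that(2) by (simp add: S_def)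
  define A where "A = (\<Prod>v\<in>arch_places. local_height q x (Arch_Place v))"
  have A: "A > 0"
    unfolding A_def
  proof (rule prod_pos)
    fix v :: "('a \<Rightarrow> complex) set" assume "v \<in> arch_places"
    then have v: "Arch_Place v \<in> places" by (simp add: places_def)
    obtain i where "x i \<noteq> 0" using x0 by blast
    then have "0 < normalized_abs (Arch_Place v) (x i)" using normalized_abs_pos_iff(1)[OF v] by blast
    then have "0 < normalized_abs (Arch_Place v) (x i) powr (1 / real (q i))"
      by (simp del: normalized_abs.simps)
    also have "\<dots> \<le> local_height q x (Arch_Place v)"
      unfolding local_height_def by (intro Max_ge) auto
    finally show "0 < local_height q x (Arch_Place v)" .
  qed
  have taut: "tautological_height q x = (\<Prod>P\<in>S. ?N P powi (- \<lfloor>?\<theta> P\<rfloor>)) * A"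
    unfolding tautological_height_def A_def
    by (subst prod'_eq_prod[OF S(1)]) (use S out in \<open>auto simp: finite_places_eq\<close>)
  have def: "defect q x = (\<Prod>P\<in>S. ?N P powr (?\<theta> P - of_int \<lfloor>?\<theta> P\<rfloor>))"
    unfolding defect_def
  proof (rule prod'_eq_prod[OF S(1)])
    fix P :: "'a set" assume "P \<in> finite_places - S"
    then have "is_prime P" "?\<theta> P = 0" using out by (auto simp: finite_places_eq)
    then show "?N P powr (?\<theta> P - of_int \<lfloor>?\<theta> P\<rfloor>) = 1" using N[of P] by simp
  qed (use S in \<open>auto simp: finite_places_eq\<close>)
  have "weighted_height q p = prod' (local_height q x) places"
  proof -
    \<comment> \<open>\<open>y\<close> is the representative at which the definition evaluates the
      height.\<close>
    define y where "y = (SOME x :: 'n \<Rightarrow> 'a. represents x p)"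
    have "represents y p" unfolding y_def using x by (rule someI[of "\<lambda>x. represents x p"])
    from represents_proportional[OF p' x this]
    obtain i0 \<nu> where "\<nu> \<noteq> 0" "\<And>i. y i ^ q i0 = \<nu> ^ q i * x i ^ q i0" by blast
    from prod_local_height_proportional[OF x0 q this q] show ?thesis by (simp add: weighted_height_def y_def)
  qed
  also have "\<dots> = (\<Prod>P\<in>S. local_height q x (Finite_Place P)) * A"
    unfolding A_def
  proof (rule prod'_places[OF S])
    fix P :: "'a set" assume "is_prime P" "P \<notin> S"
    then show "local_height q x (Finite_Place P) = 1"
      using local_height_Finite_Place[OF _ x0 q] out N[of P] by simp
  qed
  also have "(\<Prod>P\<in>S. local_height q x (Finite_Place P)) =
      (\<Prod>P\<in>S. ?N P powi (- \<lfloor>?\<theta> P\<rfloor>) / ?N P powr (?\<theta> P - of_int \<lfloor>?\<theta> P\<rfloor>))"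
  proof (rule prod.cong)
    fix P assume "P \<in> S"
    then have P: "is_prime P" using S by auto
    have "?N P powi (- \<lfloor>?\<theta> P\<rfloor>) = ?N P powr (- of_int \<lfloor>?\<theta> P\<rfloor>)"
      using N[OF P] by (simp flip: powr_real_of_int')
    then show "local_height q x (Finite_Place P) = ?N P powi (- \<lfloor>?\<theta> P\<rfloor>) / ?N P powr (?\<theta> P - of_int \<lfloor>?\<theta> P\<rfloor>)"
      unfolding local_height_Finite_Place[OF P x0 q] by (simp add: powr_diff[symmetric])
  qed simp
  finally show wh: "weighted_height q p = tautological_height q x / defect q x"
    by (simp add: taut def prod_dividef)
  have taut_pos: "tautological_height q x > 0"
    unfolding taut using A N S by (intro mult_pos_pos prod_pos) (force simp: zero_less_power_int)+
  have factor: "?N P powr (?\<theta> P - of_int \<lfloor>?\<theta> P\<rfloor>) \<ge> 1" if "P \<in> S" for P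
    using N[of P] that S by (intro ge_one_powr_ge_zero) auto
  have ge1: "defect q x \<ge> 1" unfolding def by (rule prod_ge_1_eq_1_iff(1)[OF S(1) factor])
  show "weighted_height q p \<le> tautological_height q x"
    using ge1 taut_pos by (simp add: wh divide_le_eq mult_le_cancel_left1)
  \<comment> \<open>The positive tautological height cancels, leaving the condition that the defect
    is 1; since no factor of the defect is below 1, each of them must equal 1.\<close>
  have "weighted_height q p = tautological_height q x \<longleftrightarrow> defect q x = 1"
    using ge1 taut_pos by (auto simp: wh divide_eq_eq)
  also have "\<dots> \<longleftrightarrow> (\<forall>P\<in>S. ?N P powr (?\<theta> P - of_int \<lfloor>?\<theta> P\<rfloor>) = 1)"
    unfolding def by (rule prod_ge_1_eq_1_iff(2)[OF S(1) factor])
  also have "\<dots> \<longleftrightarrow> (\<forall>P\<in>S. ?\<theta> P \<in> \<int>)"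
  proof (rule ball_cong[OF refl])
    fix P assume "P \<in> S"
    then have "?N P \<ge> 2" using N S by auto
    then have "?N P powr (?\<theta> P - of_int \<lfloor>?\<theta> P\<rfloor>) = 1 \<longleftrightarrow> frac (?\<theta> P) = 0"
      by (simp add: powr_eq_one_iff_gen frac_def)
    then show "?N P powr (?\<theta> P - of_int \<lfloor>?\<theta> P\<rfloor>) = 1 \<longleftrightarrow> ?\<theta> P \<in> \<int>" by simp
  qed
  also have "\<dots> \<longleftrightarrow> (\<forall>P\<in>finite_places. ?\<theta> P \<in> \<int>)"
    using out S by (auto simp: finite_places_eq)
  finally show "weighted_height q p = tautological_height q x \<longleftrightarrow> (\<forall>P\<in>finite_places. ?\<theta> P \<in> \<int>)" .
qed

end

section \<open>The rational case\<close>

lemma number_field_rat: "number_field TYPE(rat)"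
  unfolding number_field_def
proof
  have "Vector_Spaces.vector_space (\<lambda>(r::rat) (x::rat). of_rat r * x)"
    by unfold_locales (auto simp: algebra_simps)
  then interpret V: Vector_Spaces.vector_space "\<lambda>(r::rat) (x::rat). of_rat r * x" .
  show "finite_dimensional_vector_space (\<lambda>(r::rat) (x::rat). of_rat r * x) {1}"
  proof unfold_locales
    have "x \<in> V.span {1}" for x using V.span_scale[OF V.span_base[of 1 "{1}"], of x] by simp
    then show "V.span {1} = UNIV" by blast
    show "\<not> V.dependent {1}" by (simp only: V.dependent_single)
  qed simp
qed

lemma algebraic_int_rat_iff: "algebraic_int (x :: rat) \<longleftrightarrow> (\<exists>k. x = of_int k)"
proof
  assume "algebraic_int x"
  moreover have "x \<in> \<rat>" using Rats_of_rat[of x, where 'a = rat] by simp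
  ultimately show "\<exists>k. x = of_int k" using rational_algebraic_int_is_int[of x] by (auto elim: Ints_cases)
qed auto

text \<open>Only one direction of the correspondence enters: a prime number gives a finite place.
  Arbitrary places are treated without classifying them.\<close>

definition rat_prime :: "int \<Rightarrow> rat set" where
  "rat_prime p = (*) (of_int p) ` algints"

lemma of_int_mem_scale_algints: "rat_of_int k \<in> (*) (of_int m) ` algints \<longleftrightarrow> m dvd k"
proof
  assume "rat_of_int k \<in> (*) (of_int m) ` algints"
  then obtain l where "rat_of_int k = of_int (m * l)" by (auto simp: algebraic_int_rat_iff)
  then show "m dvd k" by (simp only: of_int_eq_iff) simp
qed (auto elim!: dvdE)

lemma of_int_mem_rat_prime: "of_int k \<in> rat_prime p \<longleftrightarrow> p dvd k"
  unfolding rat_prime_def by (rule of_int_mem_scale_algints)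

lemma is_prime_rat_prime:
  assumes "prime p"
  shows "is_prime (rat_prime p)"
proof -
  have "is_ideal (rat_prime p)" unfolding rat_prime_def by (rule is_ideal_principal) simp
  moreover have "1 \<notin> rat_prime p" using of_int_mem_rat_prime[of 1 p] assms by auto
  moreover have "of_int p \<in> rat_prime p" by (simp add: of_int_mem_rat_prime)
  then have "rat_prime p \<noteq> {0}" using assms by (metis not_prime_0 of_int_eq_0_iff singletonD)
  moreover have "x \<in> rat_prime p \<or> y \<in> rat_prime p"
    if "algebraic_int x" "algebraic_int y" "x * y \<in> rat_prime p" for x y
  proof -
    from that(1,2) obtain k l where kl: "x = of_int k" "y = of_int l"
      unfolding algebraic_int_rat_iff by blast
    then have "p dvd k * l" using that(3) of_int_mem_rat_prime[of "k * l" p] by simp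
    then show ?thesis using assms prime_dvd_mult_iff kl of_int_mem_rat_prime by blast
  qed
  ultimately show ?thesis by (auto simp: is_prime_def)
qed

text \<open>This converts an order at the place of \<open>p\<close> into divisibility by a power of
  \<open>p\<close>, the form that \<open>wgcd\<close> speaks about.\<close>

lemma ipow_rat_prime: "ipow (rat_prime p) m \<subseteq> (*) (of_int (p ^ m)) ` algints"
proof (induction m)
  case (Suc m)
  have "iprod (ipow (rat_prime p) m) (rat_prime p) \<subseteq> (*) (of_int (p ^ Suc m)) ` algints"
  proof (rule iprod_subset[OF zsub_scale[OF zsub_algints]])
    fix x y assume "x \<in> ipow (rat_prime p) m" "y \<in> rat_prime p"
    then obtain a b where ab: "algebraic_int a" "algebraic_int b" "x = of_int (p ^ m) * a" "y = of_int p * b"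
      using Suc unfolding rat_prime_def by blast
    have "x * y = of_int (p ^ Suc m) * (a * b)" by (simp add: ab mult_ac)
    then show "x * y \<in> (*) (of_int (p ^ Suc m)) ` algints" using ab by blast
  qed
  then show ?case by simp
qed simp

text \<open>By Bezout the gcd is an integer combination of the elements.\<close>

lemma Gcd_mem_int_ideal:
  fixes J :: "int set"
  assumes J: "0 \<in> J" "\<And>a b u v. a \<in> J \<Longrightarrow> b \<in> J \<Longrightarrow> u * a + v * b \<in> J"
    and A: "finite A" "A \<subseteq> J"
  shows "Gcd A \<in> J"
  using A
proof (induction A)
  case (insert a A)
  obtain u v where "u * a + v * Gcd A = gcd a (Gcd A)" using bezout_int by blast
  then show ?case using J(2)[of a "Gcd A" u v] insert by simp
qed (simp add: J(1))

text \<open>Positive weights give that an admissible \<open>d\<close> is at most the absolute value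
  of a nonzero coordinate, so the maximum is taken over a finite set.\<close>

lemma wgcd_ge:
  fixes x :: "'n::finite \<Rightarrow> int"
  assumes x: "x i0 \<noteq> 0" and q: "\<And>i. q i > 0" and d: "d > 0" "\<And>i. int d ^ q i dvd x i"
  shows "d \<le> wgcd q x"
  unfolding wgcd_def
proof (rule Max_ge)
  have "d \<le> nat \<bar>x i0\<bar>" if "d > 0" "int d ^ q i0 dvd x i0" for d
  proof -
    have "int d ^ 1 \<le> int d ^ q i0" using that q[of i0] by (intro power_increasing) auto
    also have "\<dots> \<le> \<bar>x i0\<bar>" using dvd_imp_le_int[OF x that(2)] by simp
    finally show ?thesis by simp
  qed
  then have "{d. d > 0 \<and> (\<forall>i. int d ^ q i dvd x i)} \<subseteq> {..nat \<bar>x i0\<bar>}" by blast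
  then show "finite {d. d > 0 \<and> (\<forall>i. int d ^ q i dvd x i)}" using finite_subset by blast
  show "d \<in> {d. d > 0 \<and> (\<forall>i. int d ^ q i dvd x i)}" using d by blast
qed

text \<open>With gcd 1, every \<open>P\<close> misses some coordinate, and \<open>theta\<close> is
  0. Conversely a prime \<open>p\<close> dividing all coordinates makes \<open>theta\<close>
  positive at its place; an integral value is then at least 1, so \<open>p ^ q j\<close> divides
  each \<open>x j\<close>, against \<open>wgcd\<close> equal to 1.\<close>

lemma theta_int_iff_Gcd:
  fixes x :: "'n::finite \<Rightarrow> int"
  assumes x0: "\<exists>i. x i \<noteq> 0" and q: "\<And>i. q i > 0" and wgcd: "wgcd q x = 1"
  shows "(\<forall>P\<in>finite_places. theta q (\<lambda>i. rat_of_int (x i)) P \<in> \<int>) \<longleftrightarrow> Gcd (range x) = 1"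
proof -
  obtain B where "finite_dimensional_vector_space (\<lambda>(r::rat) (x::rat). of_rat r * x) B"
    using number_field_rat by (auto simp: number_field_def)
  then interpret number_field_basis B by (simp add: number_field_basis_def)
  let ?x = "\<lambda>i. rat_of_int (x i)"
  have val: "valuation P (?x i) = int (pord P (?x i))" if "is_prime P" "x i \<noteq> 0" for P i
    using valuation_pord[OF that(1)] that(2) by simp
  have mem: "?x i \<in> ipow P m \<longleftrightarrow> m \<le> pord P (?x i)" if "is_prime P" "x i \<noteq> 0" for P i m
    using mem_ipow_iff[OF that(1)] that(2) by simp
  show ?thesis
  proof
    assume G: "Gcd (range x) = 1"
    show "\<forall>P\<in>finite_places. theta q ?x P \<in> \<int>"
    proof
      fix P :: "rat set" assume "P \<in> finite_places"
      then have P: "is_prime P" by (simp add: finite_places_eq)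
      have I: "is_ideal P" using P by (rule is_prime_ideal)
      have "\<exists>i. ?x i \<notin> P"
      proof (rule ccontr)
        assume "\<not> ?thesis"
        then have "range x \<subseteq> {k. of_int k \<in> P}" by auto
        moreover have "of_int (u * a + v * b) \<in> P" if "of_int a \<in> P" "of_int b \<in> P" for a b u v
          using that ideal_add[OF I ideal_mult[OF I] ideal_mult[OF I]] by simp
        ultimately have "Gcd (range x) \<in> {k. of_int k \<in> P}"
          using ideal_0[OF I] by (intro Gcd_mem_int_ideal) auto
        then show False using G P by (simp add: is_prime_def)
      qed
      then obtain i where i: "?x i \<notin> P" by blast
      then have "x i \<noteq> 0" using ideal_0[OF I] by auto
      have "pord P (?x i) = 0" using mem[OF P \<open>x i \<noteq> 0\<close>, of 1] i ipow_1[OF I] by simp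
      have "theta q ?x P = 0"
        unfolding theta_def
      proof (rule Min_eqI)
        show "0 \<in> (\<lambda>i. real_of_int (valuation P (?x i)) / real (q i)) ` {i. ?x i \<noteq> 0}"
          using val[OF P \<open>x i \<noteq> 0\<close>] \<open>pord P (?x i) = 0\<close> \<open>x i \<noteq> 0\<close> by (intro rev_image_eqI[of i]) auto
      qed (use val[OF P] in auto)
      then show "theta q ?x P \<in> \<int>" by simp
    qed
  next
    assume int: "\<forall>P\<in>finite_places. theta q ?x P \<in> \<int>"
    show "Gcd (range x) = 1"
    proof (rule ccontr)
      assume "Gcd (range x) \<noteq> 1"
      then have "\<not> is_unit (Gcd (range x))" using Gcd_int_greater_eq_0[of "range x"] by auto
      moreover have "Gcd (range x) \<noteq> 0" using x0 by (auto simp: Gcd_0_iff)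
      ultimately obtain p where p: "prime p" "p dvd Gcd (range x)" using prime_divisor_exists by blast
      define P where "P = rat_prime p"
      have P: "is_prime P" unfolding P_def by (rule is_prime_rat_prime[OF p(1)])
      let ?A = "(\<lambda>i. real_of_int (valuation P (?x i)) / real (q i)) ` {i. ?x i \<noteq> 0}"
      have A: "finite ?A" "?A \<noteq> {}" using x0 by auto
      have "theta q ?x P \<in> ?A" unfolding theta_def by (rule Min_in[OF A])
      then obtain i where i: "x i \<noteq> 0" "theta q ?x P = real_of_int (valuation P (?x i)) / real (q i)" by auto
      have "p dvd x i" using p(2) by (meson Gcd_dvd dvd_trans rangeI)
      then have "?x i \<in> ipow P 1" using ipow_1[OF is_prime_ideal[OF P]] by (simp add: P_def of_int_mem_rat_prime)
      then have "1 \<le> pord P (?x i)" using mem[OF P i(1)] by blast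
      then have "theta q ?x P > 0" using q[of i] by (simp add: i(2) val[OF P i(1)])
      moreover have "theta q ?x P \<in> \<int>" using int P by (simp add: finite_places_eq)
      ultimately have ge1: "theta q ?x P \<ge> 1" by (auto elim!: Ints_cases)
      have "p ^ q j dvd x j" for j
      proof (cases "x j = 0")
        case False
        then have "theta q ?x P \<le> real_of_int (valuation P (?x j)) / real (q j)"
          unfolding theta_def using A by (intro Min_le) auto
        then have "1 \<le> real (pord P (?x j)) / real (q j)" using ge1 val[OF P False] by simp
        then have "q j \<le> pord P (?x j)" using q[of j] by (simp add: le_divide_eq)
        then have "?x j \<in> ipow P (q j)" using mem[OF P False] by blast
        then have "?x j \<in> (*) (of_int (p ^ q j)) ` algints" using ipow_rat_prime[of p "q j"] by (auto simp: P_def)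
        then show ?thesis by (simp only: of_int_mem_scale_algints)
      qed simp
      then have "nat p \<le> wgcd q x"
        using i(1) q prime_gt_0_int[OF p(1)] by (intro wgcd_ge) auto
      then show False using wgcd prime_gt_1_int[OF p(1)] by simp
    qed
  qed
qed

theorem proposition2:
  fixes q :: "'n::finite \<Rightarrow> nat"
  assumes "number_field TYPE('a::field_char_0)"
    and "\<And>i. q i > 0"
  shows "(\<forall>p \<in> rational_points q. \<forall>x :: 'n \<Rightarrow> 'a. represents x p \<longrightarrow>
           weighted_height q p = tautological_height q x / defect q x \<and>
           weighted_height q p \<le> tautological_height q x \<and>
           (weighted_height q p = tautological_height q x \<longleftrightarrow>
              (\<forall>P \<in> finite_places. theta q x P \<in> \<int>))) \<and>
         (\<forall>p \<in> rational_points q. \<forall>x :: 'n \<Rightarrow> int.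
           represents (\<lambda>i. rat_of_int (x i)) p \<and> wgcd q x = 1 \<longrightarrow>
           (weighted_height q p = tautological_height q (\<lambda>i. rat_of_int (x i)) \<longleftrightarrow>
              Gcd (range x) = 1))"
proof (intro conjI ballI allI impI)
  obtain B where "finite_dimensional_vector_space (\<lambda>(r::rat) (x::'a). of_rat r * x) B"
    using assms(1) by (auto simp: number_field_def)
  then interpret K: number_field_basis B by (simp add: number_field_basis_def)
  fix p and x :: "'n \<Rightarrow> 'a" assume p: "p \<in> rational_points q" "represents x p"
  note id = K.defect_identity[OF p assms(2)]
  show "weighted_height q p = tautological_height q x / defect q x" by (rule id(1))
  show "weighted_height q p \<le> tautological_height q x" by (rule id(2))
  show "weighted_height q p = tautological_height q x \<longleftrightarrow> (\<forall>P \<in> finite_places. theta q x P \<in> \<int>)"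
    by (rule id(3))
next
  obtain B where "finite_dimensional_vector_space (\<lambda>(r::rat) (x::rat). of_rat r * x) B"
    using number_field_rat by (auto simp: number_field_def)
  then interpret Q: number_field_basis B by (simp add: number_field_basis_def)
  fix p and x :: "'n \<Rightarrow> int"
  assume p: "p \<in> rational_points q" and x: "represents (\<lambda>i. rat_of_int (x i)) p \<and> wgcd q x = 1"
  have "\<exists>i. rat_of_int (x i) \<noteq> 0"
    by (rule represents_nonzero[of p q]) (use p x in \<open>auto simp: rational_points_def\<close>)
  then show "weighted_height q p = tautological_height q (\<lambda>i. rat_of_int (x i)) \<longleftrightarrow> Gcd (range x) = 1"
    using Q.defect_identity(3)[OF p _ assms(2)] theta_int_iff_Gcd[of x q] assms(2) x by simp
qed

end
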